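(* Let $\alpha,\beta,\gamma\ge0$ be integers with $\alpha+\beta+\gamma = k$, and define $M_{2\alpha,2\beta,2\gamma}(n)$ by $C_{2\alpha}(q)C_{2\beta}(q)C_{2\gamma}(q)P(q)^{-2}=\sum_n M_{2\alpha,2\beta,2\gamma}(n)q^n$. Then, as $n\to\infty$, \begin{align*} M_{2\alpha,2\beta,2\gamma}(n) =\ & \pi\xi_{2\alpha, 2\beta, 2\gamma}(24 n-1)^{k - 3/4} I_{3/2-2k}(y_{n})+ \xi'_{2\alpha,2\beta,2\gamma} (24n-1)^{k-5/4}I_{3/2-2k+1}(y_{n})\\ & +O\!\left(n^{k-7/4}\cdot n^{-1/4} \exp(y_n) \right), \end{align*} with $\xi_{2\alpha, 2\beta, 2\gamma} := \frac{1}{4} \xi_{2\alpha}\xi_{2\beta}\xi_{2\gamma}$ and $$ \xi_{2\alpha, 2\beta, 2\gamma}' := \frac14 \left( \xi_{2\alpha}'\xi_{2\beta}\xi_{2\gamma} + \xi_{2\alpha}\xi_{2\beta}'\xi_{2\gamma} + \xi_{2\alpha}\xi_{2\beta}\xi_{2\gamma}' \right). $$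
   Context: $P(q)=\prod_{n\ge1}(1-q^n)^{-1}$. Define integers $\mathcal{M}(m,n)$ by $\sum_{m\in\mathbb Z,\, n\ge0}\mathcal{M}(m,n)x^mq^n=\prod_{n\ge1}\frac{1-q^n}{(1-xq^n)(1-x^{-1}q^n)}$ (crank counts), the crank moments $M_{2j}(n):=\sum_m m^{2j}\mathcal{M}(m,n)$, and $C_{2j}(q):=\sum_n M_{2j}(n)q^n$. Set $\xi_{2j}:=(-1)^j\,2\,B_{2j}(1/2)$ with $B_n(x)$ the Bernoulli polynomials, $\xi'_0:=0$ and $\xi'_{2j}:=-\frac14(2j)(2j-1)\xi_{2j-2}$ for $j>0$. $y_n:=\frac{\pi}{6}\sqrt{24n-1}$, and $I_\nu$ is the modified Bessel function of the first kind. *)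

theory Defs
  imports "HOL-Complex_Analysis.Complex_Analysis" "HOL-Library.Landau_Symbols"
begin

section \<open>Generating functions\<close>

text \<open>
  Series in \<open>q\<close> are formal power series; infinite products are taken in the \<open>q\<close>-adic metric.
  The index of each product is shifted: \<open>n\<close> starts at \<open>0\<close> and the exponent is \<open>Suc n\<close>.
\<close>

definition partition_gf :: "real fps" where
  "partition_gf = (\<Prod>n. inverse (1 - fps_X ^ Suc n))"

text \<open>
  Real coefficients are used so that \<open>fps\<close> division is available; \<open>crank_count_in_Ints\<close> below
  shows that the crank counts are integers, and \<open>crank_count_eq_0\<close> that the sum over all
  \<open>m\<close> in \<open>crank_moment\<close> has finitely many nonzero terms.
  The two-variable series in \<open>x\<close> and \<open>q\<close> has coefficients (of the powers of \<open>q\<close>) that are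
  Laurent polynomials in \<open>x\<close>; they are represented as formal Laurent series in \<open>x = fls_X\<close>.
\<close>

definition crank_factor :: "nat \<Rightarrow> real fls fps" where
  "crank_factor n =
     (1 - fps_X ^ n) /
     ((1 - fps_const fls_X * fps_X ^ n) * (1 - fps_const fls_X_inv * fps_X ^ n))"

definition crank_gf :: "real fls fps" where
  "crank_gf = (\<Prod>n. crank_factor (Suc n))"

definition crank_count :: "int \<Rightarrow> nat \<Rightarrow> real" where
  "crank_count m n = fls_nth (fps_nth crank_gf n) m"

definition crank_moment :: "nat \<Rightarrow> nat \<Rightarrow> real" where
  "crank_moment r n = (\<Sum>\<^sub>\<infinity>m::int. of_int m ^ r * crank_count m n)"

definition crank_moment_gf :: "nat \<Rightarrow> real fps" where
  "crank_moment_gf r = Abs_fps (crank_moment r)"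

definition triple_crank_moment :: "nat \<Rightarrow> nat \<Rightarrow> nat \<Rightarrow> nat \<Rightarrow> real" where
  "triple_crank_moment a b c n =
     fps_nth (crank_moment_gf a * crank_moment_gf b * crank_moment_gf c
                * inverse (partition_gf ^ 2)) n"


section \<open>Constants and special functions\<close>

text \<open>\<open>t * exp (x * t) / (exp t - 1) = (\<Sum>n. B\<^sub>n(x) * t ^ n / n!)\<close>\<close>

definition bernoulli_poly :: "nat \<Rightarrow> real \<Rightarrow> real" where
  "bernoulli_poly n x = fact n * fps_nth (fps_X * fps_exp x / (fps_exp 1 - 1)) n"

text \<open>In \<open>xi\<close>, \<open>xi'\<close>, \<open>xi3\<close> and \<open>xi3'\<close>, the argument \<open>j\<close> stands for the subscript \<open>2j\<close>.\<close>

definition xi :: "nat \<Rightarrow> real" where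
  "xi j = (-1) ^ j * 2 * bernoulli_poly (2 * j) (1 / 2)"

definition xi' :: "nat \<Rightarrow> real" where
  "xi' j = (if j = 0 then 0
            else - (1 / 4) * real (2 * j) * (real (2 * j) - 1) * xi (j - 1))"

definition xi3 :: "nat \<Rightarrow> nat \<Rightarrow> nat \<Rightarrow> real" where
  "xi3 a b c = 1 / 4 * xi a * xi b * xi c"

definition xi3' :: "nat \<Rightarrow> nat \<Rightarrow> nat \<Rightarrow> real" where
  "xi3' a b c = 1 / 4 * (xi' a * xi b * xi c + xi a * xi' b * xi c + xi a * xi b * xi' c)"

definition y_arg :: "nat \<Rightarrow> real" where
  "y_arg n = pi / 6 * sqrt (24 * real n - 1)"

text \<open>
  The modified Bessel function of the first kind, for real order and \<open>z > 0\<close>; \<open>rGamma\<close> is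
  \<open>1/\<Gamma>\<close>, extended by \<open>0\<close> to the poles of \<open>\<Gamma>\<close>.
\<close>

definition bessel_I :: "real \<Rightarrow> real \<Rightarrow> real" where
  "bessel_I \<nu> z = (\<Sum>m. (z / 2) powr (2 * real m + \<nu>) * rGamma (real m + \<nu> + 1) / fact m)"


section \<open>The products converge, and the crank counts are integers with finite support\<close>

lemma fps_has_prod:
  fixes f :: "nat \<Rightarrow> 'a :: idom fps"
  assumes "\<And>n i. i \<le> n \<Longrightarrow> fps_nth (f n) i = fps_nth 1 i"
  shows "f has_prod Abs_fps (\<lambda>i. fps_nth (\<Prod>k\<le>i. f k) i)"
proof -
  have trunc: "fps_nth (F * f n) i = fps_nth F i" if "i \<le> n" for F n i
  proof -
    have "fps_nth (F * f n) i = (\<Sum>j=0..i. fps_nth F j * fps_nth 1 (i - j))"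
      unfolding fps_mult_nth by (intro sum.cong refl) (use assms that in auto)
    also have "\<dots> = fps_nth (F * 1) i" by (simp only: fps_mult_nth)
    finally show ?thesis by simp
  qed
  have stab: "fps_nth (\<Prod>k\<le>i + d. f k) i = fps_nth (\<Prod>k\<le>i. f k) i" for d i
  proof (induction d)
    case (Suc d)
    have "fps_nth ((\<Prod>k\<le>i + d. f k) * f (Suc (i + d))) i = fps_nth (\<Prod>k\<le>i + d. f k) i"
      by (rule trunc) simp
    with Suc show ?case by (simp add: mult.commute)
  qed simp
  let ?p = "Abs_fps (\<lambda>i. fps_nth (\<Prod>k\<le>i. f k) i)"
  have "(\<lambda>n. \<Prod>k\<le>n. f k) \<longlonglongrightarrow> ?p"
  proof (rule tendsto_fpsI)
    fix i
    show "\<forall>\<^sub>F n in sequentially. fps_nth (\<Prod>k\<le>n. f k) i = fps_nth ?p i"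
      using eventually_ge_at_top[of i]
    proof eventually_elim
      case (elim n)
      thus ?case using stab[of i "n - i"] by simp
    qed
  qed
  moreover have "fps_nth ?p 0 = 1"
    using assms[of 0 0] by simp
  hence "?p \<noteq> 0" by (metis fps_zero_nth zero_neq_one)
  ultimately show ?thesis
    unfolding has_prod_def raw_has_prod_def by auto
qed

lemma prodinf_fps:
  fixes f :: "nat \<Rightarrow> 'a :: idom fps"
  assumes "\<And>n i. i \<le> n \<Longrightarrow> fps_nth (f n) i = fps_nth 1 i"
  shows "f has_prod prodinf f" and "fps_nth (prodinf f) i = fps_nth (\<Prod>k\<le>i. f k) i"
proof -
  have *: "f has_prod Abs_fps (\<lambda>i. fps_nth (\<Prod>k\<le>i. f k) i)"
    by (rule fps_has_prod) (rule assms)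
  note eq = has_prod_unique[OF *, symmetric]
  show "f has_prod prodinf f" by (subst eq) (rule *)
  show "fps_nth (prodinf f) i = fps_nth (\<Prod>k\<le>i. f k) i"
    by (subst eq) (rule fps_nth_Abs_fps)
qed

definition one_mod :: "nat \<Rightarrow> 'a :: field fps \<Rightarrow> bool" where
  "one_mod N F \<longleftrightarrow> (\<exists>G. F = 1 + G * fps_X ^ N)"

lemma one_mod_mult: "one_mod N F \<Longrightarrow> one_mod N G \<Longrightarrow> one_mod N (F * G)"
proof -
  assume "one_mod N F" "one_mod N G"
  then obtain A B where "F = 1 + A * fps_X ^ N" "G = 1 + B * fps_X ^ N"
    by (auto simp: one_mod_def)
  hence "F * G = 1 + (A + B + A * B * fps_X ^ N) * fps_X ^ N" by (simp add: algebra_simps)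
  thus ?thesis unfolding one_mod_def by blast
qed

lemma one_mod_inverse:
  assumes "one_mod (Suc n) F"
  shows "one_mod (Suc n) (inverse F)"
proof -
  from assms obtain A where A: "F = 1 + A * fps_X ^ Suc n" by (auto simp: one_mod_def)
  have "inverse F * F = 1" using A by (intro inverse_mult_eq_1) simp
  hence "inverse F * (1 + A * fps_X ^ Suc n) = 1" by (simp only: A)
  hence "inverse F = 1 + (- inverse F * A) * fps_X ^ Suc n"
    by (simp only: distrib_left mult_1_right mult_minus_left mult.assoc eq_diff_eq
          diff_conv_add_uminus[symmetric])
  thus ?thesis unfolding one_mod_def by blast
qed

lemma one_mod_binomial: "one_mod N (1 - c * fps_X ^ N)"
  unfolding one_mod_def by (rule exI[of _ "- c"]) simp

lemma one_mod_nth: "one_mod (Suc n) F \<Longrightarrow> i \<le> n \<Longrightarrow> fps_nth F i = fps_nth 1 i"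
  by (auto simp: one_mod_def fps_X_power_mult_right_nth simp del: power_Suc)

lemma one_mod_crank_factor: "one_mod (Suc n) (crank_factor (Suc n))"
proof -
  have "one_mod (Suc n) (1 - fps_X ^ Suc n :: real fls fps)"
    using one_mod_binomial[of "Suc n" 1] by simp
  moreover have nz: "fps_nth ((1 - fps_const fls_X * fps_X ^ Suc n) *
      (1 - fps_const fls_X_inv * fps_X ^ Suc n) :: real fls fps) 0 \<noteq> 0" by simp
  ultimately show ?thesis
    unfolding crank_factor_def fps_divide_unit[OF nz]
    by (blast intro: one_mod_mult one_mod_inverse one_mod_binomial)
qed

lemma partition_gf_has_prod: "(\<lambda>n. inverse (1 - fps_X ^ Suc n)) has_prod partition_gf"
proof -
  have "one_mod (Suc n) (inverse (1 - fps_X ^ Suc n :: real fps))" for n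
    using one_mod_inverse[OF one_mod_binomial[of "Suc n" 1]] by (simp only: mult_1_left)
  thus ?thesis
    unfolding partition_gf_def by (rule prodinf_fps(1)[OF one_mod_nth])
qed

lemma crank_gf_has_prod: "(\<lambda>n. crank_factor (Suc n)) has_prod crank_gf"
  unfolding crank_gf_def by (rule prodinf_fps(1)[OF one_mod_nth[OF one_mod_crank_factor]])

definition int_laurent :: "nat \<Rightarrow> real fls \<Rightarrow> bool" where
  "int_laurent n a \<longleftrightarrow> (\<forall>m. fls_nth a m \<in> \<int> \<and> (fls_nth a m \<noteq> 0 \<longrightarrow> \<bar>m\<bar> \<le> int n))"

lemma int_laurent_mult:
  assumes a: "int_laurent i a" and b: "int_laurent j b"
  shows "int_laurent (i + j) (a * b)"
  unfolding int_laurent_def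
proof (intro allI conjI impI)
  fix m :: int
  have eq: "fls_nth (a * b) m =
      (\<Sum>l=fls_subdegree a..m - fls_subdegree b. fls_nth a l * fls_nth b (m - l))"
    by (rule fls_times_nth)
  show "fls_nth (a * b) m \<in> \<int>"
    unfolding eq using a b by (intro Ints_sum Ints_mult) (auto simp: int_laurent_def)
  assume "fls_nth (a * b) m \<noteq> 0"
  then obtain l where "fls_nth a l * fls_nth b (m - l) \<noteq> 0"
    unfolding eq by (meson sum.not_neutral_contains_not_neutral)
  hence "\<bar>l\<bar> \<le> int i" "\<bar>m - l\<bar> \<le> int j" using a b by (auto simp: int_laurent_def)
  thus "\<bar>m\<bar> \<le> int (i + j)" by simp
qed

lemma int_laurent_sum:
  fixes f :: "'b \<Rightarrow> real fls"
  assumes "\<And>i. i \<in> A \<Longrightarrow> int_laurent n (f i)"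
  shows "int_laurent n (\<Sum>i\<in>A. f i)"
  using assms
proof (induction A rule: infinite_finite_induct)
  case (insert x A)
  thus ?case unfolding int_laurent_def
    by (metis (no_types, lifting) Ints_add add_cancel_right_left fls_plus_nth insertCI
          sum.insert)
qed (auto simp: int_laurent_def)

lemma int_laurent_uminus: "int_laurent n a \<Longrightarrow> int_laurent n (- a)"
  by (auto simp: int_laurent_def)

definition int_laurent_fps :: "real fls fps \<Rightarrow> bool" where
  "int_laurent_fps F \<longleftrightarrow> (\<forall>n. int_laurent n (fps_nth F n))"

lemma int_laurent_fps_mult:
  assumes "int_laurent_fps F" "int_laurent_fps G"
  shows "int_laurent_fps (F * G)"
  unfolding int_laurent_fps_def fps_mult_nth
proof (intro allI int_laurent_sum)
  fix n i :: nat assume "i \<in> {0..n}"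
  thus "int_laurent n (fps_nth F i * fps_nth G (n - i))"
    using int_laurent_mult[of i "fps_nth F i" "n - i" "fps_nth G (n - i)"] assms
    by (auto simp: int_laurent_fps_def)
qed

lemma int_laurent_one: "int_laurent n 1"
  by (auto simp: int_laurent_def)

lemma int_laurent_fps_one: "int_laurent_fps 1"
  by (auto simp: int_laurent_fps_def int_laurent_def)

lemma int_laurent_fps_prod:
  "(\<And>i. i \<in> A \<Longrightarrow> int_laurent_fps (f i)) \<Longrightarrow> int_laurent_fps (\<Prod>i\<in>A. f i)"
  by (induction A rule: infinite_finite_induct)
     (auto intro: int_laurent_fps_mult int_laurent_fps_one)

lemma int_laurent_fps_inverse:
  assumes F: "int_laurent_fps F" and F0: "fps_nth F 0 = 1"
  shows "int_laurent_fps (inverse F)"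
  unfolding int_laurent_fps_def
proof
  fix n
  show "int_laurent n (fps_nth (inverse F) n)"
  proof (induction n rule: less_induct)
    case (less n)
    show ?case
    proof (cases n)
      case 0
      thus ?thesis using F0 by (simp add: int_laurent_one)
    next
      case (Suc k)
      have "inverse F * F = 1" using F0 by (intro inverse_mult_eq_1) simp
      hence "(\<Sum>i=0..n. fps_nth (inverse F) i * fps_nth F (n - i)) = 0"
        using Suc by (metis fps_mult_nth fps_one_nth nat.distinct(1))
      hence "fps_nth (inverse F) n = - (\<Sum>i<n. fps_nth (inverse F) i * fps_nth F (n - i))"
        using F0 by (simp add: atLeast0AtMost lessThan_Suc_atMost[symmetric] eq_neg_iff_add_eq_0
                       add.commute)
      moreover have "int_laurent n (fps_nth (inverse F) i * fps_nth F (n - i))" if "i < n" for i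
        using int_laurent_mult[OF less.IH[OF that], of "n - i" "fps_nth F (n - i)"] F that
        by (auto simp: int_laurent_fps_def)
      ultimately show ?thesis
        by (auto intro!: int_laurent_uminus int_laurent_sum)
    qed
  qed
qed

lemma int_laurent_fps_binomial:
  assumes "int_laurent 1 c"
  shows "int_laurent_fps (1 - fps_const c * fps_X ^ Suc n)"
  using assms
  by (auto simp: int_laurent_fps_def int_laurent_def fps_X_power_mult_right_nth fps_X_power_nth
           simp del: power_Suc split: if_splits)

lemma int_laurent_fps_crank_factor: "int_laurent_fps (crank_factor (Suc n))"
proof -
  have c: "int_laurent 1 1" "int_laurent 1 fls_X" "int_laurent 1 fls_X_inv"
    by (auto simp: int_laurent_def)
  show ?thesis
    unfolding crank_factor_def
    using int_laurent_fps_binomial[OF c(1), of n] int_laurent_fps_binomial[OF c(2), of n]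
      int_laurent_fps_binomial[OF c(3), of n]
    by (subst fps_divide_unit) 
       (auto intro!: int_laurent_fps_mult int_laurent_fps_inverse simp del: power_Suc)
qed

lemma int_laurent_fps_crank_gf: "int_laurent_fps crank_gf"
proof -
  have "fps_nth crank_gf n = fps_nth (\<Prod>k\<le>n. crank_factor (Suc k)) n" for n
    unfolding crank_gf_def by (rule prodinf_fps(2)[OF one_mod_nth[OF one_mod_crank_factor]])
  moreover have "int_laurent_fps (\<Prod>k\<le>n. crank_factor (Suc k))" for n
    by (intro int_laurent_fps_prod int_laurent_fps_crank_factor)
  ultimately show ?thesis by (auto simp: int_laurent_fps_def)
qed

lemma crank_count_in_Ints: "crank_count m n \<in> \<int>"
  using int_laurent_fps_crank_gf
  by (auto simp: crank_count_def int_laurent_fps_def int_laurent_def)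

lemma crank_count_eq_0: "int n < \<bar>m\<bar> \<Longrightarrow> crank_count m n = 0"
  using int_laurent_fps_crank_gf
  by (force simp: crank_count_def int_laurent_fps_def int_laurent_def)

lemma crank_moment_altdef:
  "crank_moment r n = (\<Sum>m=-int n..int n. of_int m ^ r * crank_count m n)"
proof -
  have "crank_moment r n = (\<Sum>\<^sub>\<infinity>m\<in>{-int n..int n}. of_int m ^ r * crank_count m n)"
    unfolding crank_moment_def by (intro infsum_cong_neutral) (auto simp: crank_count_eq_0)
  thus ?thesis by simp
qed

end

(*
  The crank moments satisfy C_{2j} = P Q_j, where Q_j is a polynomial in the Eisenstein series
  sum_n sigma_{2i+1}(n) q^n, so the generating function of the triple moments is P Q_a Q_b Q_c.
  Put q = exp(-t) with |Im t| <= Re t.  Euler-Maclaurin summation of ln((1 - exp(-s)) / s) and of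
  its derivatives over the multiples of t gives
    ln P = pi^2 / (6 t) + ln(t) / 2 - ln(2 pi) / 2 - t / 24 + O(t^2)
  and first-order expansions of t^{2j} Q_j; modularity is not needed.  The leading coefficients
  satisfy the recursion of the Taylor coefficients of pi z / sin(pi z), which are the B_{2j}(1/2)
  up to scaling.
  In Cauchy's integral on the circle |q| = exp(-sigma), sigma = 2 pi / sqrt(24 n - 1), the arc
  |arg q| <= sigma yields truncated Hankel integrals for the two Bessel terms, and the
  rest of the circle is exponentially smaller.  All orders are half-integral, so the Hankel
  integrals are reduced to Gaussian integrals by the three-term recurrence.
*)
theory Submission
  imports Defs "HOL-Probability.Probability" "HOL-Real_Asymp.Real_Asymp"
begin

section \<open>Crank moments as formal power series\<close>

text \<open>Put X = sqrt(24 n - 1). The radius \<sigma> = 2 pi / X is the saddle point: there pi^2 /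
  (6 \<sigma>) and (n - 1/24) \<sigma> both equal \<kappa> = pi X / 12, and 2 \<kappa> is the Bessel
  argument; the term - t / 24 of ln P is what turns n into n - 1/24. With t = \<sigma> s the arc
  becomes the segment from 1 - i to 1 + i and the integrand a power of s times exp(\<kappa> (s +
  1/s)), so expansions are needed only in the sector. Two terms suffice: a remainder O(t^2) costs
  \<sigma>^2, and the Gaussian decay of the kernel along the segment gains 1 / sqrt \<kappa>, which
  is the factor n^(-1/4) of the error. Cutting Hankel's contour at 1 + i and 1 - i costs exp(3
  \<kappa> / 2), far below exp(2 \<kappa>). Two obstacles shape the details. Laurent coefficients in
  x cannot be evaluated at x = 1, so moments are linear functionals on them, on which multiplication
  by x^m acts through binomial sums. And Hankel's integral belongs to the order 2 k - 3/2, while the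
  theorem has its negative, so the comparison is set up for the negated order from the
  start.\<close>

lemma derivation_prod:
  fixes d :: "'a :: comm_ring_1 \<Rightarrow> 'a"
  assumes mult: "\<And>F G. d (F * G) = d F * G + F * d G" and one: "d 1 = 0"
    and "\<And>k. k \<in> A \<Longrightarrow> d (F k) = F k * G k"
  shows "d (\<Prod>k\<in>A. F k) = (\<Prod>k\<in>A. F k) * (\<Sum>k\<in>A. G k)"
  using assms(3)
  by (induction A rule: infinite_finite_induct) (simp_all add: one mult algebra_simps)

text \<open>The expansion of c X^n / (1 - c X^n): up to sign and eigenvalue, the contribution of a
  factor 1 - c X^n to a logarithmic derivative.\<close>

definition geo :: "'a :: field \<Rightarrow> nat \<Rightarrow> 'a fps" where
  "geo c n = Abs_fps (\<lambda>N. if n dvd N \<and> N > 0 then c ^ (N div n) else 0)"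

lemma geo_mult:
  assumes "n > 0"
  shows "geo c n * (1 - fps_const c * fps_X ^ n) = fps_const c * fps_X ^ n"
proof (rule fps_ext)
  fix N
  have "fps_nth (geo c n * (1 - fps_const c * fps_X ^ n)) N =
        fps_nth (geo c n) N - c * (if N < n then 0 else fps_nth (geo c n) (N - n))"
  proof -
    have "geo c n * (1 - fps_const c * fps_X ^ n) = geo c n - fps_const c * (geo c n * fps_X ^ n)"
      by (simp add: algebra_simps)
    thus ?thesis by (simp add: fps_X_power_mult_right_nth)
  qed
  \<comment> \<open>Consecutive multiples of n cancel; as \<open>geo\<close> has no constant term,
    only c at N = n survives.\<close>
  also have "\<dots> = (if N = n then c else 0)"
  proof (cases "N < n \<or> \<not> n dvd N")
    case True
    hence "\<not> n dvd N - n" if "\<not> N < n"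
      using that dvd_diffD[of n N n] by auto
    with True show ?thesis using assms by (auto simp: geo_def dest: nat_dvd_not_less)
  next
    case False
    then obtain m where "N = n * m" by auto
    with False assms obtain m' where "N = n * Suc m'" by (cases m) auto
    thus ?thesis using assms by (auto simp: geo_def)
  qed
  finally show "fps_nth (geo c n * (1 - fps_const c * fps_X ^ n)) N =
    fps_nth (fps_const c * fps_X ^ n) N"
    by (simp add: fps_X_power_nth)
qed

text \<open>Both x d/dx and q d/dq are derivations with the monomials c q^n as eigenvectors, so one
  computation with eigenvalues \<open>u\<close>, \<open>v\<close>, \<open>w\<close> serves for both.
  It differentiates the relation with cleared denominators and cancels them at the end.\<close>

lemma crank_factor_deriv:
  fixes d :: "real fls fps \<Rightarrow> real fls fps"
  assumes mult: "\<And>F G. d (F * G) = d F * G + F * d G" and "n > 0"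
    and a: "d (1 - fps_const 1 * fps_X ^ n) = - (fps_const u * (fps_const 1 * fps_X ^ n))"
    and b: "d (1 - fps_const fls_X * fps_X ^ n) = - (fps_const v * (fps_const fls_X * fps_X ^ n))"
    and c: "d (1 - fps_const fls_X_inv * fps_X ^ n) =
            - (fps_const w * (fps_const fls_X_inv * fps_X ^ n))"
  shows "d (crank_factor n) = crank_factor n *
     (fps_const v * geo fls_X n + fps_const w * geo fls_X_inv n - fps_const u * geo 1 n)"
proof -
  define B :: "real fls \<Rightarrow> real fls fps" where "B = (\<lambda>c. 1 - fps_const c * fps_X ^ n)"
  have nz: "fps_nth (B c) 0 \<noteq> 0" for c using \<open>n > 0\<close> by (simp add: B_def)
  hence B0: "B c \<noteq> 0" for c by (metis fps_zero_nth)
  have nz': "fps_nth (B fls_X * B fls_X_inv) 0 \<noteq> 0" using nz by simp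
  have f: "crank_factor n * (B fls_X * B fls_X_inv) = B 1"
    unfolding crank_factor_def
    by (subst fps_divide_unit)
       (use \<open>n > 0\<close> nz' in \<open>simp_all add: B_def mult.assoc inverse_mult_eq_1\<close>)
  have g: "fps_const c * fps_X ^ n = geo c n * B c" for c
    unfolding B_def by (rule geo_mult[OF \<open>n > 0\<close>, symmetric])
  have dB: "d (B 1) = - (fps_const u * (geo 1 n * B 1))"
     "d (B fls_X) = - (fps_const v * (geo fls_X n * B fls_X))"
     "d (B fls_X_inv) = - (fps_const w * (geo fls_X_inv n * B fls_X_inv))"
    unfolding g[symmetric] by (simp_all only: B_def a b c)
  have "d (B 1) = d (crank_factor n * (B fls_X * B fls_X_inv))" by (simp only: f)
  also have "\<dots> = d (crank_factor n) * (B fls_X * B fls_X_inv) - crank_factor n *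
     (B fls_X * B fls_X_inv) * (fps_const v * geo fls_X n + fps_const w * geo fls_X_inv n)"
    by (simp add: mult dB algebra_simps)
  finally have "d (crank_factor n) * (B fls_X * B fls_X_inv) =
     crank_factor n * (B fls_X * B fls_X_inv) *
     (fps_const v * geo fls_X n + fps_const w * geo fls_X_inv n - fps_const u * geo 1 n)"
    unfolding f dB by (simp add: algebra_simps)
  hence "d (crank_factor n) * (B fls_X * B fls_X_inv) =
     crank_factor n * (fps_const v * geo fls_X n + fps_const w * geo fls_X_inv n - fps_const u * geo 1 n)
     * (B fls_X * B fls_X_inv)"
    by (simp add: mult_ac)
  thus ?thesis using B0 by simp
qed

text \<open>The operator \<open>x d/dx\<close>, which raises the order of a moment by one.\<close>

definition xderiv :: "real fls \<Rightarrow> real fls" where "xderiv a = fls_X * fls_deriv a"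

lemma fls_nth_xderiv: "fls_nth (xderiv a) m = of_int m * fls_nth a m"
  by (simp add: xderiv_def fls_X_times_conv_shift)

lemma xderiv_simps:
  "xderiv (a * b) = xderiv a * b + a * xderiv b" "xderiv (a + b) = xderiv a + xderiv b"
  "xderiv 0 = 0" "xderiv (\<Sum>i\<in>A. f i) = (\<Sum>i\<in>A. xderiv (f i))"
proof -
  show add: "xderiv (a + b) = xderiv a + xderiv b" for a b
    by (simp add: xderiv_def algebra_simps)
  show "xderiv (a * b) = xderiv a * b + a * xderiv b"
    by (simp add: xderiv_def algebra_simps)
  show 0: "xderiv 0 = 0" by (simp add: xderiv_def)
  show "xderiv (\<Sum>i\<in>A. f i) = (\<Sum>i\<in>A. xderiv (f i))"
    by (induction A rule: infinite_finite_induct) (simp_all add: add 0)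
qed

text \<open>\<open>prodinf_fps\<close> cuts the product at the very index of the coefficient. Later
  factors do not change that coefficient, which gives one common cutoff N for all coefficients up to
  N.\<close>

lemma fps_nth_prodinf:
  assumes one: "\<And>k. one_mod (Suc k) (f k)" and "i \<le> N"
  shows "fps_nth (prodinf f) i = fps_nth (\<Prod>k\<le>N. f k) i"
  using assms(2)
proof (induction N rule: dec_induct)
  case base
  show ?case by (rule prodinf_fps(2)[OF one_mod_nth[OF one]])
next
  case (step N)
  obtain G where G: "f (Suc N) = 1 + G * fps_X ^ Suc (Suc N)"
    using one[of "Suc N"] unfolding one_mod_def by blast
  let ?P = "\<Prod>k\<le>N. f k"
  have "(\<Prod>k\<le>Suc N. f k) = ?P * f (Suc N)"
    by simp
  also have "\<dots> = ?P + ?P * G * fps_X ^ Suc (Suc N)"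
    unfolding G by (simp only: distrib_left mult_1_right mult.assoc)
  also have "fps_nth \<dots> i = fps_nth ?P i"
    using step(1) by (simp only: fps_add_nth fps_X_power_mult_right_nth) simp
  finally show ?case using step(3) by simp
qed

text \<open>No infinite sum of logarithmic derivatives is formed: by \<open>loc\<close>, coefficient
  N of \<open>d F\<close> sees only the coefficients of F up to N, so the product is cut at N before
  it is differentiated.\<close>

lemma prodinf_log_deriv:
  fixes d :: "'a :: field fps \<Rightarrow> 'a fps"
  assumes one_mod: "\<And>k. one_mod (Suc k) (f k)"
    and mult: "\<And>F G. d (F * G) = d F * G + F * d G"
    and one: "d 1 = 0"
    and fac: "\<And>k. d (f k) = f k * G k"
    and loc: "\<And>F F' N. (\<And>i. i \<le> N \<Longrightarrow> fps_nth F i = fps_nth F' i) \<Longrightarrow> fps_nth (d F) N = fps_nth (d F') N"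
  shows "fps_nth (d (prodinf f)) N =
    (\<Sum>i\<le>N. fps_nth (prodinf f) (N - i) * (\<Sum>k\<le>N. fps_nth (G k) i))"
proof -
  let ?P = "\<Prod>k\<le>N. f k"
  have "fps_nth (d (prodinf f)) N = fps_nth (d ?P) N"
    by (rule loc) (rule fps_nth_prodinf[OF one_mod])
  also have "d ?P = ?P * (\<Sum>k\<le>N. G k)"
    by (rule derivation_prod[OF mult one]) (rule fac)
  also have "fps_nth \<dots> N = fps_nth ((\<Sum>k\<le>N. G k) * ?P) N" by (simp add: mult.commute)
  also have "\<dots> = (\<Sum>i\<le>N. fps_nth (prodinf f) (N - i) * (\<Sum>k\<le>N. fps_nth (G k) i))"
    unfolding fps_mult_nth atLeast0AtMost
    by (intro sum.cong refl)
       (simp add: fps_nth_prodinf[OF one_mod, of _ N] fps_sum_nth mult.commute)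
  finally show ?thesis .
qed

lemmas crank_gf_log_deriv =
  prodinf_log_deriv[of "\<lambda>n. crank_factor (Suc n)", OF one_mod_crank_factor, folded crank_gf_def]

text \<open>Under x d/dx the monomials 1, x and 1/x have eigenvalues 0, 1 and -1; hence the
  numerators 1 - q^n drop out and the two geometric series enter with opposite signs.\<close>

lemma xderiv_crank:
  "xderiv (fps_nth crank_gf N) =
    (\<Sum>i\<le>N. fps_nth crank_gf (N - i) *
       (\<Sum>k\<le>N. fps_nth (geo fls_X (Suc k)) i - fps_nth (geo fls_X_inv (Suc k)) i))"
proof -
  define d :: "real fls fps \<Rightarrow> real fls fps" where "d = (\<lambda>F. Abs_fps (\<lambda>n. xderiv (fps_nth F n)))"
  have mult: "d (F * G) = d F * G + F * d G" for F G
    by (rule fps_ext) (simp add: d_def fps_mult_nth xderiv_simps sum.distrib)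
  have bin: "d (1 - fps_const c * fps_X ^ Suc k) = - (fps_const u * (fps_const c * fps_X ^ Suc k))"
    if "xderiv c = u * c" for c u k
  proof (rule fps_ext)
    fix n
    have "xderiv 1 = 0" "xderiv (- c) = - xderiv c" by (simp_all add: xderiv_def)
    thus "fps_nth (d (1 - fps_const c * fps_X ^ Suc k)) n =
        fps_nth (- (fps_const u * (fps_const c * fps_X ^ Suc k))) n"
      using that by (cases n) (simp_all add: d_def fps_X_power_nth xderiv_simps del: power_Suc)
  qed
  have x: "xderiv 1 = 0 * 1" "xderiv fls_X = 1 * fls_X" "xderiv fls_X_inv = (-1) * fls_X_inv"
    by (auto intro!: fls_eqI simp: fls_nth_xderiv)
  have fac: "d (crank_factor (Suc k)) = crank_factor (Suc k) * (geo fls_X (Suc k) -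
      geo fls_X_inv (Suc k))" for k
    using crank_factor_deriv[of d "Suc k" 0 1 "-1", OF mult _ bin[OF x(1)] bin[OF x(2)] bin[OF x(3)]]
    by (simp add: algebra_simps flip: fps_const_neg)
  have "xderiv (fps_nth crank_gf N) = fps_nth (d crank_gf) N" by (simp add: d_def)
  also have "\<dots> = (\<Sum>i\<le>N. fps_nth crank_gf (N - i) * (\<Sum>k\<le>N. fps_nth (geo fls_X (Suc k) -
      geo fls_X_inv (Suc k)) i))"
  proof (rule crank_gf_log_deriv[OF mult _ fac])
    show "d 1 = 0" by (rule fps_ext) (simp add: d_def xderiv_def)
    show "fps_nth (d F) N = fps_nth (d F') N" if "\<And>i. i \<le> N \<Longrightarrow> fps_nth F i = fps_nth F' i" for F F' N
      using that[of N] by (simp add: d_def)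
  qed
  finally show ?thesis by (simp only: fps_sub_nth)
qed

text \<open>Under q d/dq all three monomials in q^n have eigenvalue n, so the numerators contribute
  as well. This serves to identify the moments of order 0.\<close>

lemma qderiv_crank:
  "of_nat N * (fps_nth crank_gf N) =
    (\<Sum>i\<le>N. fps_nth crank_gf (N - i) *
       (\<Sum>k\<le>N. of_nat (Suc k) * (fps_nth (geo fls_X (Suc k)) i + fps_nth (geo fls_X_inv (Suc k)) i
         - fps_nth (geo 1 (Suc k)) i)))"
proof -
  define d :: "real fls fps \<Rightarrow> real fls fps" where "d = (\<lambda>F. fps_X * fps_deriv F)"
  have d: "fps_nth (d F) n = of_nat n * fps_nth F n" for F n
    by (cases n) (simp_all add: d_def)
  have mult: "d (F * G) = d F * G + F * d G" for F G
    by (simp add: d_def algebra_simps)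
  have bin: "d (1 - fps_const c * fps_X ^ Suc k) =
      - (fps_const (of_nat (Suc k)) * (fps_const c * fps_X ^ Suc k))" for c k
    by (rule fps_ext) (auto simp: d fps_X_power_nth simp del: power_Suc)
  have fac: "d (crank_factor (Suc k)) = crank_factor (Suc k) *
    (fps_const (of_nat (Suc k)) * geo fls_X (Suc k) + fps_const (of_nat (Suc k)) * geo fls_X_inv (Suc k)
     - fps_const (of_nat (Suc k)) * geo 1 (Suc k))" for k
    by (rule crank_factor_deriv[of d "Suc k", OF mult _ bin bin bin]) simp
  have "of_nat N * (fps_nth crank_gf N) = fps_nth (d crank_gf) N" by (simp add: d)
  also have "\<dots> = (\<Sum>i\<le>N. fps_nth crank_gf (N - i) * (\<Sum>k\<le>N. fps_nth (fps_const (of_nat (Suc k)) *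
      geo fls_X (Suc k) + fps_const (of_nat (Suc k)) * geo fls_X_inv (Suc k)
     - fps_const (of_nat (Suc k)) * geo 1 (Suc k)) i))"
  proof (rule crank_gf_log_deriv[OF mult _ fac])
    show "d 1 = 0" by (simp add: d_def)
    show "fps_nth (d F) N = fps_nth (d F') N" if "\<And>i. i \<le> N \<Longrightarrow> fps_nth F i = fps_nth F' i" for F F' N
      using that[of N] by (simp add: d)
  qed
  finally show ?thesis
    by (simp only: fps_sub_nth fps_add_nth fps_mult_left_const_nth distrib_left right_diff_distrib)
qed

section \<open>Divisor sums, and series determined by their logarithmic derivative\<close>

text \<open>The index \<open>Suc k\<close> runs over 1, ..., N + 1, and this range contains every
  divisor of i.\<close>

lemma sum_multiples:
  assumes "i \<le> N" "i > 0"
  shows "(\<Sum>k\<le>N. if Suc k dvd i then f (Suc k) else 0) = (\<Sum>d | d dvd i. f d)"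
proof -
  have "(\<Sum>k\<le>N. if Suc k dvd i then f (Suc k) else 0) = (\<Sum>k | k \<le> N \<and> Suc k dvd i. f (Suc k))"
    by (subst sum.inter_filter[symmetric]) simp_all
  also have "\<dots> = (\<Sum>d | d dvd i. f d)"
    using assms
    by (intro sum.reindex_bij_witness[of _ "\<lambda>d. d - 1" Suc])
       (auto dest: dvd_imp_le simp: Suc_diff_le le_diff_conv intro: Nat.gr0I)
  finally show ?thesis .
qed

lemma sum_codivisors:
  fixes i :: nat
  assumes "i > 0"
  shows "(\<Sum>d | d dvd i. f (i div d)) = (\<Sum>d | d dvd i. f d)"
  using assms
  by (intro sum.reindex_bij_witness[of _ "\<lambda>d. i div d" "\<lambda>d. i div d"]) auto

text \<open>The Lambert series with terms w(d) q^d / (1 - q^d); for w(d) = d^r with r odd it is an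
  Eisenstein series without its constant term.\<close>

definition divsum :: "(nat \<Rightarrow> 'a :: comm_ring_1) \<Rightarrow> 'a fps" where
  "divsum w = Abs_fps (\<lambda>n. if n = 0 then 0 else (\<Sum>d | d dvd n. w d))"

lemma partition_gf_0: "fps_nth partition_gf 0 = 1"
  unfolding partition_gf_def
  by (subst fps_nth_prodinf[of _ 0 0])
     (use one_mod_inverse[OF one_mod_binomial[of "Suc n" 1 for n]] in \<open>simp_all del: power_Suc\<close>)

text \<open>In coefficients this is Euler's recurrence expressing n p(n) by the products sigma(i)
  p(n - i).\<close>

lemma partition_gf_ode: "fps_X * fps_deriv partition_gf = divsum of_nat * partition_gf"
proof (rule fps_ext)
  fix N
  define d :: "real fps \<Rightarrow> real fps" where "d = (\<lambda>F. fps_X * fps_deriv F)"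
  have d: "fps_nth (d F) n = of_nat n * fps_nth F n" for F n
    by (cases n) (simp_all add: d_def)
  have om: "one_mod (Suc n) (inverse (1 - fps_X ^ Suc n :: real fps))" for n
    using one_mod_inverse[OF one_mod_binomial[of "Suc n" 1]] by (simp only: mult_1_left)
  have mult: "d (F * G) = d F * G + F * d G" for F G
    by (simp add: d_def algebra_simps)
  have fac: "d (inverse (1 - fps_X ^ Suc k)) =
       inverse (1 - fps_X ^ Suc k) * (fps_const (of_nat (Suc k)) * geo 1 (Suc k))" for k
  proof -
    define B :: "real fps" where "B = 1 - fps_X ^ Suc k"
    have inv: "inverse B * B = 1" by (intro inverse_mult_eq_1) (simp add: B_def)
    have "B \<noteq> 0" using inv by auto
    have g: "geo 1 (Suc k) * B = fps_X ^ Suc k"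
      using geo_mult[of "Suc k" "1::real"] by (simp add: B_def)
    have "d B = - (fps_const (of_nat (Suc k)) * fps_X ^ Suc k)"
      by (rule fps_ext) (auto simp: d B_def fps_X_power_nth simp del: power_Suc)
    moreover have "d (inverse B) * B + inverse B * d B = 0"
      using mult[of "inverse B" B] by (simp add: inv) (simp add: d_def)
    ultimately have "d (inverse B) * B = inverse B * (fps_const (of_nat (Suc k)) * geo 1 (Suc k)) * B"
      by (simp add: g mult.assoc del: power_Suc)
    thus ?thesis using \<open>B \<noteq> 0\<close> unfolding B_def[symmetric] by simp
  qed
  have "fps_nth (d partition_gf) N = (\<Sum>i\<le>N. fps_nth partition_gf (N - i) *
      (\<Sum>k\<le>N. fps_nth (fps_const (of_nat (Suc k)) * geo 1 (Suc k)) i))"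
    unfolding partition_gf_def
  proof (rule prodinf_log_deriv[OF om mult _ fac])
    show "d 1 = 0" by (simp add: d_def)
    show "fps_nth (d F) N = fps_nth (d F') N" if "\<And>i. i \<le> N \<Longrightarrow> fps_nth F i = fps_nth F' i" for F F' N
      using that[of N] by (simp add: d)
  qed
  also have "\<dots> = (\<Sum>i\<le>N. fps_nth partition_gf (N - i) * fps_nth (divsum of_nat) i)"
  proof (intro sum.cong refl arg_cong2[of _ _ _ _ "(*)"])
    fix i assume "i \<in> {..N}"
    show "(\<Sum>k\<le>N. fps_nth (fps_const (of_nat (Suc k)) * geo 1 (Suc k)) i) =
        (fps_nth (divsum of_nat) i :: real)"
      using sum_multiples[of i N "of_nat :: nat \<Rightarrow> real"] \<open>i \<in> {..N}\<close>
      by (cases "i = 0")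
         (auto simp: geo_def divsum_def if_distrib[where f = "\<lambda>x. _ * x"] cong: if_cong)
  qed
  also have "\<dots> = fps_nth (divsum of_nat * partition_gf) N"
    by (simp add: fps_mult_nth atLeast0AtMost) (simp add: mult.commute)
  finally show "fps_nth (fps_X * fps_deriv partition_gf) N = fps_nth (divsum of_nat * partition_gf) N"
    by (simp add: d_def)
qed

text \<open>As S has no constant term, coefficient n of the equation expresses n times the n-th
  coefficient by earlier ones. A series is thus recognised by its logarithmic derivative and
  constant term.\<close>

lemma fps_log_ode_unique:
  fixes F G :: "'a :: field_char_0 fps"
  assumes "fps_X * fps_deriv F = S * F" "fps_X * fps_deriv G = S * G"
    and "fps_nth F 0 = fps_nth G 0" and S0: "fps_nth S 0 = 0"
  shows "F = G"
proof (rule fps_ext)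
  fix n
  have rec: "of_nat n * fps_nth H n = (\<Sum>i=1..n. fps_nth S i * fps_nth H (n - i))"
    if "fps_X * fps_deriv H = S * H" for H n
  proof -
    have "of_nat n * fps_nth H n = fps_nth (fps_X * fps_deriv H) n" by (cases n) simp_all
    also have "\<dots> = (\<Sum>i=0..n. fps_nth S i * fps_nth H (n - i))" by (simp add: that fps_mult_nth)
    also have "\<dots> = (\<Sum>i=1..n. fps_nth S i * fps_nth H (n - i))"
      by (simp add: S0 sum.atLeast_Suc_atMost)
    finally show ?thesis .
  qed
  show "fps_nth F n = fps_nth G n"
  proof (induction n rule: less_induct)
    case (less n)
    show ?case
    proof (cases "n = 0")
      case False
      have "of_nat n * fps_nth F n = of_nat n * fps_nth G n"
        unfolding rec[OF assms(1)] rec[OF assms(2)]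
        by (intro sum.cong refl) (use False in \<open>auto intro!: less.IH\<close>)
      with False show ?thesis by simp
    qed (use assms in auto)
  qed
qed

section \<open>Moments as functionals on Laurent series of finite support\<close>

lemma has_sum_finite_sum:
  fixes f :: "'b \<Rightarrow> 'c \<Rightarrow> 'a :: topological_comm_monoid_add"
  shows "(\<And>i. i \<in> A \<Longrightarrow> (f i has_sum F i) S) \<Longrightarrow> ((\<lambda>x. \<Sum>i\<in>A. f i x) has_sum (\<Sum>i\<in>A. F i)) S"
  by (induction A rule: infinite_finite_induct) (auto intro: has_sum_add)

text \<open>Additivity of the infinite sums in \<open>moment\<close> rests on summability; finite
  support guarantees it for every power of m at once and is preserved by all operations used on the
  coefficients.\<close>

definition fin_supp :: "real fls \<Rightarrow> bool" where
  "fin_supp a \<longleftrightarrow> finite {m. fls_nth a m \<noteq> 0}"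

definition moment :: "nat \<Rightarrow> real fls \<Rightarrow> real" where
  "moment r a = (\<Sum>\<^sub>\<infinity>m::int. of_int m ^ r * fls_nth a m)"

lemma fin_supp_summable: "fin_supp a \<Longrightarrow> (\<lambda>m. f m * fls_nth a m) summable_on UNIV"
  by (intro finite_nonzero_values_imp_summable_on)
     (auto simp: fin_supp_def elim!: finite_subset[rotated])

lemma fin_supp_add: "fin_supp a \<Longrightarrow> fin_supp b \<Longrightarrow> fin_supp (a + b)"
  unfolding fin_supp_def by (rule finite_subset[of _ "{m. fls_nth a m \<noteq> 0} \<union> {m. fls_nth b m \<noteq> 0}"]) auto

lemma fin_supp_uminus: "fin_supp a \<Longrightarrow> fin_supp (- a)"
  by (simp add: fin_supp_def)

lemma fin_supp_0: "fin_supp 0"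
  by (simp add: fin_supp_def)

lemma fin_supp_sum: "(\<And>i. i \<in> A \<Longrightarrow> fin_supp (f i)) \<Longrightarrow> fin_supp (\<Sum>i\<in>A. f i)"
  by (induction A rule: infinite_finite_induct) (auto intro: fin_supp_0 fin_supp_add)

lemma fin_supp_shift: "fin_supp a \<Longrightarrow> fin_supp (fls_shift m a)"
  unfolding fin_supp_def
  by (rule finite_subset[of _ "(\<lambda>n. n - m) ` {m. fls_nth a m \<noteq> 0}"]) (auto simp: image_iff intro!: exI[of
      _ "_ + m"])

lemma fin_supp_of_nat_mult: "fin_supp a \<Longrightarrow> fin_supp (of_nat n * a)"
  unfolding fin_supp_def by (rule finite_subset[of _ "{m. fls_nth a m \<noteq> 0}"]) (auto simp: fls_of_nat)

lemma fin_supp_crank: "fin_supp (fps_nth crank_gf n)"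
  unfolding fin_supp_def
proof (rule finite_subset)
  show "{m. fls_nth (fps_nth crank_gf n) m \<noteq> 0} \<subseteq> {- int n..int n}"
    using crank_count_eq_0[of n] by (force simp: crank_count_def)
qed simp

lemma moment_0 [simp]: "moment r 0 = 0"
  by (simp add: moment_def)

lemma moment_add: "fin_supp a \<Longrightarrow> fin_supp b \<Longrightarrow> moment r (a + b) = moment r a + moment r b"
  unfolding moment_def by (simp add: distrib_left infsum_add fin_supp_summable)

lemma moment_uminus: "moment r (- a) = - moment r a"
  unfolding moment_def by (simp add: infsum_uminus)

lemma moment_diff: "fin_supp a \<Longrightarrow> fin_supp b \<Longrightarrow> moment r (a - b) = moment r a - moment r b"
  using moment_add[of a "-b" r] by (simp add: moment_uminus fin_supp_uminus)

lemma moment_sum: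
  "(\<And>i. i \<in> A \<Longrightarrow> fin_supp (f i)) \<Longrightarrow> moment r (\<Sum>i\<in>A. f i) = (\<Sum>i\<in>A. moment r (f i))"
  by (induction A rule: infinite_finite_induct) (auto simp: moment_add fin_supp_sum)

lemma moment_of_nat_mult: "moment r (of_nat n * a) = of_nat n * moment r a"
  unfolding moment_def by (simp add: fls_of_nat infsum_cmult_right' mult.left_commute)

lemma moment_xderiv: "moment r (xderiv a) = moment (Suc r) a"
  by (simp add: moment_def fls_nth_xderiv mult_ac)

text \<open>\<open>fls_shift (- m)\<close> is multiplication by x^m. It translates the support by m,
  and the binomial theorem for (m + l)^r does the rest.\<close>

lemma moment_shift:
  assumes "fin_supp a"
  shows "moment r (fls_shift (- m) a) = (\<Sum>i\<le>r. of_nat (r choose i) * of_int m ^ i * moment (r - i) a)"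
proof -
  have "moment r (fls_shift (- m) a) = (\<Sum>\<^sub>\<infinity>l. of_int (m + l) ^ r * fls_nth a l)"
    unfolding moment_def
    by (rule infsum_reindex_bij_witness[of _ "\<lambda>l. m + l" "\<lambda>l. l - m"]) auto
  also have "\<dots> = (\<Sum>\<^sub>\<infinity>l. \<Sum>i\<le>r. of_nat (r choose i) * of_int m ^ i * (of_int l ^ (r - i) * fls_nth a l))"
    by (simp add: binomial_ring sum_distrib_left sum_distrib_right mult_ac)
  also have "\<dots> = (\<Sum>i\<le>r. \<Sum>\<^sub>\<infinity>l. of_nat (r choose i) * of_int m ^ i * (of_int l ^ (r - i) * fls_nth a l))"
    by (intro infsumI has_sum_finite_sum has_sum_infsum summable_on_cmult_right fin_supp_summable assms)
  finally show ?thesis by (simp add: moment_def infsum_cmult_right')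
qed

section \<open>The recursion for the crank moments\<close>

text \<open>Each nonzero coefficient of the three series is a monomial x^m, x^(-m) or 1, with m the
  cofactor \<open>i div Suc k\<close>; multiplying by it is a translation.\<close>

lemma crank_times_geo:
  "fps_nth crank_gf n * fps_nth (geo fls_X (Suc k)) i =
     (if Suc k dvd i \<and> i > 0 then fls_shift (- int (i div Suc k)) (fps_nth crank_gf n) else 0)"
  "fps_nth crank_gf n * fps_nth (geo fls_X_inv (Suc k)) i =
     (if Suc k dvd i \<and> i > 0 then fls_shift (int (i div Suc k)) (fps_nth crank_gf n) else 0)"
  "fps_nth crank_gf n * fps_nth (geo 1 (Suc k)) i =
     (if Suc k dvd i \<and> i > 0 then fps_nth crank_gf n else 0)"
  by (simp_all add: geo_def fls_X_power_times_conv_shift fls_X_inv_power_times_conv_shift)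

lemma crank_moment_eq_moment: "crank_moment r n = moment r (fps_nth crank_gf n)"
  by (simp add: crank_moment_def moment_def crank_count_def)

text \<open>Applying x d/dx raises the order by one, and \<open>xderiv_crank\<close> expresses the
  result by translations by d and - d. Their binomial expansions differ exactly in the odd powers of
  d, whence the weight d^j - (- d)^j.\<close>

lemma crank_moment_gf_Suc:
  "crank_moment_gf (Suc r) = (\<Sum>j\<le>r. fps_const (of_nat (r choose j)) *
      (divsum (\<lambda>d. of_nat d ^ j - (- of_nat d) ^ j) * crank_moment_gf (r - j)))"
proof (rule fps_ext)
  fix N
  let ?c = "\<lambda>n. fps_nth crank_gf n"
  let ?h = "\<lambda>j d. real d ^ j - (- real d) ^ j"
  have mom: "moment r (?c n * (fps_nth (geo fls_X (Suc k)) i - fps_nth (geo fls_X_inv (Suc k)) i)) =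
      (if Suc k dvd i \<and> i > 0 then \<Sum>j\<le>r. of_nat (r choose j) * ?h j (i div Suc k) * crank_moment (r - j)
          n else 0)"
    for n k i
    using moment_shift[OF fin_supp_crank[of n], of r "int (i div Suc k)"]
          moment_shift[OF fin_supp_crank[of n], of r "- int (i div Suc k)"]
    by (simp add: right_diff_distrib crank_times_geo moment_diff fin_supp_shift fin_supp_crank
        crank_moment_eq_moment sum_subtractf left_diff_distrib)
  have fin: "fin_supp (?c n * (fps_nth (geo fls_X (Suc k)) i - fps_nth (geo fls_X_inv (Suc k)) i))"
      for n k i
    using fin_supp_add[OF fin_supp_shift fin_supp_uminus[OF fin_supp_shift],
        OF fin_supp_crank[of n] fin_supp_crank[of n], of "- int (i div Suc k)" "int (i div Suc k)"]
    by (simp add: right_diff_distrib crank_times_geo fin_supp_0)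
  have "crank_moment (Suc r) N = moment r (xderiv (?c N))"
    by (simp add: crank_moment_eq_moment moment_xderiv)
  also have "\<dots> = (\<Sum>i\<le>N. \<Sum>k\<le>N. moment r (?c (N - i) * (fps_nth (geo fls_X (Suc k)) i -
      fps_nth (geo fls_X_inv (Suc k)) i)))"
    by (simp add: xderiv_crank sum_distrib_left moment_sum fin fin_supp_sum)
  also have "\<dots> = (\<Sum>i\<le>N. \<Sum>j\<le>r. of_nat (r choose j) * (fps_nth (divsum (?h j)) i * crank_moment (r -
      j) (N - i)))"
  proof (rule sum.cong[OF refl])
    fix i assume "i \<in> {..N}"
    show "(\<Sum>k\<le>N. moment r (?c (N - i) * (fps_nth (geo fls_X (Suc k)) i -
        fps_nth (geo fls_X_inv (Suc k)) i)))
       = (\<Sum>j\<le>r. of_nat (r choose j) * (fps_nth (divsum (?h j)) i * crank_moment (r - j) (N - i)))"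
    proof (cases "i = 0")
      case False
      define g where "g = (\<lambda>d. \<Sum>j\<le>r. of_nat (r choose j) * ?h j d * crank_moment (r - j) (N - i))"
      have "(\<Sum>k\<le>N. moment r (?c (N - i) * (fps_nth (geo fls_X (Suc k)) i -
          fps_nth (geo fls_X_inv (Suc k)) i)))
          = (\<Sum>k\<le>N. if Suc k dvd i then g (i div Suc k) else 0)"
        unfolding mom g_def using False by simp
      also have "\<dots> = (\<Sum>d | d dvd i. g (i div d))"
        using sum_multiples[of i N "\<lambda>d. g (i div d)"] False \<open>i \<in> {..N}\<close> by auto
      \<comment> \<open>The product index is one divisor of i while the translation is by its
        cofactor; reversing the divisors makes the translation the summation variable.\<close>
      also have "\<dots> = (\<Sum>d | d dvd i. g d)"
        using False by (intro sum_codivisors) auto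
      also have "\<dots> = (\<Sum>j\<le>r. of_nat (r choose j) * (fps_nth (divsum (?h j)) i * crank_moment (r - j) (N -
          i)))"
        unfolding g_def using False
        by (subst sum.swap) (simp add: divsum_def sum_distrib_left sum_distrib_right mult.assoc)
      finally show ?thesis .
    qed (simp add: mom divsum_def)
  qed
  also have "\<dots> = (\<Sum>j\<le>r. \<Sum>i\<le>N. of_nat (r choose j) * (fps_nth (divsum (?h j)) i * crank_moment (r -
      j) (N - i)))"
    by (rule sum.swap)
  also have "\<dots> = fps_nth (\<Sum>j\<le>r. fps_const (of_nat (r choose j)) *
      (divsum (?h j) * crank_moment_gf (r - j))) N"
    by (simp only: fps_sum_nth fps_mult_left_const_nth)
       (simp add: fps_mult_nth crank_moment_gf_def atLeast0AtMost sum_distrib_left)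
  finally show "fps_nth (crank_moment_gf (Suc r)) N = fps_nth (\<Sum>j\<le>r. fps_const (of_nat (r choose j)) *
      (divsum (\<lambda>d. of_nat d ^ j - (- of_nat d) ^ j) * crank_moment_gf (r - j))) N"
    by (simp add: crank_moment_gf_def)
qed

text \<open>Formally x = 1 turns a crank factor into 1 / (1 - q^n). In place of that substitution,
  both series are shown to have the same logarithmic derivative and the same constant term.\<close>

lemma crank_moment_gf_0: "crank_moment_gf 0 = partition_gf"
proof (rule fps_log_ode_unique)
  show "fps_X * fps_deriv partition_gf = divsum of_nat * partition_gf" by (rule partition_gf_ode)
  show "fps_nth (divsum of_nat) 0 = 0" by (simp add: divsum_def)
  have "fps_nth crank_gf 0 = 1"
    unfolding crank_gf_def using one_mod_nth[OF one_mod_crank_factor]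
    by (subst fps_nth_prodinf[of _ 0 0]) (simp_all add: one_mod_crank_factor)
  moreover have "moment 0 1 = 1"
  proof -
    have "moment 0 1 = (\<Sum>\<^sub>\<infinity>m\<in>{0::int}. 1)"
      unfolding moment_def by (rule infsum_cong_neutral) auto
    thus ?thesis by simp
  qed
  ultimately show "fps_nth (crank_moment_gf 0) 0 = fps_nth partition_gf 0"
    by (simp add: crank_moment_gf_def crank_moment_eq_moment partition_gf_0)
  show "fps_X * fps_deriv (crank_moment_gf 0) = divsum of_nat * crank_moment_gf 0"
  proof (rule fps_ext)
    fix N
    let ?c = "\<lambda>n. fps_nth crank_gf n"
    let ?T = "\<lambda>k i. of_nat (Suc k) * (fps_nth (geo fls_X (Suc k)) i + fps_nth (geo fls_X_inv (Suc k)) i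
         - fps_nth (geo 1 (Suc k)) i)"
    have T: "?c n * ?T k i = (if Suc k dvd i \<and> i > 0 then
        of_nat (Suc k) * (fls_shift (- int (i div Suc k)) (?c n) + fls_shift (int (i div Suc k)) (?c n) -
            ?c n) else 0)"
      for n k i
    proof -
      have "?c n * ?T k i = of_nat (Suc k) * (?c n * fps_nth (geo fls_X (Suc k)) i +
           ?c n * fps_nth (geo fls_X_inv (Suc k)) i - ?c n * fps_nth (geo 1 (Suc k)) i)"
        by (simp only: algebra_simps)
      thus ?thesis unfolding crank_times_geo by (cases
          "Suc k dvd i \<and> i > 0") (simp_all only: if_True if_False simp_thms diff_self add_0
          mult_zero_right)
    qed
    have fin: "fin_supp (?c n * ?T k i)" for n k i
      unfolding T
      by (auto simp del: of_nat_Suc simp: diff_conv_add_uminus simp del: add_uminus_conv_diff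
          intro!: fin_supp_of_nat_mult fin_supp_add fin_supp_uminus fin_supp_shift fin_supp_crank
              fin_supp_0)
    \<comment> \<open>The moment of order 0 is invariant under translation, so the three terms count
      1 + 1 - 1 = 1.\<close>
    have mom: "moment 0 (?c n * ?T k i) = (if Suc k dvd i then (if i > 0 then of_nat (Suc k) *
        crank_moment 0 n else 0) else 0)"
      for n k i
      unfolding T using moment_shift[OF fin_supp_crank[of n], of 0 "int (i div Suc k)"]
          moment_shift[OF fin_supp_crank[of n], of 0 "- int (i div Suc k)"]
      by (simp add: moment_of_nat_mult moment_diff moment_add fin_supp_add fin_supp_shift fin_supp_crank
          crank_moment_eq_moment del: of_nat_Suc)
    have "of_nat N * crank_moment 0 N = moment 0 (of_nat N * ?c N)"
      by (simp add: crank_moment_eq_moment moment_of_nat_mult)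
    also have "\<dots> = (\<Sum>i\<le>N. \<Sum>k\<le>N. moment 0 (?c (N - i) * ?T k i))"
      unfolding qderiv_crank sum_distrib_left by (simp add: moment_sum fin fin_supp_sum del: of_nat_Suc)
    also have "\<dots> = (\<Sum>i\<le>N. fps_nth (divsum of_nat) i * crank_moment 0 (N - i))"
    proof (intro sum.cong refl)
      fix i assume "i \<in> {..N}"
      show "(\<Sum>k\<le>N. moment 0 (?c (N - i) * ?T k i)) = fps_nth (divsum of_nat) i * crank_moment 0 (N - i)"
        unfolding mom
        using sum_multiples[of i N "\<lambda>k. of_nat k * crank_moment 0 (N - i)"] \<open>i \<in> {..N}\<close>
        by (cases "i = 0") (simp_all add: divsum_def sum_distrib_right del: of_nat_Suc cong: if_cong)
    qed
    also have "\<dots> = fps_nth (divsum of_nat * crank_moment_gf 0) N"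
      by (simp add: fps_mult_nth crank_moment_gf_def atLeast0AtMost)
    finally show "fps_nth (fps_X * fps_deriv (crank_moment_gf 0)) N = \<dots>"
      by (cases N) (simp_all add: crank_moment_gf_def)
  qed
qed

text \<open>\<open>C\<^sub>2\<^sub>j = P * crank_quot j\<close>: iterating the logarithmic derivative of the crank product shows that
  the quotient is a polynomial in Eisenstein series.\<close>

fun crank_quot :: "nat \<Rightarrow> real fps" where
  "crank_quot j = (if j = 0 then 1 else
     (\<Sum>i<j. fps_const (2 * of_nat ((2 * j - 1) choose (2 * i + 1))) *
        (divsum (\<lambda>d. of_nat d ^ (2 * i + 1)) * crank_quot (j - Suc i))))"

declare crank_quot.simps [simp del]

lemma crank_moment_gf_even: "crank_moment_gf (2 * j) = partition_gf * crank_quot j"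
proof (induction j rule: less_induct)
  case (less j)
  show ?case
  proof (cases "j = 0")
    case True
    thus ?thesis by (simp add: crank_moment_gf_0 crank_quot.simps)
  next
    case False
    define r where "r = 2 * j - 1"
    have r: "2 * j = Suc r" using False by (simp add: r_def)
    \<comment> \<open>The indices 0, ..., 2 j - 1 are split by parity: even ones have weight 0 in
      the recursion, and the odd ones 2 i + 1 have weight 2 d^(2 i + 1).\<close>
    have split: "{..r} = (\<lambda>i. 2 * i) ` {..<j} \<union> (\<lambda>i. 2 * i + 1) ` {..<j}"
    proof (intro set_eqI iffI)
      fix x assume "x \<in> {..r}"
      thus "x \<in> (\<lambda>i. 2 * i) ` {..<j} \<union> (\<lambda>i. 2 * i + 1) ` {..<j}"
        using r by (cases "even x") (auto elim!: evenE oddE)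
    qed (use r in auto)
    define S where "S = (\<lambda>i. fps_const (of_nat (r choose i)) *
      (divsum (\<lambda>d. of_nat d ^ i - (- of_nat d) ^ i) * crank_moment_gf (r - i)))"
    have ev: "S (2 * i) = 0" for i
    proof -
      have "divsum (\<lambda>d. of_nat d ^ (2 * i) - (- of_nat d :: real) ^ (2 * i)) = 0"
        by (rule fps_ext) (simp add: divsum_def)
      thus ?thesis by (simp add: S_def)
    qed
    have two: "divsum (\<lambda>d. of_nat d ^ (2 * i + 1) - (- of_nat d :: real) ^ (2 * i + 1)) =
        fps_const 2 * divsum (\<lambda>d. of_nat d ^ (2 * i + 1))" for i
      by (rule fps_ext) (simp add: divsum_def sum_distrib_left mult.assoc)
    have od: "S (2 * i + 1) = partition_gf * (fps_const (2 * of_nat (r choose (2 * i + 1))) *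
        (divsum (\<lambda>d. of_nat d ^ (2 * i + 1)) * crank_quot (j - Suc i)))" if "i < j" for i
    proof -
      have "r - (2 * i + 1) = 2 * (j - Suc i)" using r that by simp
      moreover have "crank_moment_gf (2 * (j - Suc i)) = partition_gf * crank_quot (j - Suc i)"
        using that by (intro less.IH) auto
      ultimately show ?thesis unfolding S_def two
        by (simp add: mult_ac flip: fps_const_mult)
    qed
    have "crank_moment_gf (2 * j) = (\<Sum>i\<le>r. S i)"
      unfolding r crank_moment_gf_Suc S_def ..
    also have "\<dots> = (\<Sum>i<j. S (2 * i)) + (\<Sum>i<j. S (2 * i + 1))"
      unfolding split by (subst sum.union_disjoint)
        (auto simp: sum.reindex inj_on_def, presburger)
    also have "(\<Sum>i<j. S (2 * i)) = 0" by (simp add: ev)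
    also have "(\<Sum>i<j. S (2 * i + 1)) = (\<Sum>i<j. partition_gf * (fps_const (2 * of_nat (r choose (2 * i +
        1))) *
        (divsum (\<lambda>d. of_nat d ^ (2 * i + 1)) * crank_quot (j - Suc i))))"
      by (rule sum.cong[OF refl]) (simp only: od lessThan_iff)
    also have "\<dots> = partition_gf * crank_quot j"
      unfolding crank_quot.simps[of j] r_def[symmetric] using False
          by (simp only: sum_distrib_left if_False)
    also have "0 + \<dots> = \<dots>" by simp
    finally show ?thesis .
  qed
qed

lemma triple_crank_moment_eq:
  "triple_crank_moment (2 * a) (2 * b) (2 * c) n =
     fps_nth (partition_gf * crank_quot a * crank_quot b * crank_quot c) n"
proof -
  have "partition_gf ^ 2 * inverse (partition_gf ^ 2) = 1"
    using partition_gf_0 by (subst mult.commute) (rule inverse_mult_eq_1, simp add: power2_eq_square)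
  thus ?thesis unfolding triple_crank_moment_def crank_moment_gf_even
    by (simp add: power2_eq_square mult_ac)
       (metis (no_types, lifting) mult.assoc mult.commute mult.right_neutral)
qed

section \<open>Evaluation in the unit disc\<close>

definition cfps :: "real fps \<Rightarrow> complex fps" where
  "cfps F = Abs_fps (\<lambda>n. complex_of_real (fps_nth F n))"

lemma fps_nth_cfps [simp]: "fps_nth (cfps F) n = of_real (fps_nth F n)"
  by (simp add: cfps_def)

lemma cfps_mult: "cfps (F * G) = cfps F * cfps G"
  by (rule fps_ext) (simp add: fps_mult_nth)

lemma cfps_sum: "cfps (\<Sum>i\<in>A. f i) = (\<Sum>i\<in>A. cfps (f i))"
  by (rule fps_ext) (simp add: fps_sum_nth)

lemma cfps_1: "cfps 1 = 1"
  by (rule fps_ext) simp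

lemma cfps_const: "cfps (fps_const c) = fps_const (of_real c)"
  by (rule fps_ext) simp

lemma cfps_divsum: "cfps (divsum w) = divsum (\<lambda>d. of_real (w d))"
  by (rule fps_ext) (simp add: divsum_def)

lemma unit_disc_conv: "fps_conv_radius F \<ge> 1 \<Longrightarrow> norm q < 1 \<Longrightarrow> ereal (norm q) < fps_conv_radius F"
  by (metis ereal_less(2) less_ereal.simps(1) one_ereal_def order_less_le_trans)

lemma summable_power_mult:
  assumes "norm (q :: complex) < 1"
  shows "summable (\<lambda>n. real (Suc n) ^ r * norm q ^ n)"
proof -
  have "conv_radius (\<lambda>n. of_nat (Suc n) ^ r :: real) = 1"
  proof (rule conv_radius_ratio_limit_nonzero[of _ 1])
    show "(\<lambda>n. norm (real (Suc n) ^ r) / norm (real (Suc (Suc n)) ^ r)) \<longlonglongrightarrow> 1"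
    proof -
      have "(\<lambda>n. (real (Suc n) / real (Suc (Suc n))) ^ r) \<longlonglongrightarrow> 1 ^ r"
        by (intro tendsto_power LIMSEQ_Suc[OF LIMSEQ_n_over_Suc_n])
      thus ?thesis by (simp add: power_divide norm_power del: of_nat_Suc)
    qed
  qed (auto simp: one_ereal_def)
  thus ?thesis using summable_in_conv_radius[of "norm q" "\<lambda>n. of_nat (Suc n) ^ r :: real"] assms
    by (simp add: one_ereal_def)
qed

section \<open>Lambert series as absolutely convergent double sums\<close>

lemma has_sum_rows:
  fixes f :: "'a \<Rightarrow> 'b \<Rightarrow> complex" and S :: complex
  assumes "((\<lambda>(x,y). f x y) has_sum S) UNIV"
  shows "((\<lambda>x. \<Sum>\<^sub>\<infinity>y. f x y) has_sum S) UNIV"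
proof -
  have s: "(\<lambda>(x,y). f x y) summable_on UNIV \<times> UNIV"
    using assms by (auto simp: summable_on_def)
  have "(f x has_sum (\<Sum>\<^sub>\<infinity>y. f x y)) UNIV" for x
    using summable_on_SigmaD1[OF s, of x] by (intro has_sum_infsum) simp
  thus ?thesis
    using has_sum_Sigma[where f = "\<lambda>(x,y). f x y" and a = S and A = UNIV and B = "\<lambda>_. UNIV" and b =
        "\<lambda>x. \<Sum>\<^sub>\<infinity>y. f x y"] assms
    by (simp add: isUCont_plus)
qed

context
  fixes w :: "nat \<Rightarrow> real" and r :: nat
  assumes w: "\<And>d. d > 0 \<Longrightarrow> \<bar>w d\<bar> \<le> real d ^ r"
begin

text \<open>An integer n > 0 has at most n divisors, each of weight at most n^r.\<close>

lemma divsum_abs_le: "(\<Sum>d | d dvd n. \<bar>w d\<bar>) \<le> real (Suc n) ^ Suc r" if "n > 0"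
proof -
  have "(\<Sum>d | d dvd n. \<bar>w d\<bar>) \<le> (\<Sum>d | d dvd n. real n ^ r)"
  proof (rule sum_mono)
    fix d assume "d \<in> {d. d dvd n}"
    with that have "d > 0" "d \<le> n" by (auto intro: Nat.gr0I dvd_imp_le)
    thus "\<bar>w d\<bar> \<le> real n ^ r" using w[of d] power_mono[of "real d" "real n" r] by auto
  qed
  also have "\<dots> = real (card {d. d dvd n}) * real n ^ r" by simp
  also have "\<dots> \<le> real n * real n ^ r"
  proof (intro mult_right_mono)
    have "{d. d dvd n} \<subseteq> {1..n}" using that by (auto intro: Nat.gr0I dvd_imp_le simp: Suc_le_eq)
    hence "card {d. d dvd n} \<le> n" using card_mono[of "{1..n}"] by fastforce
    thus "real (card {d. d dvd n}) \<le> real n" by simp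
  qed auto
  also have "\<dots> \<le> real (Suc n) ^ Suc r"
    using power_mono[of "real n" "real (Suc n)" "Suc r"] by simp
  finally show ?thesis .
qed

lemma divsum_norm_le: "norm (fps_nth (cfps (divsum w)) n) \<le> real (Suc n) ^ Suc r"
proof (cases "n = 0")
  case False
  have "norm (fps_nth (cfps (divsum w)) n) = \<bar>\<Sum>d | d dvd n. w d\<bar>"
    using False by (simp add: divsum_def del: of_real_sum)
  also have "\<dots> \<le> (\<Sum>d | d dvd n. \<bar>w d\<bar>)" by (rule sum_abs)
  also have "\<dots> \<le> real (Suc n) ^ Suc r" using False by (intro divsum_abs_le) auto
  finally show ?thesis .
qed (simp add: divsum_def)

lemma divsum_conv_radius: "fps_conv_radius (cfps (divsum w)) \<ge> 1"
  unfolding fps_conv_radius_def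
proof (rule conv_radius_geI_ex')
  fix x :: real assume x: "0 < x" "ereal x < 1"
  show "summable (\<lambda>n. fps_nth (cfps (divsum w)) n * of_real x ^ n)"
  proof (rule summable_comparison_test)
    show "summable (\<lambda>n. real (Suc n) ^ Suc r * norm (of_real x :: complex) ^ n)"
      by (rule summable_power_mult) (use x in \<open>simp add: one_ereal_def\<close>)
    show "\<exists>N. \<forall>n\<ge>N. norm (fps_nth (cfps (divsum w)) n * of_real x ^ n) \<le>
        real (Suc n) ^ Suc r * norm (of_real x :: complex) ^ n"
      using divsum_norm_le by (auto simp: norm_mult norm_power intro!: mult_right_mono)
  qed
qed

text \<open>Pairs (n, d) with d dividing n are reindexed by the cofactor and d, both lowered by one
  so that they range over all naturals. Absolute summability over the pairs is proved first; it
  makes both orders of summation legitimate.\<close>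

lemma divsum_has_sum:
  assumes q: "norm q < 1"
  shows "((\<lambda>(k,m). of_real (w (Suc m)) * q ^ (Suc k * Suc m)) has_sum
           eval_fps (cfps (divsum w)) q) UNIV"
proof -
  define T where "T = (SIGMA n:{1::nat..}. {d. d dvd n})"
  define f where "f = (\<lambda>(n,d). of_real (w d) * q ^ n :: complex)"
  have inner: "((\<lambda>d. f (n, d)) has_sum fps_nth (cfps (divsum w)) n * q ^ n) {d. d dvd n}" if "n \<in> {1..}"
      for n
    using that by (intro has_sum_finiteI) (auto simp: f_def divsum_def sum_distrib_right)
  have abs: "(\<lambda>x. norm (f x)) summable_on T"
    unfolding T_def Infinite_Sum.abs_summable_on_Sigma_iff
  proof (intro conjI ballI)
    fix n :: nat assume "n \<in> {1..}"
    thus "(\<lambda>d. norm (f (n, d))) summable_on {d. d dvd n}"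
      by (intro summable_on_finite) auto
  next
    have "(\<lambda>n. real (Suc n) ^ Suc r * norm q ^ n) summable_on {1..}"
    proof (rule summable_on_subset_banach[of _ UNIV], rule norm_summable_imp_summable_on)
      show "summable (\<lambda>n. norm (real (Suc n) ^ Suc r * norm q ^ n))"
        using summable_power_mult[OF q, of "Suc r"] by (simp add: abs_mult del: power_Suc of_nat_Suc)
    qed auto
    thus "(\<lambda>n. norm (\<Sum>\<^sub>\<infinity>d\<in>{d. d dvd n}. norm (f (n, d)))) summable_on {1..}"
    proof (rule summable_on_comparison_test)
      fix n :: nat assume n: "n \<in> {1..}"
      have "(\<Sum>\<^sub>\<infinity>d\<in>{d. d dvd n}. norm (f (n, d))) = (\<Sum>d | d dvd n. \<bar>w d\<bar>) * norm q ^ n"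
        using n by (subst infsum_finite) (auto simp: f_def norm_mult norm_power sum_distrib_right)
      moreover have "(\<Sum>d | d dvd n. \<bar>w d\<bar>) \<ge> 0" by (intro sum_nonneg) auto
      ultimately show "norm (\<Sum>\<^sub>\<infinity>d\<in>{d. d dvd n}. norm (f (n, d))) \<le> real (Suc n) ^ Suc r * norm q ^ n"
        using divsum_abs_le[of n] n by (auto intro!: mult_right_mono simp: abs_mult simp del: power_Suc)
    qed auto
  qed
  have "(f has_sum (\<Sum>\<^sub>\<infinity>n\<in>{1..}. \<Sum>\<^sub>\<infinity>d\<in>{d. d dvd n}. f (n, d))) T"
    using has_sum_infsum[OF abs_summable_summable[OF abs]] infsum_Sigma_banach[of f "{1..}"
        "\<lambda>n. {d. d dvd n}"]
      abs_summable_summable[OF abs] by (simp add: T_def)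
  also have "(\<Sum>\<^sub>\<infinity>n\<in>{1..}. \<Sum>\<^sub>\<infinity>d\<in>{d. d dvd n}. f (n, d)) = (\<Sum>\<^sub>\<infinity>n\<in>{1..}. fps_nth (cfps (divsum w)) n * q ^ n)"
    by (intro infsum_cong infsumI inner) auto
  also have "\<dots> = (\<Sum>\<^sub>\<infinity>n. fps_nth (cfps (divsum w)) n * q ^ n)"
    by (rule infsum_cong_neutral) (auto simp: divsum_def not_le)
  also have "\<dots> = eval_fps (cfps (divsum w)) q"
  proof (rule infsumI, rule norm_summable_imp_has_sum)
    show "summable (\<lambda>n. norm (fps_nth (cfps (divsum w)) n * q ^ n))"
      by (rule summable_comparison_test[OF _ summable_power_mult[OF q, of "Suc r"]])
         (use divsum_norm_le in \<open>auto simp: norm_mult norm_power intro!: mult_right_mono\<close>)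
    show "(\<lambda>n. fps_nth (cfps (divsum w)) n * q ^ n) sums eval_fps (cfps (divsum w)) q"
      by (intro sums_eval_fps unit_disc_conv divsum_conv_radius q)
  qed
  finally have "(f has_sum eval_fps (cfps (divsum w)) q) T" .
  also have "?this \<longleftrightarrow> ?thesis"
  proof (rule has_sum_reindex_bij_witness[of _ "\<lambda>(k,m). (Suc k * Suc m, Suc m)"
      "\<lambda>(n,d). (n div d - 1, d - 1)"])
    fix a assume "a \<in> T"
    then obtain d e where a: "a = (e * d, d)" "e * d \<ge> 1"
      by (auto simp: T_def elim!: dvdE simp: mult.commute)
    then obtain k m where "e = Suc k" "d = Suc m" by (cases e; cases d) auto
    hence a: "a = (Suc k * Suc m, Suc m)" using a by (simp only:)
    have 1: "Suc k * Suc m div Suc m - 1 = k"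
      using nonzero_mult_div_cancel_right[of "Suc m" "Suc k"] by (simp del: mult_Suc)
    show "(case case a of (n, d) \<Rightarrow> (n div d - 1, d - 1) of (k, m) \<Rightarrow> (Suc k * Suc m, Suc m)) = a"
      unfolding a prod.case 1 by simp
    show "(case case a of (n, d) \<Rightarrow> (n div d - 1, d - 1) of
          (k, m) \<Rightarrow> complex_of_real (w (Suc m)) * q ^ (Suc k * Suc m)) = f a"
      unfolding a prod.case 1 f_def by simp
  next
    fix b :: "nat \<times> nat"
    obtain k m where b: "b = (k, m)" by force
    have 1: "Suc k * Suc m div Suc m - 1 = k"
      using nonzero_mult_div_cancel_right[of "Suc m" "Suc k"] by (simp del: mult_Suc)
    show "(case case b of (k, m) \<Rightarrow> (Suc k * Suc m, Suc m) of (n, d) \<Rightarrow> (n div d - 1, d - 1)) = b"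
      unfolding b prod.case 1 by simp
    show "(case b of (k, m) \<Rightarrow> (Suc k * Suc m, Suc m)) \<in> T"
      unfolding b prod.case T_def using dvd_triv_right[of "Suc m" "Suc k"] by simp
  qed auto
  finally show ?thesis .
qed

text \<open>For a fixed multiple k + 1 the inner sum is a series in q^(k + 1), for power weights a
  polylogarithm. This is the order of summation to which Euler-Maclaurin applies.\<close>

lemma divsum_rows_sums:
  assumes q: "norm q < 1"
  shows "(\<lambda>k. \<Sum>m. of_real (w (Suc m)) * q ^ (Suc k * Suc m)) sums eval_fps (cfps (divsum w)) q"
proof -
  have 1: "(\<lambda>(k,m). of_real (w (Suc m)) * q ^ (Suc k * Suc m)) summable_on UNIV \<times> UNIV"
    using divsum_has_sum[OF q] by (auto simp: summable_on_def)
  have row: "(\<Sum>\<^sub>\<infinity>m. of_real (w (Suc m)) * q ^ (Suc k * Suc m)) =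
      (\<Sum>m. of_real (w (Suc m)) * q ^ (Suc k * Suc m))" for k
    using summable_on_SigmaD1[OF 1, of k] by (intro sums_unique has_sum_imp_sums has_sum_infsum) simp
  have "((\<lambda>k. \<Sum>\<^sub>\<infinity>m. of_real (w (Suc m)) * q ^ (Suc k * Suc m)) has_sum eval_fps (cfps (divsum w)) q) UNIV"
    using has_sum_rows[of "\<lambda>k m. of_real (w (Suc m)) * q ^ (Suc k * Suc m)"]
      divsum_has_sum[OF q] by simp
  thus ?thesis unfolding row by (rule has_sum_imp_sums)
qed

text \<open>In the other order the inner sums are geometric. The resulting Lambert series is the
  form that can be compared term by term with its value at |q|.\<close>

lemma divsum_lambert_sums:
  assumes q: "norm q < 1"
  shows "(\<lambda>m. of_real (w (Suc m)) * (q ^ Suc m / (1 - q ^ Suc m))) sums eval_fps (cfps (divsum w)) q"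
proof -
  have "((\<lambda>(m,k). of_real (w (Suc m)) * q ^ (Suc k * Suc m)) has_sum
           eval_fps (cfps (divsum w)) q) UNIV"
    using divsum_has_sum[OF q]
    by (subst has_sum_reindex_bij_witness[of _ prod.swap prod.swap UNIV
          "\<lambda>(k,m). of_real (w (Suc m)) * q ^ (Suc k * Suc m)"]) auto
  hence "((\<lambda>m. \<Sum>\<^sub>\<infinity>k. of_real (w (Suc m)) * q ^ (Suc k *
      Suc m)) has_sum eval_fps (cfps (divsum w)) q) UNIV"
    by (rule has_sum_rows)
  moreover have "(\<Sum>\<^sub>\<infinity>k. of_real (w (Suc m)) * q ^ (Suc k * Suc m)) =
      of_real (w (Suc m)) * (q ^ Suc m / (1 - q ^ Suc m))" for m
  proof -
    have n: "norm (q ^ Suc m) < 1" using q by (simp add: norm_power power_less_one_iff del: power_Suc)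
    have "((\<lambda>k. (q ^ Suc m) ^ k) has_sum (1 / (1 - q ^ Suc m))) UNIV"
      using n by (intro norm_summable_imp_has_sum geometric_sums) (auto simp: norm_power
          summable_geometric simp del: power_Suc)
    hence "((\<lambda>k. of_real (w (Suc m)) * q ^ Suc m * (q ^ Suc m) ^ k) has_sum
         (of_real (w (Suc m)) * q ^ Suc m * (1 / (1 - q ^ Suc m)))) UNIV"
      by (rule has_sum_cmult_right)
    moreover have "q ^ (Suc k * Suc m) = q ^ Suc m * (q ^ Suc m) ^ k" for k
      by (subst mult.commute, subst power_mult) simp
    ultimately show ?thesis by (intro infsumI) (simp only: mult.assoc mult_1_right times_divide_eq_right)
  qed
  ultimately show ?thesis by (simp only: has_sum_imp_sums)
qed

end

abbreviation "sigma_gf r \<equiv> divsum (\<lambda>d. of_nat d ^ r)"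
text \<open>The power series of ln P(q), the sum over k of - ln(1 - q^k).\<close>

abbreviation "log_gf \<equiv> divsum (\<lambda>d. 1 / of_nat d)"

lemma weight_bounds: "d > 0 \<Longrightarrow> \<bar>of_nat d ^ r\<bar> \<le> real d ^ r" "d > 0 \<Longrightarrow> \<bar>1 / of_nat d\<bar> \<le> real d ^ 0"
  by simp_all

section \<open>Values of P and of the quotients in the disc\<close>

lemma log_gf_deriv: "fps_X * fps_deriv log_gf = (divsum of_nat :: 'a :: field_char_0 fps)"
proof (rule fps_ext)
  fix n
  have "of_nat n * (\<Sum>d | d dvd n. 1 / of_nat d) = (\<Sum>d | d dvd n. of_nat (n div d) :: 'a)" if "n > 0"
    unfolding sum_distrib_left
  proof (rule sum.cong[OF refl])
    fix d assume "d \<in> {d. d dvd n}"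
    then obtain e where "n = d * e" by auto
    with that show "of_nat n * (1 / of_nat d) = (of_nat (n div d) :: 'a)" by auto
  qed
  thus "fps_nth (fps_X * fps_deriv log_gf) n = fps_nth (divsum of_nat :: 'a fps) n"
    using sum_codivisors[of n "of_nat :: nat \<Rightarrow> 'a"]
    by (cases n) (simp_all add: divsum_def)
qed

text \<open>Formally, the exponential of \<open>log_gf\<close> solves the differential equation of
  P. Since the function exp of ln P is holomorphic on the disc, its expansion yields both the radius
  of convergence and the value.\<close>

lemma partition_gf_eval:
  shows "fps_conv_radius (cfps partition_gf) \<ge> 1"
    and "norm q < 1 \<Longrightarrow> eval_fps (cfps partition_gf) q = exp (eval_fps (cfps log_gf) q)"
proof -
  let ?L = "cfps log_gf"
  have L: "fps_conv_radius ?L \<ge> 1"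
    by (rule divsum_conv_radius) (rule weight_bounds)
  have Leq: "?L = log_gf" by (simp add: cfps_divsum)
  have L0: "fps_nth ?L 0 = 0" by (simp add: divsum_def)
  have 1: "((\<lambda>x. exp x) \<circ> eval_fps ?L) has_fps_expansion (fps_exp 1 oo ?L)"
  proof (rule has_fps_expansion_compose)
    show "eval_fps ?L has_fps_expansion ?L"
      using L by (intro eval_fps_has_fps_expansion) (auto intro: less_le_trans[of _ 1])
    show "exp has_fps_expansion fps_exp (1::complex)" by (rule has_fps_expansion_exp1)
  qed (rule L0)
  have "fps_exp 1 oo ?L = cfps partition_gf"
  proof (rule fps_log_ode_unique)
    have "fps_X * fps_deriv (fps_exp 1 oo ?L) = fps_X * fps_deriv ?L * (fps_exp 1 oo ?L)"
      by (subst fps_compose_deriv[OF L0]) (simp add: mult_ac)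
    also have "fps_X * fps_deriv ?L = divsum of_nat" unfolding Leq by (rule log_gf_deriv)
    finally show "fps_X * fps_deriv (fps_exp 1 oo ?L) = divsum of_nat * (fps_exp 1 oo ?L)" .
    have "cfps (fps_X * fps_deriv partition_gf) = cfps (divsum of_nat * partition_gf)"
      by (simp only: partition_gf_ode)
    moreover have "cfps (fps_X * fps_deriv partition_gf) = fps_X * fps_deriv (cfps partition_gf)"
      by (rule fps_ext) (auto split: nat.splits)
    ultimately show "fps_X * fps_deriv (cfps partition_gf) = divsum of_nat * cfps partition_gf"
      by (simp add: cfps_mult cfps_divsum)
  qed (simp_all add: divsum_def partition_gf_0)
  with 1 have 2: "((\<lambda>x. exp x) \<circ> eval_fps ?L) has_fps_expansion cfps partition_gf" by simp
  have hol: "eval_fps ?L holomorphic_on ball 0 1"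
    using L by (intro holomorphic_on_eval_fps) (auto intro!: unit_disc_conv)
  have hol': "((\<lambda>x. exp x) \<circ> eval_fps ?L) holomorphic_on ball 0 1"
    unfolding o_def by (intro holomorphic_intros hol)
  show "fps_conv_radius (cfps partition_gf) \<ge> 1"
    by (rule holomorphic_on_imp_fps_conv_radius_ge[OF 2]) (use hol' in \<open>simp add: one_ereal_def\<close>)
  show "eval_fps (cfps partition_gf) q = exp (eval_fps (cfps log_gf) q)" if "norm q < 1"
    using has_fps_expansion_imp_eval_fps_eq[OF 2 that hol'] by simp
qed

lemma fps_conv_radius_mult_ge:
  fixes F G :: "complex fps"
  assumes "fps_conv_radius F \<ge> r" "fps_conv_radius G \<ge> r"
  shows "fps_conv_radius (F * G) \<ge> r"
  using fps_conv_radius_mult[of F G] assms by (meson min.boundedI order_trans)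

lemma fps_conv_radius_sum_ge:
  fixes F :: "'b \<Rightarrow> complex fps"
  assumes "\<And>i. i \<in> A \<Longrightarrow> fps_conv_radius (F i) \<ge> r"
  shows "fps_conv_radius (\<Sum>i\<in>A. F i) \<ge> r"
  using assms
proof (induction A rule: infinite_finite_induct)
  case (insert x A)
  have "r \<le> min (fps_conv_radius (F x)) (fps_conv_radius (\<Sum>i\<in>A. F i))"
    using insert by simp
  also have "\<dots> \<le> fps_conv_radius (F x + (\<Sum>i\<in>A. F i))" by (rule fps_conv_radius_add)
  finally show ?case using insert by simp
qed auto

lemma eval_fps_sum:
  fixes F :: "'b \<Rightarrow> complex fps"
  assumes "\<And>i. i \<in> A \<Longrightarrow> fps_conv_radius (F i) \<ge> 1" "norm q < 1"
  shows "eval_fps (\<Sum>i\<in>A. F i) q = (\<Sum>i\<in>A. eval_fps (F i) q)"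
  using assms
proof (induction A rule: infinite_finite_induct)
  case (insert x A)
  thus ?case by (simp add: eval_fps_add unit_disc_conv fps_conv_radius_sum_ge)
qed auto

lemma crank_quot_conv_radius: "fps_conv_radius (cfps (crank_quot j)) \<ge> 1"
proof (induction j rule: less_induct)
  case (less j)
  have "fps_conv_radius (cfps (fps_const c * (sigma_gf r * crank_quot (j - Suc i)))) \<ge> 1" if "i < j"
      for i r c
    unfolding cfps_mult cfps_const
    by (intro fps_conv_radius_mult_ge divsum_conv_radius[where r = r] weight_bounds less.IH) (use that in
        auto)
  hence "fps_conv_radius (\<Sum>i<j. cfps (fps_const (c i) * (sigma_gf (r i) * crank_quot (j - Suc i)))) \<ge> 1"
      for r c
    by (intro fps_conv_radius_sum_ge) simp
  thus ?case
    by (subst crank_quot.simps)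
       (cases "j = 0", simp add: cfps_1, simp only: cfps_sum if_False)
qed

lemma eval_crank_quot:
  assumes "norm q < 1"
  shows "eval_fps (cfps (crank_quot j)) q = (if j = 0 then 1 else
    (\<Sum>i<j. 2 * of_nat ((2 * j - 1) choose (2 * i + 1)) *
        (eval_fps (cfps (sigma_gf (2 * i + 1))) q * eval_fps (cfps (crank_quot (j - Suc i))) q)))"
proof -
  have r: "fps_conv_radius (cfps (sigma_gf r)) \<ge> 1" for r
    by (intro divsum_conv_radius[where r = r] weight_bounds)
  have "eval_fps (cfps (fps_const (2 * of_nat c) * (sigma_gf r * crank_quot (j - Suc i)))) q =
     2 * of_nat c * (eval_fps (cfps (sigma_gf r)) q * eval_fps (cfps (crank_quot (j - Suc i)))
         q)" for i c r
    unfolding cfps_mult cfps_const using assms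
    by (simp add: eval_fps_mult unit_disc_conv fps_conv_radius_mult_ge r crank_quot_conv_radius)
  moreover have "fps_conv_radius (cfps (fps_const c * (sigma_gf r * crank_quot (j - Suc i)))) \<ge> 1"
      for i r c
    unfolding cfps_mult cfps_const
    by (intro fps_conv_radius_mult_ge r crank_quot_conv_radius) auto
  ultimately show ?thesis
    by (subst crank_quot.simps)
       (cases "j = 0", simp add: cfps_1, simp only: if_False cfps_sum eval_fps_sum assms)
qed

text \<open>Nonnegative coefficients make the value at |q| a majorant on the whole circle, which
  reduces the growth of the quotients away from q = 1 to the real axis.\<close>

lemma crank_quot_nonneg: "fps_nth (crank_quot j) n \<ge> 0"
proof (induction j arbitrary: n rule: less_induct)
  case (less j)
  have "fps_nth (sigma_gf r * crank_quot (j - Suc i)) n \<ge> 0" if "i < j" for i r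
    unfolding fps_mult_nth using that
    by (auto simp: divsum_def intro!: sum_nonneg mult_nonneg_nonneg less.IH)
  hence "(\<Sum>i<j. c i * fps_nth (sigma_gf (r i) * crank_quot (j - Suc i)) n) \<ge> 0" if "\<And>i. c i \<ge> 0" for c r
    using that by (intro sum_nonneg mult_nonneg_nonneg) auto
  from this[of "\<lambda>i. 2 * of_nat ((2 * j - 1) choose (2 * i + 1))" "\<lambda>i. 2 * i + 1"] show ?case
    by (subst crank_quot.simps) (simp add: fps_sum_nth fps_mult_left_const_nth)
qed

lemma crank_quot_norm_le:
  assumes "norm q < 1"
  shows "norm (eval_fps (cfps (crank_quot j)) q) \<le>
      norm (eval_fps (cfps (crank_quot j)) (of_real (norm q)))"
proof -
  have s: "(\<lambda>n. of_real (fps_nth (crank_quot j) n *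
      norm q ^ n)) sums eval_fps (cfps (crank_quot j)) (of_real (norm q))"
    using sums_eval_fps[of "of_real (norm q)" "cfps (crank_quot j)"] assms crank_quot_conv_radius[of j]
    by (simp add: unit_disc_conv)
  define S where "S = (\<Sum>n. fps_nth (crank_quot j) n * norm q ^ n)"
  have s1: "summable (\<lambda>n. fps_nth (crank_quot j) n * norm q ^ n)"
    using sums_summable[OF s] unfolding summable_of_real_iff .
  have s2: "eval_fps (cfps (crank_quot j)) (of_real (norm q)) = of_real S"
    using sums_unique2[OF s sums_of_real[OF summable_sums[OF s1]]] by (simp add: S_def)
  have "norm (eval_fps (cfps (crank_quot j)) q) \<le> S"
    unfolding eval_fps_def S_def
    by (rule norm_suminf_le[OF _ s1]) (simp add: norm_mult norm_power crank_quot_nonneg)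
  thus ?thesis unfolding s2 by simp
qed

section \<open>Cauchy's integral for the coefficients\<close>

text \<open>The path \<open>circlepath\<close> starts at angle 0, where the dominant arc should lie
  in the middle of the interval. Cauchy's formula is therefore applied to z \<mapsto> F(- z), which
  rotates the circle by pi; a shift and a reflection of the variable then lead to the interval from
  - pi to pi.\<close>

lemma Cauchy_coeff_eq:
  fixes F :: "complex fps"
  assumes F: "fps_conv_radius F \<ge> 1" and \<sigma>: "\<sigma> > 0"
  shows "((\<lambda>\<theta>. eval_fps F (exp (- Complex \<sigma> \<theta>)) * exp (of_nat n * Complex \<sigma> \<theta>)) has_integral
     of_real (2 * pi) * fps_nth F n) {-pi..pi}"
proof -
  define r where "r = exp (- \<sigma>)"
  define K where "K = (\<lambda>\<theta>. eval_fps F (exp (- Complex \<sigma> \<theta>)) * exp (of_nat n * Complex \<sigma> \<theta>))"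
  have r: "0 < r" "r < 1" using \<sigma> by (auto simp: r_def)
  define G where "G = Abs_fps (\<lambda>n. (-1) ^ n * fps_nth F n)"
  define g where "g = eval_fps G"
  have g: "g z = eval_fps F (- z)" for z
    unfolding g_def G_def eval_fps_def
    by (intro suminf_cong) (subst (2) power_minus, simp add: mult_ac)
  have G: "fps_conv_radius G \<ge> 1"
  proof -
    have "fps_conv_radius G = conv_radius (\<lambda>n. norm (fps_nth G n))"
      by (simp add: fps_conv_radius_def conv_radius_norm)
    also have "\<dots> = fps_conv_radius F"
      by (simp add: G_def norm_mult norm_power fps_conv_radius_def conv_radius_norm)
    finally show ?thesis using F by simp
  qed
  have hol: "g holomorphic_on ball 0 1"
    unfolding g_def using G by (intro holomorphic_on_eval_fps) (auto intro!: unit_disc_conv)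
  have "g has_fps_expansion G"
    unfolding g_def using G by (intro eval_fps_has_fps_expansion) (auto intro: less_le_trans[of _ 1])
  hence d: "(deriv ^^ n) g 0 / fact n = (-1) ^ n * fps_nth F n"
    using fps_nth_fps_expansion[of g G n] by (simp add: G_def)
  have c: "(2 * pi * \<i>) / (fact n) * (deriv ^^ n) g 0 = (2 * pi * \<i>) * ((-1) ^ n * fps_nth F n)"
    unfolding d[symmetric] by simp
  have "((\<lambda>u. g u / (u - 0) ^ Suc n) has_contour_integral (2 * pi * \<i>) / (fact n) *
      (deriv ^^ n) g 0) (circlepath 0 r)"
    using r by (intro Cauchy_has_contour_integral_higher_derivative_circlepath
       holomorphic_on_imp_continuous_on holomorphic_on_subset[OF hol]) auto
  hence "((\<lambda>t. g (of_real r * cis t) / (of_real r * cis t) ^ Suc n * of_real r * \<i> *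
      cis t) has_integral (2 * pi * \<i>) * ((-1) ^ n * fps_nth F n)) {0..2*pi}"
    unfolding circlepath_def c by (subst (asm) has_contour_integral_part_circlepath_iff) simp_all
  hence "((\<lambda>t. (-1) ^ n / \<i> * (g (of_real r * cis t) / (of_real r * cis t) ^ Suc n * of_real r * \<i> *
      cis t)) has_integral (-1) ^ n / \<i> * ((2 * pi * \<i>) * ((-1) ^ n * fps_nth F n))) {0..2*pi}"
    by (rule has_integral_mult_right)
  also have "(-1) ^ n / \<i> * ((2 * pi * \<i>) * ((-1) ^ n * fps_nth F n)) = of_real (2 * pi) * fps_nth F n"
    by (simp add: field_simps flip: power_add mult_2)
  also have "(\<lambda>t. (-1) ^ n / \<i> * (g (of_real r * cis t) / (of_real r * cis t) ^ Suc n * of_real r * \<i> *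
      cis t)) =
      (\<lambda>\<theta>. K (- \<theta>)) \<circ> (+) (- pi)"
  proof
    fix t
    have q: "exp (- Complex \<sigma> (pi - t)) = - (of_real r * cis t)"
    proof -
      have "exp (- Complex \<sigma> (pi - t)) = of_real r * cis (t - pi)"
        by (simp add: exp_eq_polar r_def)
      also have "cis (t - pi) = - cis t" by (simp add: complex_eq_iff)
      finally show ?thesis by simp
    qed
    have "exp (of_nat n * Complex \<sigma> (pi - t)) = inverse (exp (- Complex \<sigma> (pi - t))) ^ n"
      by (simp add: exp_minus[symmetric] exp_of_nat_mult[symmetric])
    also have "\<dots> = (-1) ^ n / (of_real r * cis t) ^ n"
      unfolding q by (simp add: field_simps power_minus' flip: power_mult_distrib)
    finally have e: "exp (of_nat n * Complex \<sigma> (pi - t)) = (-1) ^ n / (of_real r * cis t) ^ n" .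
    show "(-1) ^ n / \<i> * (g (of_real r * cis t) / (of_real r * cis t) ^ Suc n * of_real r * \<i> * cis t) =
      ((\<lambda>\<theta>. K (- \<theta>)) \<circ> (+) (- pi)) t"
      using r by (simp add: K_def q e g field_simps)
  qed
  finally have "((\<lambda>\<theta>. K (- \<theta>)) has_integral of_real (2 * pi) * fps_nth F n) {- pi .. - (- pi)}"
    by (subst (asm) has_integral_shift_Icc_real) simp
  thus ?thesis unfolding K_def[symmetric] by (subst (asm) has_integral_reflect_real) auto
qed

section \<open>The logarithm of $(1 - e^{-s}) / s$\<close>

text \<open>An open convex neighbourhood of \<open>sector\<close>. It contains 0, where the sums
  start, and meets the imaginary axis only in |Im s| < 1, hence avoids the other zeros 2 pi i n of 1
  - exp(- s).\<close>

definition wedge :: "complex set" where "wedge = {s. \<bar>Im s\<bar> < Re s + 1}"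
definition sector :: "complex set" where "sector = {s. \<bar>Im s\<bar> \<le> Re s}"

lemma wedge_facts: "open wedge" "convex wedge" "0 \<in> wedge"
proof -
  have eq: "wedge = {s. (1 - \<i>) \<bullet> s > -1} \<inter> {s. (1 + \<i>) \<bullet> s > -1}"
    by (auto simp: wedge_def inner_complex_def)
  show "open wedge" unfolding eq by (intro open_Int open_halfspace_gt)
  show "convex wedge" unfolding eq by (intro convex_Int convex_halfspace_gt)
qed (simp add: wedge_def)

lemma Re_pos_in_wedge: "s \<in> sector \<Longrightarrow> s \<in> wedge"
  by (auto simp: wedge_def sector_def)

lemma exp_neq_1_wedge: "s \<in> wedge \<Longrightarrow> s \<noteq> 0 \<Longrightarrow> exp (- s) \<noteq> 1"
proof
  assume s: "s \<in> wedge" "s \<noteq> 0" and "exp (- s) = 1"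
  then obtain n :: int where n: "Re s = 0" "- Im s = of_int (2 * n) * pi" by (auto simp: exp_eq_1)
  have "\<bar>Im s\<bar> < 1" using s n by (auto simp: wedge_def)
  moreover have "\<bar>Im s\<bar> = 2 * \<bar>of_int n\<bar> * pi" using n
      by (metis abs_minus_cancel abs_mult abs_numeral abs_of_pos mult.assoc of_int_mult of_int_numeral
      pi_gt_zero)
  moreover have "n \<noteq> 0" using n s by (auto simp: complex_eq_iff)
  hence "\<bar>real_of_int n\<bar> \<ge> 1" by linarith
  ultimately show False using pi_gt3 mult_mono[of 1 "\<bar>real_of_int n\<bar>" 3 pi] by simp
qed

definition expq :: "complex \<Rightarrow> complex" where
  "expq s = (if s = 0 then 1 else (1 - exp (- s)) / s)"

lemma expq_holomorphic: "expq holomorphic_on A"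
proof -
  have d: "((\<lambda>z. - exp (- z)) has_field_derivative 1) (at (0 :: complex))"
    by (auto intro!: derivative_eq_intros)
  have "(\<lambda>z. if z = 0 then deriv (\<lambda>z. - exp (- z)) 0 else (- exp (- z) - (- exp (- 0))) / (z -
      0)) holomorphic_on UNIV"
    by (rule pole_lemma) (auto intro!: holomorphic_intros)
  also have "(\<lambda>z. if z = 0 then deriv (\<lambda>z. - exp (- z)) 0 else (- exp (- z) - (- exp (- 0))) / (z - 0)) =
      expq"
    using DERIV_imp_deriv[OF d] by (auto simp: expq_def fun_eq_iff)
  finally show ?thesis by (rule holomorphic_on_subset) auto
qed

lemma expq_nz: "s \<in> wedge \<Longrightarrow> expq s \<noteq> 0"
  using exp_neq_1_wedge[of s] by (auto simp: expq_def)

lemma expq_log_deriv: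
  assumes "s \<in> wedge" "s \<noteq> 0"
  shows "deriv expq s / expq s = 1 / (exp s - 1) - 1 / s"
proof -
  have e: "exp (- s) \<noteq> 1" using exp_neq_1_wedge[OF assms] .
  have "(expq has_field_derivative (exp (- s) * s - (1 - exp (- s))) / s ^ 2) (at s)"
  proof (rule has_field_derivative_transform_within_open[of "\<lambda>s. (1 - exp (- s)) / s" _ _ "- {0}"])
    show "((\<lambda>s. (1 - exp (- s)) / s) has_field_derivative (exp (- s) * s - (1 -
        exp (- s))) / s ^ 2) (at s)"
      using assms by (auto intro!: derivative_eq_intros simp: power2_eq_square)
  qed (use assms in \<open>auto simp: expq_def\<close>)
  hence d: "deriv expq s = (exp (- s) * s - (1 - exp (- s))) / s ^ 2" by (rule DERIV_imp_deriv)
  have alg: "((x * s - (1 - x)) / s ^ 2) / ((1 - x) / s) = x / (1 - x) - 1 / s" if "x \<noteq> 1" for x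
    using that assms by (simp add: divide_simps) (simp add: algebra_simps power2_eq_square)
  have "deriv expq s / expq s = exp (- s) / (1 - exp (- s)) - 1 / s"
    unfolding d using alg[OF e] assms by (simp add: expq_def)
  also have "exp (- s) / (1 - exp (- s)) = 1 / (exp s - 1)"
    using e by (simp add: exp_minus field_simps)
  finally show ?thesis .
qed

lemma wedge_primitive:
  assumes "f holomorphic_on wedge"
  shows "\<exists>g. (\<forall>s\<in>wedge. (g has_field_derivative f s) (at s)) \<and> g 0 = 0"
proof -
  obtain g where g: "\<And>s. s \<in> wedge \<Longrightarrow> (g has_field_derivative f s) (at s within wedge)"
    using holomorphic_convex_primitive'[OF wedge_facts(2,1) assms] by blast
  have "\<forall>s\<in>wedge. ((\<lambda>s. g s - g 0) has_field_derivative f s) (at s)"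
  proof
    fix s assume "s \<in> wedge"
    with g[OF this] have "(g has_field_derivative f s) (at s)"
      using at_within_open[OF _ wedge_facts(1)] by metis
    from DERIV_diff[OF this DERIV_const[of "g 0"]]
    show "((\<lambda>s. g s - g 0) has_field_derivative f s) (at s)" by simp
  qed
  thus ?thesis by (intro exI[of _ "\<lambda>s. g s - g 0"]) auto
qed

text \<open>The branch of \<open>ln ((1 - exp (- s)) / s)\<close> that vanishes at \<open>0\<close>, and its primitive.\<close>

definition lexpq :: "complex \<Rightarrow> complex" where
  "lexpq = (SOME g. (\<forall>s\<in>wedge. (g has_field_derivative deriv expq s / expq s) (at s)) \<and> g 0 = 0)"

definition lexpq_prim :: "complex \<Rightarrow> complex" where
  "lexpq_prim = (SOME g. (\<forall>s\<in>wedge. (g has_field_derivative lexpq s) (at s)) \<and> g 0 = 0)"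

lemma lexpq_deriv: "s \<in> wedge \<Longrightarrow> (lexpq has_field_derivative deriv expq s / expq s) (at s)"
  and lexpq_0: "lexpq 0 = 0"
proof -
  have "(\<lambda>s. deriv expq s / expq s) holomorphic_on wedge"
    by (intro holomorphic_intros expq_holomorphic expq_nz wedge_facts)
  from someI_ex[OF wedge_primitive[OF this]]
  show "s \<in> wedge \<Longrightarrow> (lexpq has_field_derivative deriv expq s / expq s) (at s)" "lexpq 0 = 0"
    unfolding lexpq_def by auto
qed

lemma lexpq_holomorphic: "lexpq holomorphic_on wedge"
  using lexpq_deriv by (auto simp: holomorphic_on_open wedge_facts)

lemma lexpq_prim_deriv: "s \<in> wedge \<Longrightarrow> (lexpq_prim has_field_derivative lexpq s) (at s)"
  and lexpq_prim_0: "lexpq_prim 0 = 0"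
  using someI_ex[OF wedge_primitive[OF lexpq_holomorphic]] unfolding lexpq_prim_def by auto

lemma lexpq_higher_deriv:
  "s \<in> wedge \<Longrightarrow> ((deriv ^^ n) lexpq has_field_derivative (deriv ^^ Suc n) lexpq s) (at s)"
  using has_field_derivative_higher_deriv[OF lexpq_holomorphic wedge_facts(1)] by simp

lemma lexpq_deriv_1: "s \<in> wedge \<Longrightarrow> s \<noteq> 0 \<Longrightarrow> deriv lexpq s = 1 / (exp s - 1) - 1 / s"
  using DERIV_imp_deriv[OF lexpq_deriv] expq_log_deriv by simp

lemma of_real_in_wedge: "x \<ge> 0 \<Longrightarrow> complex_of_real x \<in> wedge"
  by (simp add: wedge_def)

lemma tendsto_of_real_at_right_0: "isCont f 0 \<Longrightarrow> ((\<lambda>x. f (complex_of_real x)) \<longlongrightarrow> f 0) (at_right 0)"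
proof -
  assume "isCont f (0 :: complex)"
  moreover have "((\<lambda>x. complex_of_real x) \<longlongrightarrow> 0) (at_right 0)"
    by (intro tendsto_eq_intros) auto
  ultimately show ?thesis by (metis isCont_tendsto_compose of_real_0)
qed

text \<open>The closed form of the derivative is singular at 0, so the value is a limit along the
  positive reals. It is the Bernoulli number - 1/2, from which the term - t / 24 of ln P
  arises.\<close>

lemma lexpq_deriv_0: "deriv lexpq 0 = - 1 / 2"
proof -
  have c: "isCont (deriv lexpq) 0"
    using lexpq_higher_deriv[of 0 1] wedge_facts by (auto intro: DERIV_isCont)
  have "((\<lambda>x. deriv lexpq (complex_of_real x)) \<longlongrightarrow> complex_of_real (- 1 / 2)) (at_right 0)"
  proof (rule Lim_transform_eventually)
    have "((\<lambda>x::real. 1 / (exp x - 1) - 1 / x) \<longlongrightarrow> - 1 / 2) (at_right 0)" by real_asymp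
    thus "((\<lambda>x. complex_of_real (1 / (exp x - 1) - 1 / x)) \<longlongrightarrow> complex_of_real (- 1 / 2)) (at_right 0)"
      by (rule tendsto_of_real)
    show "\<forall>\<^sub>F x in at_right 0. complex_of_real (1 / (exp x - 1) - 1 / x) =
        deriv lexpq (complex_of_real x)"
      using eventually_at_right_less[of 0]
      by eventually_elim (simp add: lexpq_deriv_1 of_real_in_wedge exp_of_real)
  qed
  with tendsto_of_real_at_right_0[OF c] show ?thesis
    using tendsto_unique[of "at_right (0::real)"] by fastforce
qed

section \<open>Closed forms away from 0\<close>

text \<open>Here \<open>Ln s\<close> and the series in \<open>exp (- s)\<close> are holomorphic too;
  0 is a boundary point, reached through limits.\<close>

definition wedge_pos :: "complex set" where "wedge_pos = wedge \<inter> {s. Re s > 0}"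

lemma wedge_pos_facts: "open wedge_pos" "convex wedge_pos" "x > 0 \<Longrightarrow> complex_of_real x \<in> wedge_pos"
  using wedge_facts by (auto simp: wedge_pos_def of_real_in_wedge intro!: convex_Int
      convex_halfspace_Re_gt open_halfspace_Re_gt)

lemma wedge_posD: "s \<in> wedge_pos \<Longrightarrow> s \<in> wedge" "s \<in> wedge_pos \<Longrightarrow> Re s > 0" "s \<in> wedge_pos \<Longrightarrow> s \<noteq> 0"
  by (auto simp: wedge_pos_def)

lemma sector_wedge_pos: "s \<in> sector \<Longrightarrow> s \<noteq> 0 \<Longrightarrow> s \<in> wedge_pos"
  by (auto simp: wedge_pos_def sector_def wedge_def complex_eq_iff)

text \<open>Two functions with the same derivative differ by a constant, and the constant is read
  off at the boundary point 0, where approach along the reals turns the question into a real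
  limit.\<close>

lemma wedge_pos_eqI:
  assumes "\<And>s. s \<in> wedge_pos \<Longrightarrow> (f has_field_derivative D s) (at s)"
    and "\<And>s. s \<in> wedge_pos \<Longrightarrow> (g has_field_derivative D s) (at s)"
    and lim: "((\<lambda>x. f (complex_of_real x) - g (complex_of_real x)) \<longlongrightarrow> 0) (at_right 0)"
    and "s \<in> wedge_pos"
  shows "f s = g s"
proof -
  have "\<exists>c. \<forall>s\<in>wedge_pos. f s - g s = c"
  proof (rule has_field_derivative_zero_constant)
    fix s assume "s \<in> wedge_pos"
    thus "((\<lambda>s. f s - g s) has_field_derivative 0) (at s within wedge_pos)"
      using DERIV_diff[OF assms(1,2), of s] by (auto intro: has_field_derivative_at_within)
  qed (rule wedge_pos_facts)
  then obtain c where c: "\<And>s. s \<in> wedge_pos \<Longrightarrow> f s - g s = c" by auto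
  have "((\<lambda>x. f (complex_of_real x) - g (complex_of_real x)) \<longlongrightarrow> c) (at_right 0)"
    by (rule tendsto_eventually) (use eventually_at_right_less[of
        "0::real"] in eventually_elim, simp add: c wedge_pos_facts)
  hence "c = 0" using lim by (intro tendsto_unique[of "at_right (0::real)"]) auto
  thus ?thesis using c[OF assms(4)] by simp
qed

lemma Re_1_minus_exp: "Re s > 0 \<Longrightarrow> Re (1 - exp (- s)) > 0"
proof -
  assume "Re s > 0"
  have "Re (exp (- s)) \<le> norm (exp (- s))" by (rule complex_Re_le_cmod)
  also have "\<dots> < 1" using \<open>Re s > 0\<close> by simp
  finally show ?thesis by simp
qed

lemma Ln_1_minus_exp_deriv:
  assumes "Re s > 0"
  shows "((\<lambda>s. Ln (1 - exp (- s))) has_field_derivative 1 / (exp s - 1)) (at s)"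
proof -
  have "1 - exp (- s) \<notin> \<real>\<^sub>\<le>\<^sub>0" using Re_1_minus_exp[OF assms] by (auto simp: complex_nonpos_Reals_iff)
  moreover have "exp (- s) \<noteq> 1" using Re_1_minus_exp[OF assms] by auto
  ultimately show ?thesis
    by (auto intro!: derivative_eq_intros simp: exp_minus field_simps)
qed

lemma lexpq_eq:
  assumes "s \<in> wedge_pos"
  shows "lexpq s = Ln (1 - exp (- s)) - Ln s"
proof (rule wedge_pos_eqI[OF _ _ _ assms])
  fix s assume s: "s \<in> wedge_pos"
  show "(lexpq has_field_derivative 1 / (exp s - 1) - 1 / s) (at s)"
    using lexpq_deriv[of s] expq_log_deriv[of s] wedge_posD[OF s] by simp
  have "s \<notin> \<real>\<^sub>\<le>\<^sub>0" using wedge_posD[OF s] by (auto simp: complex_nonpos_Reals_iff)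
  thus "((\<lambda>s. Ln (1 - exp (- s)) - Ln s) has_field_derivative 1 / (exp s - 1) - 1 / s) (at s)"
    using wedge_posD[OF s]
    by (intro DERIV_diff Ln_1_minus_exp_deriv) (auto intro!: derivative_eq_intros simp: divide_inverse)
next
  have "isCont lexpq 0" using lexpq_deriv[of 0] wedge_facts by (auto intro: DERIV_isCont)
  from tendsto_of_real_at_right_0[OF this]
  have 1: "((\<lambda>x. lexpq (complex_of_real x)) \<longlongrightarrow> 0) (at_right 0)" by (simp add: lexpq_0)
  have "((\<lambda>x::real. ln (1 - exp (- x)) - ln x) \<longlongrightarrow> 0) (at_right 0)" by real_asymp
  from tendsto_of_real[OF this]
  have "((\<lambda>x. complex_of_real (ln (1 - exp (- x)) - ln x)) \<longlongrightarrow> 0) (at_right 0)" by simp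
  moreover have "\<forall>\<^sub>F x in at_right 0. complex_of_real (ln (1 - exp (- x)) - ln x) =
      Ln (1 - exp (- complex_of_real x)) - Ln (complex_of_real x)"
    using eventually_at_right_less[of 0]
  proof eventually_elim
    case (elim x)
    have "Ln (1 - exp (- complex_of_real x)) = Ln (complex_of_real (1 - exp (- x)))"
      by (simp add: exp_of_real flip: of_real_minus)
    also have "\<dots> = complex_of_real (ln (1 - exp (- x)))"
      by (rule Ln_of_real) (use elim in simp)
    finally show ?case using elim by (simp add: Ln_of_real)
  qed
  ultimately have "((\<lambda>x. Ln (1 - exp (- complex_of_real x)) - Ln (complex_of_real x)) \<longlongrightarrow> 0) (at_right 0)"
    by (rule Lim_transform_eventually)
  from tendsto_diff[OF 1 this] show "((\<lambda>x. lexpq (complex_of_real x) - (Ln (1 -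
      exp (- complex_of_real x)) - Ln (complex_of_real x))) \<longlongrightarrow> 0) (at_right 0)"
    by simp
qed

section \<open>Polylogarithms of integer order\<close>

text \<open>Integer exponents put the dilogarithm (k = -2), the logarithm (k = -1) and the series
  met in the divisor sums (k \<ge> 0) into one family, in which q d/dq raises k by one.\<close>

definition li :: "int \<Rightarrow> complex fps" where
  "li k = Abs_fps (\<lambda>m. if m = 0 then 0 else of_nat m powi k)"

text \<open>The polylogarithm of order \<open>- k\<close> at \<open>exp (- s)\<close>.\<close>

definition LI :: "int \<Rightarrow> complex \<Rightarrow> complex" where
  "LI k s = eval_fps (li k) (exp (- s))"

lemma li_deriv: "fps_X * fps_deriv (li k) = li (k + 1)"
proof (rule fps_ext)
  fix m
  show "fps_nth (fps_X * fps_deriv (li k)) m = fps_nth (li (k + 1)) m"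
    by (cases m) (simp_all add: li_def power_int_add_1' del: of_nat_Suc)
qed

text \<open>For k \<le> 0 the geometric series dominates; each application of q d/dq then raises k
  without shrinking the radius.\<close>

lemma li_conv_radius: "fps_conv_radius (li k) \<ge> 1"
proof -
  have up: "fps_conv_radius (li (k + 1)) \<ge> 1" if "fps_conv_radius (li k) \<ge> 1" for k
  proof -
    have "1 \<le> min (fps_conv_radius (fps_X :: complex fps)) (fps_conv_radius (fps_deriv (li k)))"
      using that fps_conv_radius_deriv[of "li k"] by (auto intro: order_trans)
    also note fps_conv_radius_mult[of fps_X "fps_deriv (li k)"]
    finally show ?thesis by (simp only: li_deriv)
  qed
  have neg: "fps_conv_radius (li k) \<ge> 1" if "k \<le> 0" for k
    unfolding fps_conv_radius_def
  proof (rule conv_radius_geI_ex')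
    fix r :: real assume r: "0 < r" "ereal r < 1"
    hence r1: "r < 1" by (simp add: one_ereal_def)
    show "summable (\<lambda>n. fps_nth (li k) n * of_real r ^ n)"
    proof (rule summable_comparison_test)
      show "summable (\<lambda>n. r ^ n)" using r r1 by (intro summable_geometric) auto
      have "norm (fps_nth (li k) n * of_real r ^ n) \<le> r ^ n" for n
      proof (cases "n = 0")
        case False
        have "norm (of_nat n powi k :: complex) \<le> 1"
        proof -
          have "norm (of_nat n powi k :: complex) = 1 / real n ^ nat (- k)"
            using that by (simp add: norm_power_int power_int_def inverse_eq_divide power_one_over
                norm_divide norm_power)
          also have "\<dots> \<le> 1" using False by simp
          finally show ?thesis .
        qed
        thus ?thesis using False r by (auto simp: li_def norm_mult norm_power mult_left_le_one_le)
      qed (simp add: li_def)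
      thus "\<exists>N. \<forall>n\<ge>N. norm (fps_nth (li k) n * of_real r ^ n) \<le> r ^ n" by blast
    qed
  qed
  show ?thesis
  proof (cases "k \<le> 0")
    case False
    have "fps_conv_radius (li (int n)) \<ge> 1" for n
    proof (induction n)
      case (Suc n)
      from up[OF this] show ?case by (simp add: add.commute)
    qed (use neg[of 0] in simp)
    from this[of "nat k"] False show ?thesis by simp
  qed (rule neg)
qed

lemma disc_exp: "Re s > 0 \<Longrightarrow> ereal (norm (exp (- s))) < fps_conv_radius (li k)"
proof -
  assume "Re s > 0"
  hence "ereal (norm (exp (- s))) < 1" by (simp add: one_ereal_def)
  thus ?thesis using li_conv_radius[of k] by (rule less_le_trans)
qed

lemma LI_deriv:
  assumes "Re s > 0"
  shows "(LI k has_field_derivative - LI (k + 1) s) (at s)"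
proof -
  let ?q = "exp (- s)"
  have "((\<lambda>s. eval_fps (li k) (exp (- s))) has_field_derivative eval_fps (fps_deriv (li k)) ?q *
      (- ?q)) (at s)"
  proof (rule DERIV_chain2[where f = "eval_fps (li k)" and g = "\<lambda>s. exp (- s)"])
    show "(eval_fps (li k) has_field_derivative eval_fps (fps_deriv (li k)) ?q) (at ?q)"
      by (rule has_field_derivative_eval_fps[OF disc_exp[OF assms]])
    show "((\<lambda>s. exp (- s)) has_field_derivative - ?q) (at s)"
      by (auto intro!: derivative_eq_intros)
  qed
  moreover have "eval_fps (li (k + 1)) ?q = ?q * eval_fps (fps_deriv (li k)) ?q"
    unfolding li_deriv[symmetric]
    using disc_exp[OF assms, of k] fps_conv_radius_deriv[of "li k"]
    by (subst eval_fps_mult) (auto intro: less_le_trans)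
  ultimately show ?thesis by (simp add: LI_def[abs_def] mult.commute)
qed

lemma LI_sums:
  assumes "Re s > 0"
  shows "(\<lambda>m. of_nat (Suc m) powi k * exp (- (of_nat (Suc m) * s))) sums LI k s"
proof -
  have "(\<lambda>m. fps_nth (li k) m * exp (- s) ^ m) sums LI k s"
    unfolding LI_def by (intro sums_eval_fps disc_exp assms)
  from sums_split_initial_segment[OF this, of 1]
  have "(\<lambda>m. fps_nth (li k) (Suc m) * exp (- s) ^ (Suc m)) sums LI k s" by (simp add: li_def)
  also have "(\<lambda>m. exp (- s) ^ Suc m) = (\<lambda>m. exp (- (of_nat (Suc m) * s)))"
    by (simp only: exp_of_nat_mult[symmetric] mult_minus_right)
  finally show ?thesis by (simp add: li_def del: power_Suc of_nat_Suc)
qed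

lemma LI_0:
  assumes "Re s > 0"
  shows "LI 0 s = 1 / (exp s - 1)"
proof -
  have n: "norm (exp (- s)) < 1" using assms by simp
  have "(\<lambda>m. exp (- s) * exp (- s) ^ m) sums (exp (- s) * (1 / (1 - exp (- s))))"
    by (intro sums_mult geometric_sums n)
  also have "(\<lambda>m. exp (- s) * exp (- s) ^ m) = (\<lambda>m. of_nat (Suc m) powi 0 * exp (- (of_nat (Suc m) *
      s)))"
    by (simp add: exp_of_nat_mult[symmetric] mult_exp_exp algebra_simps)
  finally have "LI 0 s = exp (- s) * (1 / (1 - exp (- s)))"
    using LI_sums[OF assms, of 0] by (rule sums_unique2[symmetric])
  also have "\<dots> = 1 / (exp s - 1)"
    using Re_1_minus_exp[OF assms] by (auto simp: exp_minus field_simps)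
  finally show ?thesis .
qed

lemma LI_minus_1:
  assumes "Re s > 0"
  shows "LI (-1) s = - Ln (1 - exp (- s))"
proof -
  have n: "norm (- exp (- s)) < 1" using assms by simp
  from Ln_series'[OF n] have "(\<lambda>n. exp (- s) ^ n / of_nat n) sums (- Ln (1 - exp (- s)))"
    using sums_minus by fastforce
  moreover have "(\<lambda>n. exp (- s) ^ n / of_nat n) = (\<lambda>m. fps_nth (li (-1)) m * exp (- s) ^ m)"
    by (simp add: li_def fun_eq_iff power_int_minus divide_inverse)
  ultimately show ?thesis
    using sums_eval_fps[OF disc_exp[OF assms], of "-1"] unfolding LI_def by (metis sums_unique2)
qed

text \<open>\<open>LI n\<close> has the singular part n! / s^(n + 1) at 0; once it is removed, what
  remains is, up to sign, a derivative of \<open>lexpq\<close> and therefore regular at 0. This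
  links divisor sums to sums of a regular function over the multiples of t.\<close>

lemma lexpq_higher_deriv_eq:
  assumes "s \<in> wedge_pos"
  shows "(deriv ^^ Suc n) lexpq s = (-1) ^ n * (LI (int n) s - fact n / s ^ Suc n)"
  using assms
proof (induction n arbitrary: s)
  case (0 s)
  thus ?case using wedge_posD[OF 0] by (simp add: lexpq_deriv_1 LI_0)
next
  case (Suc n s)
  note s = wedge_posD[OF Suc.prems]
  have "((deriv ^^ Suc n) lexpq has_field_derivative
          (-1) ^ n * (- LI (int n + 1) s - fact n * (- of_nat (Suc n) / s ^ Suc (Suc n)))) (at s)"
  proof (rule has_field_derivative_transform_within_open[OF _ wedge_pos_facts(1) Suc.prems
      Suc.IH[symmetric]])
    have "((\<lambda>s. inverse (s ^ Suc n)) has_field_derivative (- of_nat (Suc n) / s ^ Suc (Suc n))) (at s)"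
      using s by (auto intro!: derivative_eq_intros simp: field_simps simp del: power_Suc) (simp add:
          field_simps power2_eq_square)
    hence "((\<lambda>s. LI (int n) s - fact n * inverse (s ^ Suc n)) has_field_derivative
         (- LI (int n + 1) s - fact n * (- of_nat (Suc n) / s ^ Suc (Suc n)))) (at s)"
      by (intro DERIV_diff LI_deriv s DERIV_cmult)
    from DERIV_cmult[OF this, of "(-1) ^ n"]
    show "((\<lambda>s. (-1) ^ n * (LI (int n) s - fact n / s ^ Suc n)) has_field_derivative
          (-1) ^ n * (- LI (int n + 1) s - fact n * (- of_nat (Suc n) / s ^ Suc (Suc n)))) (at s)"
      by (simp only: divide_inverse)
  qed
  from DERIV_imp_deriv[OF this] show ?case by (simp add: algebra_simps)
qed

section \<open>Decay of the derivatives in the sector\<close>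

lemma power_le_fact_exp: "y \<ge> 0 \<Longrightarrow> y ^ j \<le> fact j * exp (y :: real)"
proof -
  assume "y \<ge> 0"
  have "(\<Sum>n\<in>{j}. y ^ n /\<^sub>R fact n) \<le> (\<Sum>n. y ^ n /\<^sub>R fact n)"
    using \<open>y \<ge> 0\<close> by (intro sum_le_suminf summable_exp_generic) auto
  thus ?thesis by (simp add: exp_def field_simps)
qed

lemma exp_minus_le_fact: "y > 0 \<Longrightarrow> exp (- y) \<le> fact j / (y :: real) ^ j"
proof -
  assume "y > 0"
  hence "exp (- y) * y ^ j \<le> exp (- y) * (fact j * exp y)"
    using power_le_fact_exp[of y j] by (intro mult_left_mono) auto
  also have "\<dots> = fact j" by (simp add: exp_minus)
  finally show ?thesis using \<open>y > 0\<close> by (simp add: pos_le_divide_eq)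
qed

text \<open>Replacing exp(- y) by its bound (k + 2)! / y^(k + 2) cancels the growth m^k and leaves
  the convergent sum of 1 / m^2.\<close>

lemma LI_norm_le:
  assumes "Re s > 0"
  shows "norm (LI (int k) s) \<le> fact (k + 2) * (pi\<^sup>2 / 6) / Re s ^ (k + 2)"
proof -
  let ?f = "\<lambda>m. of_nat (Suc m) powi int k * exp (- (of_nat (Suc m) * s)) :: complex"
  let ?g = "\<lambda>m. fact (k + 2) / Re s ^ (k + 2) * (1 / (real m + 1)\<^sup>2)"
  have g: "?g sums (fact (k + 2) / Re s ^ (k + 2) * (pi\<^sup>2 / 6))"
    using inverse_squares_sums by (intro sums_mult) (simp add: add.commute)
  have le: "norm (?f m) \<le> ?g m" for m
  proof -
    let ?y = "real (Suc m) * Re s"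
    have y: "?y > 0" using assms by simp
    have "norm (?f m) = real (Suc m) ^ k * exp (- ?y)"
      by (simp add: norm_mult norm_power del: of_nat_Suc)
    also have "exp (- ?y) \<le> fact (k + 2) / ?y ^ (k + 2)"
      by (rule exp_minus_le_fact[OF y])
    also have "real (Suc m) ^ k * (fact (k + 2) / ?y ^ (k + 2)) = ?g m"
      using assms by (simp add: power_mult_distrib power_add power2_eq_square add.commute)
    finally show ?thesis by simp
  qed
  have "norm (LI (int k) s) \<le> suminf ?g"
    unfolding sums_unique[OF LI_sums[OF assms]]
    by (rule norm_suminf_le[OF le sums_summable[OF g]])
  thus ?thesis using sums_unique[OF g] by simp
qed

lemma sector_Re_ge: "s \<in> sector \<Longrightarrow> norm s \<le> 2 * Re s"
  using cmod_le[of s] by (simp add: sector_def)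

text \<open>Near 0 this is compactness, away from 0 both parts in
  \<open>lexpq_higher_deriv_eq\<close> decay at least quadratically. The restriction n \<ge> 2 keeps
  out the first derivative, which decays only like 1/s.\<close>

lemma lexpq_deriv_bound:
  assumes "n \<ge> 2"
  shows "\<exists>C>0. \<forall>s\<in>sector. norm ((deriv ^^ n) lexpq s) \<le> C / (1 + (norm s)\<^sup>2)"
proof -
  obtain k where n: "n = Suc k" and k: "k \<ge> 1" using assms by (cases n) auto
  have closed: "closed sector"
  proof -
    have "closed {s. \<bar>Im s\<bar> \<le> Re s}" by (intro closed_Collect_le continuous_intros)
    thus ?thesis by (simp add: sector_def)
  qed
  have "compact ((deriv ^^ n) lexpq ` (sector \<inter> cball 0 1))"
  proof (rule compact_continuous_image)
    show "continuous_on (sector \<inter> cball 0 1) ((deriv ^^ n) lexpq)"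
      by (rule holomorphic_on_imp_continuous_on[OF holomorphic_on_subset[OF holomorphic_higher_deriv[OF
          lexpq_holomorphic wedge_facts(1)]]])
         (auto intro: Re_pos_in_wedge)
    show "compact (sector \<inter> cball 0 1)" using closed by (intro closed_Int_compact) auto
  qed
  from compact_imp_bounded[OF this] obtain C1
    where "\<forall>x\<in>(deriv ^^ n) lexpq ` (sector \<inter> cball 0 1). norm x \<le> C1" unfolding bounded_iff by blast
  hence C1: "norm ((deriv ^^ n) lexpq s) \<le> C1" if "s \<in> sector" "norm s \<le> 1" for s
    using that by auto
  define C2 where "C2 = fact (k + 2) * (pi\<^sup>2 / 6) * 2 ^ (k + 2) + fact k"
  have C2: "norm ((deriv ^^ n) lexpq s) \<le> C2 / (norm s)\<^sup>2" if s: "s \<in> sector" "norm s \<ge> 1" for s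
  proof -
    have Re: "Re s \<ge> norm s / 2" using sector_Re_ge[OF s(1)] by simp
    hence Re0: "Re s > 0" using s(2) by linarith
    have "s \<noteq> 0" using s by auto
    have p: "norm s ^ 2 \<le> norm s ^ (k + 2)" "norm s ^ 2 \<le> norm s ^ Suc k"
      using s k by (intro power_increasing; simp)+
    have "norm ((deriv ^^ n) lexpq s) \<le> norm (LI (int k) s) + fact k / norm s ^ Suc k"
      unfolding n lexpq_higher_deriv_eq[OF sector_wedge_pos[OF s(1) \<open>s \<noteq> 0\<close>]]
      using norm_triangle_ineq4[of "LI (int k) s" "fact k / s ^ Suc k"]
      by (simp add: norm_mult norm_power norm_divide)
    also have "norm (LI (int k) s) \<le> fact (k + 2) * (pi\<^sup>2 / 6) / (norm s / 2) ^ (k + 2)"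
      by (rule order_trans[OF LI_norm_le[OF Re0]])
         (use Re s in \<open>intro divide_left_mono power_mono mult_pos_pos zero_less_power, auto\<close>)
    also have "\<dots> = fact (k + 2) * (pi\<^sup>2 / 6) * 2 ^ (k + 2) / norm s ^ (k + 2)"
      by (simp add: power_divide)
    also have "\<dots> \<le> fact (k + 2) * (pi\<^sup>2 / 6) * 2 ^ (k + 2) / norm s ^ 2"
      using p \<open>s \<noteq> 0\<close> by (intro frac_le) auto
    also have "fact k / norm s ^ Suc k \<le> fact k / norm s ^ 2"
      using p \<open>s \<noteq> 0\<close> by (intro frac_le) auto
    finally show ?thesis by (simp add: C2_def add_divide_distrib)
  qed
  \<comment> \<open>The factor 2 covers both ranges: 1 + |s|^2 is at most 2 for |s| \<le> 1 and at
    most 2 |s|^2 beyond.\<close>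
  define C where "C = 2 * (\<bar>C1\<bar> + \<bar>C2\<bar> + 1)"
  have "norm ((deriv ^^ n) lexpq s) \<le> C / (1 + (norm s)\<^sup>2)" if s: "s \<in> sector" for s
  proof (cases "norm s \<le> 1")
    case True
    hence "(norm s)\<^sup>2 \<le> 1" by (simp add: power_le_one)
    hence "C / 2 \<le> C / (1 + (norm s)\<^sup>2)" by (intro divide_left_mono) (auto simp: C_def intro!:
        mult_pos_pos add_pos_nonneg)
    moreover have "norm ((deriv ^^ n) lexpq s) \<le> C / 2" using C1[OF s True] by (simp add: C_def)
    ultimately show ?thesis by linarith
  next
    case False
    hence "(norm s)\<^sup>2 \<ge> 1" by simp
    have "norm ((deriv ^^ n) lexpq s) \<le> C2 / (norm s)\<^sup>2" using C2[OF s] False by simp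
    also have "\<dots> \<le> (C / 2) / (norm s)\<^sup>2" by (intro divide_right_mono) (auto simp: C_def)
    also have "\<dots> = C / (2 * (norm s)\<^sup>2)" by simp
    also have "\<dots> \<le> C / (1 + (norm s)\<^sup>2)"
      using \<open>(norm s)\<^sup>2 \<ge> 1\<close> by (intro divide_left_mono) (auto simp: C_def intro!: mult_pos_pos)
    finally show ?thesis .
  qed
  thus ?thesis by (intro exI[of _ C]) (auto simp: C_def)
qed

section \<open>Euler-Maclaurin summation along a ray\<close>

text \<open>For k \<le> 0 the coefficients m^k are at most 1, so a geometric series dominates. The
  resulting exponential decay disposes of the boundary terms at K t.\<close>

lemma LI_neg_norm_le:
  assumes "Re s > 0" "k \<le> 0"
  shows "norm (LI k s) \<le> 1 / (exp (Re s) - 1)"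
proof -
  have n: "norm (exp (- Re s)) < 1" using assms by simp
  have g: "(\<lambda>m. exp (- Re s) * exp (- Re s) ^ m) sums (exp (- Re s) * (1 / (1 - exp (- Re s))))"
    by (intro sums_mult geometric_sums n)
  have le: "norm (of_nat (Suc m) powi k * exp (- (of_nat (Suc m) * s))) \<le>
      exp (- Re s) * exp (- Re s) ^ m" for m
  proof -
    have "norm (of_nat (Suc m) powi k :: complex) \<le> 1"
      using assms(2) by (auto simp: norm_power_int power_int_def inverse_eq_divide power_one_over
          norm_divide norm_power simp del: of_nat_Suc)
    hence "norm (of_nat (Suc m) powi k * exp (- (of_nat (Suc m) * s))) \<le>
        1 * exp (- (real (Suc m) * Re s))"
      unfolding norm_mult by (intro mult_mono) (auto simp del: of_nat_Suc)
    also have "\<dots> = exp (- Re s) ^ Suc m"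
      by (simp only: exp_of_nat_mult[symmetric] mult_minus_right mult_1_left)
    finally show ?thesis by simp
  qed
  have "norm (LI k s) \<le> (\<Sum>m. exp (- Re s) * exp (- Re s) ^ m)"
    unfolding sums_unique[OF LI_sums[OF assms(1)]]
    by (rule norm_suminf_le[OF le sums_summable[OF g]])
  also have "\<dots> = exp (- Re s) * (1 / (1 - exp (- Re s)))" using g by (rule sums_unique[symmetric])
  also have "\<dots> = 1 / (exp (Re s) - 1)" using assms by (simp add: exp_minus field_simps)
  finally show ?thesis .
qed

lemma LI_neg_tendsto_0:
  assumes "Re t > 0" "k \<le> 0"
  shows "(\<lambda>n. LI k (of_nat n * t)) \<longlonglongrightarrow> 0"
proof (rule Lim_null_comparison)
  show "\<forall>\<^sub>F n in sequentially. norm (LI k (of_nat n * t)) \<le> 1 / (exp (real n * Re t) - 1)"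
    using eventually_gt_at_top[of 0]
    by eventually_elim (use LI_neg_norm_le[of "of_nat _ * t" k] assms in auto)
  show "(\<lambda>n. 1 / (exp (real n * Re t) - 1)) \<longlonglongrightarrow> 0"
    using assms(1) by real_asymp
qed

text \<open>The value of the dilogarithm at 1. The terms 1 / m^2 dominate uniformly in x > 0, so the
  limit may be taken under the sum by Tannery's theorem.\<close>

lemma LI_minus_2_tendsto: "((\<lambda>x. LI (-2) (complex_of_real x)) \<longlongrightarrow> of_real (pi\<^sup>2 / 6)) (at_right 0)"
proof -
  let ?a = "\<lambda>m x. 1 / (real m + 1)\<^sup>2 * exp (- (real (Suc m) * x))"
  have 1: "((\<lambda>x. \<Sum>m. ?a m x) \<longlongrightarrow> (\<Sum>m. 1 / (real m + 1)\<^sup>2)) (at_right 0)"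
  proof (rule tannerys_theorem[THEN conjunct2, THEN conjunct2])
    show "summable (\<lambda>m. 1 / (real m + 1)\<^sup>2)" using inverse_squares_sums
        by (simp add: sums_iff add.commute)
    show "((\<lambda>x. ?a m x) \<longlongrightarrow> 1 / (real m + 1)\<^sup>2) (at_right 0)" for m
      by (rule tendsto_eq_intros refl | simp)+
    have "\<forall>\<^sub>F x in at_right (0::real). \<forall>m. norm (?a m x) \<le> 1 / (real m + 1)\<^sup>2"
      using eventually_at_right_less[of 0] by eventually_elim (auto simp: divide_simps)
    hence "\<forall>\<^sub>F p in sequentially \<times>\<^sub>F at_right (0::real). True \<and> (\<forall>m. norm (?a m (snd p)) \<le>
        1 / (real m + 1)\<^sup>2)"
      by (intro eventually_prodI) simp_all
    thus "\<forall>\<^sub>F (m, x) in sequentially \<times>\<^sub>F at_right 0. norm (?a m x) \<le> 1 / (real m + 1)\<^sup>2"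
      by (rule eventually_mono) auto
  qed auto
  have sum: "(\<Sum>m. 1 / (real m + 1)\<^sup>2) = pi\<^sup>2 / 6" using inverse_squares_sums
      by (simp add: sums_iff add.commute)
  have "((\<lambda>x. complex_of_real (\<Sum>m. ?a m x)) \<longlongrightarrow> complex_of_real (pi\<^sup>2 / 6)) (at_right 0)"
    using tendsto_of_real[OF 1] unfolding sum .
  moreover have "\<forall>\<^sub>F x in at_right 0. complex_of_real (\<Sum>m. ?a m x) = LI (-2) (complex_of_real x)"
    using eventually_at_right_less[of 0]
  proof eventually_elim
    case (elim x)
    have "(\<lambda>m. of_nat (Suc m) powi (-2) * exp (- (of_nat (Suc m) * complex_of_real x))) =
        (\<lambda>m. complex_of_real (?a m x))"
      by (simp add: fun_eq_iff power_int_minus divide_inverse add.commute flip: exp_of_real)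
    with LI_sums[of "complex_of_real x" "-2"] elim have
        "(\<lambda>m. complex_of_real (?a m x)) sums LI (-2) (complex_of_real x)"
      by simp
    moreover from this have "summable (\<lambda>m. ?a m x)"
        by (simp only: sums_summable flip: summable_of_real_iff[where 'a = complex])
    hence "(\<lambda>m. complex_of_real (?a m x)) sums complex_of_real (\<Sum>m. ?a m x)"
        by (intro sums_of_real summable_sums)
    ultimately show ?case by (rule sums_unique2[symmetric])
  qed
  ultimately show ?thesis by (rule Lim_transform_eventually)
qed

text \<open>The constant - pi^2 / 6 is forced by \<open>lexpq_prim 0 = 0\<close> and the value of
  the dilogarithm at 1; divided by t it becomes the leading term of ln P.\<close>

lemma lexpq_prim_eq:
  assumes "s \<in> wedge_pos"
  shows "lexpq_prim s = LI (-2) s - of_real (pi\<^sup>2 / 6) - s * Ln s + s"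
proof (rule wedge_pos_eqI[OF _ _ _ assms])
  fix s assume s: "s \<in> wedge_pos"
  show "(lexpq_prim has_field_derivative - LI (-1) s - Ln s) (at s)"
    using lexpq_prim_deriv[of s] wedge_posD[OF s] by (simp add: lexpq_eq[OF s] LI_minus_1)
  have "s \<notin> \<real>\<^sub>\<le>\<^sub>0" using wedge_posD[OF s] by (auto simp: complex_nonpos_Reals_iff)
  hence "((\<lambda>s. s * Ln s) has_field_derivative Ln s + 1) (at s)"
    using wedge_posD[OF s] by (auto intro!: derivative_eq_intros)
  hence "((\<lambda>s. LI (-2) s - of_real (pi\<^sup>2 / 6) - s * Ln s + s) has_field_derivative (- LI (- 2 + 1) s - 0 -
      (Ln s + 1) + 1)) (at s)"
    using wedge_posD[OF s] by (intro DERIV_add DERIV_diff LI_deriv DERIV_const DERIV_ident)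
  thus "((\<lambda>s. LI (-2) s - of_real (pi\<^sup>2 / 6) - s * Ln s + s) has_field_derivative (- LI (-1) s -
      Ln s)) (at s)"
    by simp
next
  have "isCont lexpq_prim 0" using lexpq_prim_deriv[of 0] wedge_facts by (auto intro: DERIV_isCont)
  from tendsto_of_real_at_right_0[OF this]
  have 1: "((\<lambda>x. lexpq_prim (complex_of_real x)) \<longlongrightarrow> 0) (at_right 0)" by (simp add: lexpq_prim_0)
  have "((\<lambda>x::real. x * ln x) \<longlongrightarrow> 0) (at_right 0)" by real_asymp
  from tendsto_of_real[OF this]
  have "((\<lambda>x. complex_of_real (x * ln x)) \<longlongrightarrow> 0) (at_right 0)" by simp
  moreover have "\<forall>\<^sub>F x in at_right 0. complex_of_real (x * ln x) =
      complex_of_real x * Ln (complex_of_real x)"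
    using eventually_at_right_less[of 0] by eventually_elim (simp add: Ln_of_real)
  ultimately have 2: "((\<lambda>x. complex_of_real x * Ln (complex_of_real x)) \<longlongrightarrow> 0) (at_right 0)"
    by (rule Lim_transform_eventually)
  have 3: "((\<lambda>x. complex_of_real x) \<longlongrightarrow> 0) (at_right 0)" by (intro tendsto_eq_intros) auto
  have "((\<lambda>x. lexpq_prim (complex_of_real x) -
          (LI (-2) (complex_of_real x) - of_real (pi\<^sup>2 / 6) - complex_of_real x * Ln (complex_of_real x) +
              complex_of_real x)) \<longlongrightarrow>
          0 - (of_real (pi\<^sup>2 / 6) - of_real (pi\<^sup>2 / 6) - 0 + 0)) (at_right 0)"
    by (intro tendsto_add tendsto_diff 1 2 3 LI_minus_2_tendsto tendsto_const)
  thus "((\<lambda>x. lexpq_prim (complex_of_real x) -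
          (LI (-2) (complex_of_real x) - of_real (pi\<^sup>2 / 6) - complex_of_real x * Ln (complex_of_real x) +
              complex_of_real x)) \<longlongrightarrow> 0) (at_right 0)"
    by simp
qed

section \<open>The Euler-Maclaurin remainder\<close>

text \<open>The sequence \<open>F\<close> lists successive derivatives. In the Taylor expansions of
  \<open>F 0\<close>, \<open>F 1\<close> and \<open>F 2\<close> at \<open>a\<close> the terms of
  third order cancel, since 1/6 - 1/4 + 1/12 = 0, and only fourth derivatives remain; their bounds
  add up to 1/6 + 1/4 + 1/12 = 1/2.\<close>

lemma euler_maclaurin_remainder:
  fixes F :: "nat \<Rightarrow> complex \<Rightarrow> complex"
  assumes F: "\<And>i x. x \<in> closed_segment a b \<Longrightarrow> i \<le> 3 \<Longrightarrow> (F i has_field_derivative F (Suc i) x) (at x)"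
    and B: "\<And>x. x \<in> closed_segment a b \<Longrightarrow> norm (F 4 x) \<le> B"
  shows "norm (F 0 b - F 0 a - (b - a) / 2 * (F 1 a + F 1 b) + (b - a)\<^sup>2 / 12 * (F 2 b - F 2 a)) \<le>
      B * norm (b - a) ^ 4"
proof -
  define h where "h = b - a"
  have T: "norm (F j b - (\<Sum>i\<le>n. F (i + j) a * h ^ i / fact i)) \<le> B * norm h ^ Suc n / fact n"
    if "n + j = 3" for n j
  proof -
    have "norm ((\<lambda>i. F (i + j)) 0 b - (\<Sum>i\<le>n. (\<lambda>i. F (i + j)) i a * (b - a) ^ i / fact i)) \<le>
        B * norm (b - a) ^ Suc n / fact n"
    proof (rule complex_Taylor[of "closed_segment a b"])
      fix i x assume "x \<in> closed_segment a b" "i \<le> n"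
      thus "(F (i + j) has_field_derivative F (Suc i + j) x) (at x within closed_segment a b)"
        using F[of x "i + j"] that by (auto intro: has_field_derivative_at_within)
    next
      fix x assume "x \<in> closed_segment a b"
      moreover have "Suc n + j = 4" using that by simp
      ultimately show "norm (F (Suc n + j) x) \<le> B" using B by simp
    qed auto
    thus ?thesis by (simp add: h_def)
  qed
  have T0: "norm (F 0 b - (F 0 a + F 1 a * h + F 2 a * h ^ 2 / 2 + F 3 a * h ^ 3 / 6)) \<le>
      B * norm h ^ 4 / 6"
    using T[of 3 0] by (simp add: numeral_eq_Suc)
  have T1: "norm (F 1 b - (F 1 a + F 2 a * h + F 3 a * h ^ 2 / 2)) \<le> B * norm h ^ 3 / 2"
    using T[of 2 1] by (simp add: numeral_eq_Suc)
  have T2: "norm (F 2 b - (F 2 a + F 3 a * h)) \<le> B * norm h ^ 2"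
    using T[of 1 2] by (simp add: numeral_eq_Suc)
  define T0' where "T0' = F 0 b - (F 0 a + F 1 a * h + F 2 a * h ^ 2 / 2 + F 3 a * h ^ 3 / 6)"
  define T1' where "T1' = F 1 b - (F 1 a + F 2 a * h + F 3 a * h ^ 2 / 2)"
  define T2' where "T2' = F 2 b - (F 2 a + F 3 a * h)"
  have "F 0 b - F 0 a - h / 2 * (F 1 a + F 1 b) + h\<^sup>2 / 12 * (F 2 b - F 2 a) =
      T0' - h / 2 * T1' + h\<^sup>2 / 12 * T2'"
    unfolding T0'_def T1'_def T2'_def by (simp add: field_simps power2_eq_square power3_eq_cube)
  also have "norm \<dots> \<le> norm T0' + norm (h / 2 * T1') + norm (h\<^sup>2 / 12 * T2')"
    by (meson norm_triangle_ineq norm_triangle_ineq4 order_trans add_right_mono)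
  also have "\<dots> \<le> B * norm h ^ 4 / 6 + norm h / 2 * (B * norm h ^ 3 / 2) +
      norm h ^ 2 / 12 * (B * norm h ^ 2)"
    unfolding norm_mult using T0 T1 T2
    by (intro add_mono mult_mono) (auto simp: norm_divide norm_power T0'_def T1'_def T2'_def)
  also have "\<dots> = B * norm h ^ 4 / 2" by (simp add: power_numeral_reduce)
  also have "\<dots> \<le> B * norm h ^ 4"
  proof -
    have "0 \<le> B" using B[of a] norm_ge_zero order_trans by blast
    thus ?thesis by simp
  qed
  finally show ?thesis by (simp add: h_def)
qed

text \<open>A telescoping comparison: for y \<ge> 0 and 0 < x \<le> 1, (1 + y)(1 + y + x) \<le> 2 (1
  + y)^2 \<le> 4 (1 + y^2). It plays the part of the integral of 1 / (1 + u^2), uniformly in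
  K.\<close>

lemma sum_inverse_quadratic:
  assumes "0 < x" "x \<le> 1"
  shows "(\<Sum>k<K. 1 / (1 + (real k * x)\<^sup>2)) \<le> 4 / x"
proof -
  have "1 / (1 + (real k * x)\<^sup>2) \<le> 4 / x * (1 / (1 + real k * x) - 1 / (1 + real (Suc k) * x))" for k
  proof -
    define y where "y = real k * x"
    have y: "y \<ge> 0" using assms by (simp add: y_def)
    have "(1 + y) * (1 + (y + x)) \<le> (1 + y) * (2 * (1 + y))" using y assms by (intro mult_left_mono) auto
    also have "\<dots> \<le> 4 * (1 + y\<^sup>2)" using zero_le_power2[of "y - 1"]
        by (simp add: power2_eq_square algebra_simps)
    finally have "1 / (1 + y\<^sup>2) \<le> 4 / ((1 + y) * (1 + (y + x)))"
      using y assms by (simp add: divide_simps add_pos_nonneg mult.commute)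
    also have "\<dots> = 4 / x * (1 / (1 + y) - 1 / (1 + (y + x)))"
      using y assms by (simp add: field_simps)
    finally show ?thesis by (simp add: y_def algebra_simps)
  qed
  hence "(\<Sum>k<K. 1 / (1 + (real k * x)\<^sup>2)) \<le> (\<Sum>k<K. 4 / x * (1 / (1 + real k * x) - 1 / (1 +
      real (Suc k) * x)))"
    by (rule sum_mono)
  also have "\<dots> = 4 / x * (1 / (1 + real 0 * x) - 1 / (1 + real K * x))"
    unfolding sum_distrib_left[symmetric]
    using sum_lessThan_telescope'[of "\<lambda>k. 1 / (1 + real k * x)" K] by simp
  also have "\<dots> \<le> 4 / x * 1"
    using assms by (intro mult_left_mono) auto
  finally show ?thesis by simp
qed

text \<open>Passing from \<open>lexpq\<close> to ln(1 - exp(- s)) at the multiples of t brings in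
  the logarithms of 1, ..., K; with the boundary terms they form this sequence, which does not
  involve t.\<close>

definition stirling_seq :: "nat \<Rightarrow> real" where
  "stirling_seq K = ln (fact K) + real K - real K * ln (real K) - ln (real K) / 2"

text \<open>The Euler-Maclaurin remainder of \<open>lexpq\<close> on the segment from \<open>k t\<close> to \<open>(k + 1) t\<close>, and the boundary
  terms at \<open>K t\<close>, which vanish in the limit.\<close>

definition em_rem :: "complex \<Rightarrow> nat \<Rightarrow> complex" where
  "em_rem t k = lexpq_prim (of_nat (Suc k) * t) - lexpq_prim (of_nat k * t)
      - t / 2 * (lexpq (of_nat k * t) + lexpq (of_nat (Suc k) * t))
      + t\<^sup>2 / 12 * (deriv lexpq (of_nat (Suc k) * t) - deriv lexpq (of_nat k * t))"

lemma sector_mult: "s \<in> sector \<Longrightarrow> x \<ge> 0 \<Longrightarrow> of_real x * s \<in> sector"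
  by (auto simp: sector_def abs_mult intro: mult_left_mono)

lemma sector_of_nat_mult: "s \<in> sector \<Longrightarrow> of_nat n * s \<in> sector"
  using sector_mult[of s "real n"] by simp

lemma closed_segment_multiples:
  assumes "s \<in> closed_segment (of_nat k * t) (of_nat (Suc k) * t)" "t \<in> sector"
  shows "s \<in> sector" "norm s \<ge> real k * norm t"
proof -
  from assms obtain u where u: "0 \<le> u" "s = (1 - u) *\<^sub>R (of_nat k * t) + u *\<^sub>R (of_nat (Suc k) * t)"
    unfolding closed_segment_def by auto
  hence s: "s = of_real (real k + u) * t" by (simp add: scaleR_conv_of_real algebra_simps)
  show "s \<in> sector" unfolding s by (rule sector_mult) (use assms u in auto)
  have "norm s = (real k + u) * norm t" unfolding s norm_mult norm_of_real using u by simp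
  thus "norm s \<ge> real k * norm t" using u by (simp add: algebra_simps)
qed

lemma em_rem_bound: "\<exists>C>0. \<forall>t\<in>sector. \<forall>k. norm (em_rem t k) \<le> C * norm t ^ 4 / (1 + (real k * norm t)\<^sup>2)"
proof -
  obtain C where C: "C > 0" "\<And>s. s \<in> sector \<Longrightarrow> norm ((deriv ^^ 3) lexpq s) \<le> C / (1 + (norm s)\<^sup>2)"
    using lexpq_deriv_bound[of 3] by auto
  \<comment> \<open>With the primitive as \<open>F 0\<close>, the fourth derivative in the remainder
    is the third of \<open>lexpq\<close>.\<close>
  define F where "F = (\<lambda>i. if i = 0 then lexpq_prim else (deriv ^^ (i - 1)) lexpq)"
  have "norm (em_rem t k) \<le> C * norm t ^ 4 / (1 + (real k * norm t)\<^sup>2)" if t: "t \<in> sector" for t k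
  proof -
    let ?a = "of_nat k * t" and ?b = "of_nat (Suc k) * t"
    have h: "?b - ?a = t" by (simp add: algebra_simps)
    have "norm (F 0 ?b - F 0 ?a - (?b - ?a) / 2 * (F 1 ?a + F 1 ?b) + (?b - ?a)\<^sup>2 / 12 * (F 2 ?b -
        F 2 ?a))
       \<le> C / (1 + (real k * norm t)\<^sup>2) * norm (?b - ?a) ^ 4"
    proof (rule euler_maclaurin_remainder)
      fix i x assume x: "x \<in> closed_segment ?a ?b" and "i \<le> (3 :: nat)"
      hence "x \<in> wedge" using closed_segment_multiples[OF x t] by (auto intro: Re_pos_in_wedge)
      thus "(F i has_field_derivative F (Suc i) x) (at x)"
        using lexpq_prim_deriv lexpq_higher_deriv[of x "i - 1"] by (cases i) (auto simp: F_def)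
    next
      fix x assume x: "x \<in> closed_segment ?a ?b"
      note s = closed_segment_multiples[OF x t]
      have "norm (F 4 x) \<le> C / (1 + (norm x)\<^sup>2)" using C(2)[OF s(1)] by (simp add: F_def)
      also have "\<dots> \<le> C / (1 + (real k * norm t)\<^sup>2)"
        using C(1) s(2) by (intro divide_left_mono add_left_mono power_mono mult_pos_pos add_pos_nonneg)
            auto
      finally show "norm (F 4 x) \<le> C / (1 + (real k * norm t)\<^sup>2)" .
    qed
    thus ?thesis unfolding h by (simp add: em_rem_def F_def numeral_eq_Suc)
  qed
  thus ?thesis using C(1) by blast
qed

text \<open>All terms telescope except the trapezoidal sum. At the lower end
  \<open>lexpq_prim\<close> and \<open>lexpq\<close> vanish, and the derivative - 1/2 of
  \<open>lexpq\<close> at 0 enters as + 1/2.\<close>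

lemma sum_em_rem:
  "(\<Sum>k<K. em_rem t k) = lexpq_prim (of_nat K * t) - t * (\<Sum>k<K. lexpq (of_nat (Suc k) * t))
      + t / 2 * lexpq (of_nat K * t) + t\<^sup>2 / 12 * (deriv lexpq (of_nat K * t) + 1 / 2)"
  by (induction K) (simp_all add: lexpq_prim_0 lexpq_0 lexpq_deriv_0 em_rem_def algebra_simps del:
      of_nat_Suc)

definition em_err :: "complex \<Rightarrow> nat \<Rightarrow> complex" where
  "em_err t K = - LI (-2) (of_nat K * t) / t + LI (-1) (of_nat K * t) / 2
     - t / 12 * (LI 0 (of_nat K * t) - 1 / (of_nat K * t))"

text \<open>By \<open>lexpq_eq\<close>, \<open>lexpq\<close> at k t is - \<open>LI (-1)\<close>
  minus the logarithm of k t. This converts the formula for sums of \<open>lexpq\<close> into one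
  for the partial sums of ln P.\<close>

lemma sum_LI_minus_1:
  assumes t: "t \<in> sector" "t \<noteq> 0" and K: "K > 0"
  shows "(\<Sum>k<K. LI (-1) (of_nat (Suc k) * t)) = (\<Sum>k<K. em_rem t k) / t + of_real (pi\<^sup>2 / 6) / t +
      Ln t / 2 - t / 24
     - of_real (stirling_seq K) + em_err t K"
proof -
  have wp: "of_nat k * t \<in> wedge_pos" if "k > 0" for k
    using that t by (intro sector_wedge_pos sector_of_nat_mult) auto
  have Lnk: "Ln (of_nat k * t) = of_real (ln (real k)) + Ln t" if "k > 0" for k
    using Ln_times_of_real[of "real k" t] that t by simp
  have lex: "lexpq (of_nat k * t) = - LI (-1) (of_nat k * t) - of_real (ln (real k)) - Ln t" if "k > 0"
      for k
    using lexpq_eq[OF wp[OF that]] LI_minus_1[of "of_nat k * t"] wedge_posD(2)[OF wp[OF that]]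
        by (simp add: Lnk[OF that])
  have "(\<Sum>k<K. lexpq (of_nat (Suc k) * t)) = - (\<Sum>k<K. LI (-1) (of_nat (Suc k) * t)) -
      of_real (\<Sum>k<K. ln (real (Suc k))) - of_nat K * Ln t"
    by (simp add: lex sum_subtractf sum_negf del: of_nat_Suc)
  also have "(\<Sum>k<K. ln (real (Suc k))) = ln (fact K)"
    by (induction K) (simp_all add: ln_mult del: of_nat_Suc)
  finally have 1: "(\<Sum>k<K. LI (-1) (of_nat (Suc k) * t)) = - (\<Sum>k<K. lexpq (of_nat (Suc k) * t)) -
      of_real (ln (fact K)) - of_nat K * Ln t"
    by simp
  have 2: "(\<Sum>k<K. lexpq (of_nat (Suc k) * t)) = (lexpq_prim (of_nat K * t) +
      t / 2 * lexpq (of_nat K * t) + t\<^sup>2 / 12 * (deriv lexpq (of_nat K * t) + 1 / 2) - (\<Sum>k<K. em_rem t k))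
      / t"
    using t by (simp add: sum_em_rem field_simps)
  have 3: "lexpq_prim (of_nat K * t) = LI (-2) (of_nat K * t) - of_real (pi\<^sup>2 / 6) -
      of_nat K * t * (of_real (ln (real K)) + Ln t) + of_nat K * t"
    using lexpq_prim_eq[OF wp[OF K]] by (simp add: Lnk[OF K])
  have 4: "deriv lexpq (of_nat K * t) = LI 0 (of_nat K * t) - 1 / (of_nat K * t)"
    using lexpq_deriv_1[of "of_nat K * t"] LI_0[of "of_nat K * t"] wedge_posD[OF wp[OF K]] by simp
  \<comment> \<open>The terms n T cancel, and the half weight of the endpoint in the trapezoidal sum
    leaves T / 2: this is the origin of the factor t^(1/2) in P.\<close>
  have alg: "- ((A - c - n * t * (l + T) + n * t + t / 2 * (- B - l - T) + t\<^sup>2 / 12 * (D + 1 / 2) -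
      R) / t) - f - n * T =
     R / t + c / t + T / 2 - t / 24 - (f + n - n * l - l / 2) + (- A / t + B / 2 - t / 12 * D)" if "t \<noteq>
         0"
    for A B D l T R f n c t :: complex
    using that by (simp add: divide_simps) (simp add: algebra_simps power2_eq_square)
  show ?thesis
    unfolding 1 2 3 4 lex[OF K] stirling_seq_def em_err_def using alg[OF t(2)] by simp
qed

lemma em_err_tendsto_0:
  assumes "t \<in> sector" "t \<noteq> 0"
  shows "em_err t \<longlonglongrightarrow> 0"
proof -
  have Re: "Re t > 0" using wedge_posD[OF sector_wedge_pos[OF assms]] by simp
  have "(\<lambda>K. 1 / (of_nat K * t)) \<longlonglongrightarrow> 0"
  proof -
    have "(\<lambda>K. inverse (of_nat K) * (1 / t)) \<longlonglongrightarrow> 0 * (1 / t)"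
      by (intro tendsto_mult tendsto_const) (rule lim_inverse_n)
    thus ?thesis by (simp add: field_simps)
  qed
  hence "em_err t \<longlonglongrightarrow> - 0 / t + 0 / 2 - t / 12 * (0 - 0)"
    unfolding em_err_def[abs_def] by (intro tendsto_intros LI_neg_tendsto_0[OF Re] assms) auto
  thus ?thesis by simp
qed

text \<open>Terms of size |t|^4, effectively about 1 / |t| of them, add up to O(|t|^3).\<close>

lemma summable_em_rem:
  shows "\<exists>C>0. \<forall>t\<in>sector. t \<noteq> 0 \<longrightarrow> norm t \<le> 1 \<longrightarrow> summable (em_rem t) \<and> norm (\<Sum>k. em_rem t k) \<le>
      C * norm t ^ 3"
proof -
  obtain C where C: "C > 0" "\<And>t k. t \<in> sector \<Longrightarrow> norm (em_rem t k) \<le> C * norm t ^ 4 / (1 +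
      (real k * norm t)\<^sup>2)"
    using em_rem_bound by blast
  have "summable (em_rem t) \<and> norm (\<Sum>k. em_rem t k) \<le> 4 * C * norm t ^ 3" if t: "t \<in> sector" "t \<noteq> 0"
      "norm t \<le> 1" for t
  proof -
    have "(\<Sum>k<K. norm (em_rem t k)) \<le> 4 * C * norm t ^ 3" for K
    proof -
      have "(\<Sum>k<K. norm (em_rem t k)) \<le> (\<Sum>k<K. C * norm t ^ 4 * (1 / (1 + (real k * norm t)\<^sup>2)))"
        using C(2)[OF t(1)] by (intro sum_mono) simp
      also have "\<dots> = C * norm t ^ 4 * (\<Sum>k<K. 1 / (1 + (real k * norm t)\<^sup>2))"
          by (simp add: sum_distrib_left)
      also have "\<dots> \<le> C * norm t ^ 4 * (4 / norm t)"
        using C(1) t by (intro mult_left_mono sum_inverse_quadratic) auto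
      also have "\<dots> = 4 * C * norm t ^ 3" using t by (simp add: power_numeral_reduce)
      finally show ?thesis .
    qed
    note bd = this
    have s: "summable (\<lambda>k. norm (em_rem t k))"
    proof (rule bounded_imp_summable)
      fix n show "(\<Sum>k\<le>n. norm (em_rem t k)) \<le> 4 * C * norm t ^ 3"
        using bd[of "Suc n"] by (simp only: lessThan_Suc_atMost)
    qed simp
    have "(\<Sum>k. norm (em_rem t k)) \<le> 4 * C * norm t ^ 3"
      by (rule suminf_le_const[OF s bd])
    thus ?thesis using summable_norm[OF s] summable_norm_cancel[OF s] by linarith
  qed
  thus ?thesis using C(1) by (intro exI[of _ "4 * C"]) auto
qed

section \<open>Stirling's constant\<close>

text \<open>In 2 S(n) - S(2 n) the factorials combine to Wallis's product, whose limit pi / 2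
  determines c, because this combination also tends to 2 c - c.\<close>

lemma stirling_constant:
  assumes "stirling_seq \<longlonglongrightarrow> c"
  shows "c = ln (2 * pi) / 2"
proof -
  define W where "W = (\<lambda>n. \<Prod>k=1..n. (4 * real k ^ 2) / (4 * real k ^ 2 - 1))"
  have alg: "(p * f\<^sup>2 / (F / (2 * c * a)))\<^sup>2 / a * (4 * c\<^sup>2 / (a * b)) = (4 * p * (c * f)\<^sup>2 / F)\<^sup>2 / b"
    if "a \<noteq> 0" "b \<noteq> 0" "F \<noteq> 0" for p f F a b c :: real
    using that by (simp add: field_simps power2_eq_square)
  have W: "W n = (4 ^ n * fact n ^ 2 / fact (2 * n)) ^ 2 / (2 * real n + 1)" for n
  proof (induction n)
    case (Suc n)
    have "W (Suc n) = W n * ((4 * real (Suc n) ^ 2) / (4 * real (Suc n) ^ 2 - 1))" by (simp add: W_def)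
    also have "4 * real (Suc n) ^ 2 - 1 = (2 * real n + 1) * (2 * real n + 3)"
        by (simp add: algebra_simps power2_eq_square)
    also have "W n = (4 ^ n * fact n ^ 2 / fact (2 * n)) ^ 2 / (2 * real n + 1)" by (rule Suc)
    also have "fact (2 * n) = (fact (2 * Suc n) / ((2 * real n + 2) * (2 * real n + 1)) :: real)"
    proof -
      have "fact (2 * Suc n) = (2 * real n + 2) * (2 * real n + 1) * fact (2 * n)"
          by (simp add: algebra_simps)
      moreover have "(2 * real n + 2) * (2 * real n + 1) \<noteq> 0" by (simp add: add_nonneg_eq_0_iff)
      ultimately show ?thesis by (metis nonzero_mult_div_cancel_left)
    qed
    also have "2 * real n + 2 = 2 * real (Suc n)" by simp
    finally have "W (Suc n) = (4 ^ n * (fact n)\<^sup>2 / (fact (2 * Suc n) / (2 * real (Suc n) * (2 * real n +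
        1))))\<^sup>2 / (2 * real n + 1) *
       (4 * (real (Suc n))\<^sup>2 / ((2 * real n + 1) * (2 * real n + 3)))" .
    also have "\<dots> = (4 * 4 ^ n * (real (Suc n) * fact n)\<^sup>2 / fact (2 * Suc n))\<^sup>2 / (2 * real n + 3)"
    proof (rule alg)
      show "2 * real n + 1 \<noteq> 0" "2 * real n + 3 \<noteq> 0" by linarith+
    qed simp
    finally show ?case by (simp only: fact_Suc power_Suc) (simp add: algebra_simps)
  qed (simp add: W_def)
  have eq: "2 * stirling_seq n - stirling_seq (2 * n) = ln (W n) / 2 + ln (2 * real n + 1) / 2 +
      ln 2 / 2 - ln (real n) / 2" if "n > 0" for n
  proof -
    have "ln (W n) = 2 * (real n * ln 4 + 2 * ln (fact n) - ln (fact (2 * n))) - ln (2 * real n + 1)"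
      unfolding W by (simp add: ln_div ln_mult ln_realpow)
    moreover have "ln 4 = 2 * ln (2 :: real)" using ln_realpow[of 2 2] by simp
    ultimately show ?thesis using that by (simp add: stirling_seq_def ln_mult field_simps)
  qed
  have "(\<lambda>n. 2 * stirling_seq n - stirling_seq (2 * n)) \<longlonglongrightarrow> 2 * c - c"
    by (intro tendsto_intros assms filterlim_compose[OF assms]) (rule filterlim_subseq, auto simp:
        strict_mono_def)
  moreover have "(\<lambda>n. 2 * stirling_seq n - stirling_seq (2 * n)) \<longlonglongrightarrow> ln (pi / 2) / 2 + ln 2"
  proof (rule Lim_transform_eventually)
    have "(\<lambda>n. ln (2 * real n + 1) / 2 + ln 2 / 2 - ln (real n) / 2) \<longlonglongrightarrow> ln 2" by real_asymp
    moreover have "(\<lambda>n. ln (W n) / 2) \<longlonglongrightarrow> ln (pi / 2) / 2"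
      by (intro tendsto_intros wallis[folded W_def]) auto
    ultimately have "(\<lambda>n. ln (W n) / 2 + (ln (2 * real n + 1) / 2 + ln 2 / 2 -
        ln (real n) / 2)) \<longlonglongrightarrow> ln (pi / 2) / 2 + ln 2"
      by (intro tendsto_add)
    thus "(\<lambda>n. ln (W n) / 2 + ln (2 * real n + 1) / 2 + ln 2 / 2 - ln (real n) / 2) \<longlonglongrightarrow> ln (pi / 2) / 2 +
        ln 2"
      by (simp add: algebra_simps)
    show "\<forall>\<^sub>F n in sequentially. ln (W n) / 2 + ln (2 * real n + 1) / 2 + ln 2 / 2 - ln (real n) / 2 =
        2 * stirling_seq n - stirling_seq (2 * n)"
      using eventually_gt_at_top[of 0] by eventually_elim (simp only: eq)
  qed
  ultimately have "2 * c - c = ln (pi / 2) / 2 + ln 2" by (rule LIMSEQ_unique)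
  thus ?thesis by (simp add: ln_div ln_mult field_simps)
qed

section \<open>First-order expansions at the dominant singularity\<close>

lemma row_eq_LI:
  assumes "Re t > 0" "\<And>d. d > 0 \<Longrightarrow> complex_of_real (w d) = of_nat d powi r"
  shows "(\<Sum>m. of_real (w (Suc m)) * exp (- t) ^ (Suc k * Suc m)) = LI r (of_nat (Suc k) * t)"
proof -
  have "Re (of_nat (Suc k) * t) > 0" using assms(1) by (simp del: of_nat_Suc)
  from LI_sums[OF this, of r] have "(\<lambda>m. of_nat (Suc m) powi r * exp (- (of_nat (Suc m) *
      (of_nat (Suc k) * t)))) sums LI r (of_nat (Suc k) * t)" .
  also have "(\<lambda>m. of_nat (Suc m) powi r * exp (- (of_nat (Suc m) * (of_nat (Suc k) * t)))) =
      (\<lambda>m. of_real (w (Suc m)) * exp (- t) ^ (Suc k * Suc m))"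
  proof
    fix m
    have "exp (- t) ^ (Suc k * Suc m) = exp (of_nat (Suc k * Suc m) * (- t))"
        by (simp only: exp_of_nat_mult)
    also have "of_nat (Suc k * Suc m) * (- t) = - (of_nat (Suc m) * (of_nat (Suc k) * t))"
      by (simp only: of_nat_mult mult_minus_right mult_minus_left mult_ac)
    finally show "of_nat (Suc m) powi r * exp (- (of_nat (Suc m) * (of_nat (Suc k) * t))) =
        of_real (w (Suc m)) * exp (- t) ^ (Suc k * Suc m)"
      by (simp only: assms(2) zero_less_Suc)
  qed
  finally show ?thesis by (rule sums_unique[symmetric])
qed

text \<open>The logarithm of \<open>P(exp (- t))\<close>.\<close>

definition log_part :: "complex \<Rightarrow> complex" where
  "log_part t = eval_fps (cfps log_gf) (exp (- t))"

definition sigma_part :: "nat \<Rightarrow> complex \<Rightarrow> complex" where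
  "sigma_part r t = eval_fps (cfps (sigma_gf r)) (exp (- t))"

lemma log_part_sums: "Re t > 0 \<Longrightarrow> (\<lambda>k. LI (-1) (of_nat (Suc k) * t)) sums log_part t"
  using divsum_rows_sums[of "\<lambda>d. 1 / of_nat d" 0 "exp (- t)", OF weight_bounds(2)]
        row_eq_LI[of t "\<lambda>d. 1 / of_nat d" "-1"]
  by (simp add: log_part_def power_int_minus divide_inverse del: of_nat_Suc)

lemma sigma_part_sums: "Re t > 0 \<Longrightarrow> (\<lambda>k. LI (int r) (of_nat (Suc k) * t)) sums sigma_part r t"
  using divsum_rows_sums[of "\<lambda>d. of_nat d ^ r" r "exp (- t)", OF weight_bounds(1)]
        row_eq_LI[of t "\<lambda>d. of_nat d ^ r" "int r"]
  by (simp add: sigma_part_def del: of_nat_Suc)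

text \<open>At t = 1 every other term of \<open>sum_LI_minus_1\<close> converges, which forces
  \<open>stirling_seq\<close> to converge; the value of the limit then comes from
  \<open>stirling_constant\<close>.\<close>

lemma stirling_limit: "stirling_seq \<longlonglongrightarrow> ln (2 * pi) / 2"
proof -
  obtain C where C: "\<And>t. t \<in> sector \<Longrightarrow> t \<noteq> 0 \<Longrightarrow> norm t \<le> 1 \<Longrightarrow> summable (em_rem t)"
    using summable_em_rem by blast
  have 1: "1 \<in> sector" by (simp add: sector_def)
  have "(\<lambda>K. (\<Sum>k<K. em_rem 1 k) / 1 + of_real (pi\<^sup>2 / 6) / 1 + Ln 1 / 2 - 1 / 24 + em_err 1 K -
      (\<Sum>k<K. LI (-1) (of_nat (Suc k) * 1)))
     \<longlonglongrightarrow> (\<Sum>k. em_rem 1 k) / 1 + of_real (pi\<^sup>2 / 6) / 1 + Ln 1 / 2 - 1 / 24 + 0 - log_part 1"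
    using log_part_sums[of 1] summable_LIMSEQ[OF C[of 1]] 1
    by (intro tendsto_intros em_err_tendsto_0) (auto simp: sums_def simp del: of_nat_Suc)
  hence "(\<lambda>K. complex_of_real (stirling_seq K)) \<longlonglongrightarrow> (\<Sum>k. em_rem 1 k) / 1 + of_real (pi\<^sup>2 / 6) / 1 +
      Ln 1 / 2 - 1 / 24 + 0 - log_part 1"
    by (rule Lim_transform_eventually)
       (use eventually_gt_at_top[of 0] in \<open>eventually_elim, subst sum_LI_minus_1[OF 1], auto\<close>)
  from tendsto_Re[OF this] have L: "stirling_seq \<longlonglongrightarrow> Re ((\<Sum>k. em_rem 1 k) / 1 + of_real (pi\<^sup>2 / 6) / 1 +
      Ln 1 / 2 - 1 / 24 + 0 - log_part 1)"
    by simp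
  show ?thesis unfolding stirling_constant[OF L, symmetric] by (rule L)
qed

text \<open>The limit of \<open>sum_LI_minus_1\<close> as K grows. The remainder series enters
  divided by t, which lowers its bound from |t|^3 to |t|^2.\<close>

lemma log_part_asymp:
  "\<exists>C>0. \<forall>t\<in>sector. t \<noteq> 0 \<longrightarrow> norm t \<le> 1 \<longrightarrow>
     norm (log_part t - (of_real (pi\<^sup>2 / 6) / t + Ln t / 2 - of_real (ln (2 * pi) / 2) - t / 24)) \<le> C *
         norm t ^ 2"
proof -
  from summable_em_rem obtain C where C0: "C > 0" "\<forall>t\<in>sector. t \<noteq> 0 \<longrightarrow> norm t \<le> 1 \<longrightarrow> summable (em_rem t) \<and>
      norm (\<Sum>k. em_rem t k) \<le> C * norm t ^ 3"
    by (elim exE conjE)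
  hence C: "summable (em_rem t) \<and> norm (\<Sum>k. em_rem t k) \<le> C * norm t ^ 3" if "t \<in> sector" "t \<noteq> 0"
      "norm t \<le> 1" for t
    using that by simp
  show ?thesis
  proof (intro exI[of _ C] conjI ballI impI C0(1))
    fix t assume t: "t \<in> sector" "t \<noteq> 0" "norm t \<le> 1"
    have Re: "Re t > 0" using wedge_posD[OF sector_wedge_pos[OF t(1,2)]] by simp
    let ?m = "of_real (pi\<^sup>2 / 6) / t + Ln t / 2 - of_real (ln (2 * pi) / 2) - t / 24"
    have "(\<lambda>K. (\<Sum>k<K. em_rem t k) / t + of_real (pi\<^sup>2 / 6) / t + Ln t / 2 - t / 24 -
        of_real (stirling_seq K) + em_err t K)
     \<longlonglongrightarrow> (\<Sum>k. em_rem t k) / t + of_real (pi\<^sup>2 / 6) / t + Ln t / 2 - t / 24 - of_real (ln (2 * pi) / 2) + 0"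
      using summable_LIMSEQ[of "em_rem t"] C[OF t] t
      by (intro tendsto_intros em_err_tendsto_0 stirling_limit) auto
    hence "(\<lambda>K. \<Sum>k<K. LI (-1) (of_nat (Suc k) * t)) \<longlonglongrightarrow> (\<Sum>k. em_rem t k) / t + of_real (pi\<^sup>2 / 6) / t +
        Ln t / 2 - t / 24 - of_real (ln (2 * pi) / 2) + 0"
      by (rule Lim_transform_eventually)
         (use eventually_gt_at_top[of 0] in \<open>eventually_elim, subst sum_LI_minus_1[OF t(1,2)], auto\<close>)
    with log_part_sums[OF Re] have "log_part t = (\<Sum>k. em_rem t k) / t + of_real (pi\<^sup>2 / 6) / t +
        Ln t / 2 - t / 24 - of_real (ln (2 * pi) / 2) + 0"
      unfolding sums_def by (rule LIMSEQ_unique)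
    hence "norm (log_part t - ?m) = norm (\<Sum>k. em_rem t k) / norm t" by (simp add: norm_divide)
    also have "\<dots> \<le> C * norm t ^ 3 / norm t" using C[OF t] by (intro divide_right_mono) auto
    also have "\<dots> = C * norm t ^ 2" using t by (simp add: power_numeral_reduce)
    finally show "norm (log_part t - ?m) \<le> C * norm t ^ 2" .
  qed
qed

section \<open>Calculus of first-order expansions\<close>

definition zeta_nat :: "nat \<Rightarrow> real" where "zeta_nat n = (\<Sum>k. 1 / real (Suc k) ^ n)"

lemma zeta_nat_sums: "n \<ge> 2 \<Longrightarrow> (\<lambda>k. 1 / real (Suc k) ^ n) sums zeta_nat n"
proof -
  assume "n \<ge> 2"
  hence "summable (\<lambda>k. inverse (real k ^ n))" by (rule inverse_power_summable)
  hence "summable (\<lambda>k. inverse (real (Suc k) ^ n))" by (subst summable_Suc_iff)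
  thus ?thesis unfolding zeta_nat_def by (intro summable_sums) (simp add: divide_inverse)
qed

text \<open>The radius is fixed at 1 instead of being part of a limit, so all expansions share one
  domain and can be multiplied. The point t = 0 is left out because \<open>exp (- t)\<close> leaves
  the open disc there.\<close>

definition expands :: "(complex \<Rightarrow> complex) \<Rightarrow> complex \<Rightarrow> complex \<Rightarrow> bool" where
  "expands f a b \<longleftrightarrow> (\<exists>C\<ge>0. \<forall>t\<in>sector. t \<noteq> 0 \<longrightarrow> norm t \<le> 1 \<longrightarrow> norm (f t - (a + b * t)) \<le> C * norm t ^ 2)"

lemma expandsI:
  assumes "\<And>t. t \<in> sector \<Longrightarrow> t \<noteq> 0 \<Longrightarrow> norm t \<le> 1 \<Longrightarrow> norm (f t - (a + b * t)) \<le> C * norm t ^ 2"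
  shows "expands f a b"
  unfolding expands_def
proof (intro exI[of _ "\<bar>C\<bar>"] conjI ballI impI)
  fix t assume "t \<in> sector" "t \<noteq> 0" "norm t \<le> 1"
  from assms[OF this] show "norm (f t - (a + b * t)) \<le> \<bar>C\<bar> * norm t ^ 2"
    by (rule order_trans) (intro mult_right_mono, auto)
qed simp

lemma expandsE:
  assumes "expands f a b"
  obtains C where "C \<ge> 0" "\<And>t. t \<in> sector \<Longrightarrow> t \<noteq> 0 \<Longrightarrow> norm t \<le> 1 \<Longrightarrow> norm (f t - (a + b * t)) \<le>
      C * norm t ^ 2"
  using assms unfolding expands_def by blast

lemma expands_const: "expands (\<lambda>_. c) c 0"
  by (rule expandsI[of _ _ _ 0]) auto

lemma expands_add:
  assumes "expands f a b" "expands g c d"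
  shows "expands (\<lambda>t. f t + g t) (a + c) (b + d)"
proof -
  obtain C D where C: "\<And>t. t \<in> sector \<Longrightarrow> t \<noteq> 0 \<Longrightarrow> norm t \<le> 1 \<Longrightarrow> norm (f t - (a + b * t)) \<le> C * norm t ^ 2"
    and D: "\<And>t. t \<in> sector \<Longrightarrow> t \<noteq> 0 \<Longrightarrow> norm t \<le> 1 \<Longrightarrow> norm (g t - (c + d * t)) \<le> D * norm t ^ 2"
    using assms by (elim expandsE) blast
  show ?thesis
  proof (rule expandsI)
    fix t assume t: "t \<in> sector" "t \<noteq> 0" "norm t \<le> 1"
    have "f t + g t - (a + c + (b + d) * t) = (f t - (a + b * t)) + (g t - (c + d * t))"
        by (simp add: algebra_simps)
    also have "norm \<dots> \<le> C * norm t ^ 2 + D * norm t ^ 2" by (intro norm_triangle_mono C D t)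
    finally show "norm (f t + g t - (a + c + (b + d) * t)) \<le> (C + D) * norm t ^ 2"
        by (simp add: algebra_simps)
  qed
qed

lemma expands_mult:
  assumes "expands f a b" "expands g c d"
  shows "expands (\<lambda>t. f t * g t) (a * c) (a * d + b * c)"
proof -
  obtain C D where C0: "C \<ge> 0" and C: "\<And>t. t \<in> sector \<Longrightarrow> t \<noteq> 0 \<Longrightarrow> norm t \<le> 1 \<Longrightarrow> norm (f t - (a + b * t)) \<le>
      C * norm t ^ 2"
    and D0: "D \<ge> 0" and D: "\<And>t. t \<in> sector \<Longrightarrow> t \<noteq> 0 \<Longrightarrow> norm t \<le> 1 \<Longrightarrow> norm (g t - (c + d * t)) \<le>
        D * norm t ^ 2"
    using assms by (elim expandsE) blast
  show ?thesis
  proof (rule expandsI)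
    fix t assume t: "t \<in> sector" "t \<noteq> 0" "norm t \<le> 1"
    let ?x = "f t - (a + b * t)" and ?y = "g t - (c + d * t)"
    have t2: "norm t ^ 2 \<le> 1" using t by (simp add: power_le_one)
    have lin: "norm (u + v * t) \<le> norm u + norm v" for u v
    proof -
      have "norm (u + v * t) \<le> norm u + norm v * norm t" by (metis norm_mult norm_triangle_ineq)
      also have "norm v * norm t \<le> norm v * 1" using t by (intro mult_left_mono) auto
      finally show ?thesis by simp
    qed
    have y1: "norm ?y \<le> D" using D[OF t] mult_left_mono[OF t2 D0] by simp
    have "f t * g t - (a * c + (a * d + b * c) * t) = (a + b * t) * ?y + ?x * (c + d * t) + ?x * ?y +
        b * d * t ^ 2"
      by (simp add: algebra_simps power2_eq_square)
    also have "norm \<dots> \<le> (norm a + norm b) * (D * norm t ^ 2) + (C * norm t ^ 2) * (norm c + norm d) +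
        (C * norm t ^ 2) * D + norm b * norm d * norm t ^ 2"
      by (intro norm_triangle_mono) (auto simp: norm_mult norm_power intro!: mult_mono lin C D t y1 C0 D0
          mult_nonneg_nonneg)
    finally show "norm (f t * g t - (a * c + (a * d + b * c) * t)) \<le>
       ((norm a + norm b) * D + C * (norm c + norm d) + C * D + norm b * norm d) * norm t ^ 2"
      by (simp add: algebra_simps)
  qed
qed

lemma expands_cmult: "expands f a b \<Longrightarrow> expands (\<lambda>t. c * f t) (c * a) (c * b)"
  using expands_mult[OF expands_const[of c], of f a b] by simp

lemma expands_sum:
  "(\<And>i. i \<in> A \<Longrightarrow> expands (f i) (a i) (b i)) \<Longrightarrow> expands (\<lambda>t. \<Sum>i\<in>A. f i t) (\<Sum>i\<in>A. a i) (\<Sum>i\<in>A. b i)"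
proof (induction A rule: infinite_finite_induct)
  case (insert x A)
  thus ?case using expands_add[of "f x" "a x" "b x"] by simp
qed (use expands_const[of 0] in auto)

lemma expands_cong:
  "expands f a b \<Longrightarrow> (\<And>t. t \<in> sector \<Longrightarrow> t \<noteq> 0 \<Longrightarrow> norm t \<le> 1 \<Longrightarrow> f t = g t) \<Longrightarrow> a = a' \<Longrightarrow> b = b' \<Longrightarrow> expands g a' b'"
  unfolding expands_def by auto

section \<open>Sums of derivatives over the multiples of t\<close>

text \<open>A Riemann sum of a function with quadratic decay, lacking the step size, is of order 1 /
  |t|.\<close>

lemma sum_lexpq_deriv:
  assumes "n \<ge> 2"
  shows "\<exists>C\<ge>0. \<forall>t\<in>sector. t \<noteq> 0 \<longrightarrow> norm t \<le> 1 \<longrightarrow> summable (\<lambda>k. (deriv ^^ n) lexpq (of_nat (Suc k) * t)) \<and>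
     norm (\<Sum>k. (deriv ^^ n) lexpq (of_nat (Suc k) * t)) \<le> C / norm t"
proof -
  obtain C where C: "C > 0" "\<And>s. s \<in> sector \<Longrightarrow> norm ((deriv ^^ n) lexpq s) \<le> C / (1 + (norm s)\<^sup>2)"
    using lexpq_deriv_bound[OF assms] by auto
  have "summable (\<lambda>k. (deriv ^^ n) lexpq (of_nat (Suc k) * t)) \<and>
     norm (\<Sum>k. (deriv ^^ n) lexpq (of_nat (Suc k) * t)) \<le> (4 * C) / norm t" if t: "t \<in> sector" "t \<noteq>
         0" "norm t \<le> 1" for t
  proof -
    let ?f = "\<lambda>k. (deriv ^^ n) lexpq (of_nat (Suc k) * t)"
    have bd: "(\<Sum>k<K. norm (?f k)) \<le> 4 * C / norm t" for K
    proof -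
      have "(\<Sum>k<K. norm (?f k)) \<le> (\<Sum>k<K. C * (1 / (1 + (real k * norm t)\<^sup>2)))"
      proof (intro sum_mono)
        fix k
        have "norm (?f k) \<le> C / (1 + (norm (of_nat (Suc k) * t))\<^sup>2)" by (intro C sector_of_nat_mult t)
        also have "\<dots> \<le> C / (1 + (real k * norm t)\<^sup>2)"
          using C(1) by (intro divide_left_mono add_left_mono power_mono mult_pos_pos add_pos_nonneg)
             (auto simp: norm_mult simp del: of_nat_Suc intro!: mult_right_mono)
        finally show "norm (?f k) \<le> C * (1 / (1 + (real k * norm t)\<^sup>2))" by simp
      qed
      also have "\<dots> = C * (\<Sum>k<K. 1 / (1 + (real k * norm t)\<^sup>2))" by (simp add: sum_distrib_left)
      also have "\<dots> \<le> C * (4 / norm t)" using C(1) t by (intro mult_left_mono sum_inverse_quadratic) auto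
      finally show ?thesis by (simp add: mult_ac del: of_nat_Suc)
    qed
    have s: "summable (\<lambda>k. norm (?f k))"
    proof (rule bounded_imp_summable)
      fix m show "(\<Sum>k\<le>m. norm (?f k)) \<le> 4 * C / norm t"
        using bd[of "Suc m"] by (simp only: lessThan_Suc_atMost)
    qed simp
    have "(\<Sum>k. norm (?f k)) \<le> 4 * C / norm t" by (rule suminf_le_const[OF s bd])
    thus ?thesis using summable_norm[OF s] summable_norm_cancel[OF s] by linarith
  qed
  thus ?thesis using C(1) by (intro exI[of _ "4 * C"]) auto
qed

text \<open>A Riemann sum at right endpoints for the integral of the second derivative along the
  ray, which is - \<open>deriv lexpq 0\<close> = 1/2. The Taylor remainders, taken at the right
  endpoints, total O(|t|).\<close>

lemma sum_lexpq_deriv2: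
  "\<exists>C. \<forall>t\<in>sector. t \<noteq> 0 \<longrightarrow> norm t \<le> 1 \<longrightarrow> norm (t * (\<Sum>k. (deriv ^^ 2) lexpq (of_nat (Suc k) * t)) - 1 / 2) \<le>
      C * norm t"
proof -
  obtain C where C: "C > 0" "\<And>s. s \<in> sector \<Longrightarrow> norm ((deriv ^^ 3) lexpq s) \<le> C / (1 + (norm s)\<^sup>2)"
    using lexpq_deriv_bound[of 3] by auto
  let ?u1 = "deriv lexpq" and ?u2 = "(deriv ^^ 2) lexpq"
  have "norm (t * (\<Sum>k. ?u2 (of_nat (Suc k) * t)) - 1 / 2) \<le> (4 * C) * norm t" if t: "t \<in> sector" "t \<noteq> 0"
      "norm t \<le> 1" for t
  proof -
    let ?R = "\<lambda>k. ?u1 (of_nat k * t) - (?u1 (of_nat (Suc k) * t) + ?u2 (of_nat (Suc k) * t) * (- t))"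
    have R: "norm (?R k) \<le> C * norm t ^ 2 * (1 / (1 + (real k * norm t)\<^sup>2))" for k
    proof -
      let ?a = "of_nat k * t" and ?b = "of_nat (Suc k) * t"
      have "norm ((\<lambda>i. (deriv ^^ Suc i) lexpq) 0 ?a - (\<Sum>i\<le>1. (\<lambda>i. (deriv ^^ Suc i) lexpq) i ?b * (?a -
          ?b) ^ i / fact i))
         \<le> (C / (1 + (real k * norm t)\<^sup>2)) * norm (?a - ?b) ^ Suc 1 / fact 1"
      proof (rule complex_Taylor[of "closed_segment ?a ?b"])
        fix i x assume x: "x \<in> closed_segment ?a ?b"
        have "x \<in> wedge" using closed_segment_multiples[OF x t(1)] by (auto intro: Re_pos_in_wedge)
        thus "((deriv ^^ Suc i) lexpq has_field_derivative (deriv ^^ Suc (Suc i)) lexpq x) (at x within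
            closed_segment ?a ?b)"
          using has_field_derivative_at_within[OF lexpq_higher_deriv] by blast
      next
        fix x assume x: "x \<in> closed_segment ?a ?b"
        note s = closed_segment_multiples[OF x t(1)]
        have "norm ((deriv ^^ 3) lexpq x) \<le> C / (1 + (norm x)\<^sup>2)" using C(2)[OF s(1)] .
        also have "\<dots> \<le> C / (1 + (real k * norm t)\<^sup>2)"
          using C(1) s(2) by (intro divide_left_mono add_left_mono power_mono mult_pos_pos
              add_pos_nonneg) auto
        finally show "norm ((deriv ^^ Suc (Suc 1)) lexpq x) \<le> C / (1 + (real k * norm t)\<^sup>2)"
          by (simp add: numeral_eq_Suc)
      qed auto
      moreover have "?a - ?b = - t" by (simp add: algebra_simps)
      ultimately show ?thesis by (simp add: numeral_eq_Suc)
    qed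
    have sumR: "(\<Sum>k<K. ?R k) = - 1 / 2 - ?u1 (of_nat K * t) + t * (\<Sum>k<K. ?u2 (of_nat (Suc k) * t))" for K
      by (induction K) (simp_all add: lexpq_deriv_0 algebra_simps del: of_nat_Suc)
    have Re: "Re t > 0" using wedge_posD[OF sector_wedge_pos[OF t(1,2)]] by simp
    have "(\<lambda>K. ?u1 (of_nat K * t)) \<longlonglongrightarrow> 0"
    proof (rule Lim_transform_eventually)
      have "(\<lambda>K. inverse (of_nat K) * (1 / t)) \<longlonglongrightarrow> 0 * (1 / t)"
        by (intro tendsto_mult tendsto_const) (rule lim_inverse_n)
      hence "(\<lambda>K. LI 0 (of_nat K * t) - inverse (of_nat K) * (1 / t)) \<longlonglongrightarrow> 0 - 0 * (1 / t)"
        by (intro tendsto_diff LI_neg_tendsto_0 Re) auto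
      thus "(\<lambda>K. LI 0 (of_nat K * t) - inverse (of_nat K) * (1 / t)) \<longlonglongrightarrow> 0" by simp
      show "\<forall>\<^sub>F K in sequentially. LI 0 (of_nat K * t) - inverse (of_nat K) * (1 / t) =
          ?u1 (of_nat K * t)"
        using eventually_gt_at_top[of 0]
      proof eventually_elim
        case (elim K)
        have "of_nat K * t \<in> wedge_pos" using elim t by (intro sector_wedge_pos sector_of_nat_mult) auto
        from wedge_posD[OF this] show ?case using LI_0[of "of_nat K * t"] lexpq_deriv_1[of
            "of_nat K * t"]
          by (simp add: field_simps)
      qed
    qed
    moreover have "summable (\<lambda>k. ?u2 (of_nat (Suc k) * t))"
      using sum_lexpq_deriv[of 2] t by auto
    ultimately have "(\<lambda>K. - 1 / 2 - ?u1 (of_nat K * t) + t * (\<Sum>k<K. ?u2 (of_nat (Suc k) * t))) \<longlonglongrightarrow> -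
        1 / 2 - 0 + t * (\<Sum>k. ?u2 (of_nat (Suc k) * t))"
      by (intro tendsto_intros summable_LIMSEQ)
    hence "(\<lambda>K. norm (\<Sum>k<K. ?R k)) \<longlonglongrightarrow> norm (- 1 / 2 - 0 + t * (\<Sum>k. ?u2 (of_nat (Suc k) * t)))"
      unfolding sumR by (rule tendsto_norm)
    moreover have "norm (\<Sum>k<K. ?R k) \<le> (4 * C) * norm t" for K
    proof -
      have "norm (\<Sum>k<K. ?R k) \<le> (\<Sum>k<K. C * norm t ^ 2 * (1 / (1 + (real k * norm t)\<^sup>2)))"
        by (rule sum_norm_le) (rule R)
      also have "\<dots> = C * norm t ^ 2 * (\<Sum>k<K. 1 / (1 + (real k * norm t)\<^sup>2))"
          by (simp add: sum_distrib_left)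
      also have "\<dots> \<le> C * norm t ^ 2 * (4 / norm t)" using C(1) t
          by (intro mult_left_mono sum_inverse_quadratic) auto
      also have "\<dots> = 4 * C * norm t" using t by (simp add: power2_eq_square)
      finally show ?thesis .
    qed
    ultimately have "norm (- 1 / 2 - 0 + t * (\<Sum>k. ?u2 (of_nat (Suc k) * t))) \<le> (4 * C) * norm t"
      by (intro LIMSEQ_le_const2) auto
    thus ?thesis by (simp add: algebra_simps)
  qed
  thus ?thesis by blast
qed

section \<open>Eisenstein series and the crank quotients\<close>

text \<open>The identity \<open>lexpq_higher_deriv_eq\<close> summed over the multiples of t: the
  singular parts add up to the zeta value, and the sign (-1)^n is - 1 because n is odd.\<close>

lemma sigma_part_eq:
  assumes t: "t \<in> sector" "t \<noteq> 0" "norm t \<le> 1" and n: "n = Suc (2 * i)"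
  shows "t ^ Suc n * sigma_part n t = of_real (fact n * zeta_nat (Suc n)) -
      t ^ Suc n * (\<Sum>k. (deriv ^^ Suc n) lexpq (of_nat (Suc k) * t))"
proof -
  have Re: "Re t > 0" using wedge_posD[OF sector_wedge_pos[OF t(1,2)]] by simp
  have LI: "LI (int n) (of_nat (Suc k) * t) = fact n / t ^ Suc n * of_real (1 / real (Suc k) ^ Suc n) -
      (deriv ^^ Suc n) lexpq (of_nat (Suc k) * t)" for k
  proof -
    have "of_nat (Suc k) * t \<in> wedge_pos" using t
        by (intro sector_wedge_pos sector_of_nat_mult) (auto simp del: of_nat_Suc)
    from lexpq_higher_deriv_eq[OF this, of n] n
    have "(deriv ^^ Suc n) lexpq (of_nat (Suc k) * t) = - (LI (int n) (of_nat (Suc k) * t) -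
        fact n / (of_nat (Suc k) * t) ^ Suc n)"
      by (simp del: of_nat_Suc power_Suc)
    thus ?thesis using t by (simp add: power_mult_distrib field_simps del: of_nat_Suc power_Suc)
  qed
  have s: "summable (\<lambda>k. (deriv ^^ Suc n) lexpq (of_nat (Suc k) * t))"
    using sum_lexpq_deriv[of "Suc n"] t n by auto
  have "(\<lambda>k. LI (int n) (of_nat (Suc k) * t)) sums (fact n / t ^ Suc n * of_real (zeta_nat (Suc n)) -
      (\<Sum>k. (deriv ^^ Suc n) lexpq (of_nat (Suc k) * t)))"
    unfolding LI using n by (intro sums_diff sums_mult sums_of_real zeta_nat_sums summable_sums s) auto
  with sigma_part_sums[OF Re, of n] have sp: "sigma_part n t =
      fact n / t ^ Suc n * of_real (zeta_nat (Suc n)) - (\<Sum>k. (deriv ^^ Suc n) lexpq (of_nat (Suc k) *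
      t))"
    by (rule sums_unique2)
  show ?thesis unfolding sp using t by (simp add: right_diff_distrib del: power_Suc of_nat_Suc
      funpow.simps)
qed

text \<open>The correction t^(2 i + 2) O(1 / t) is negligible for i > 0. For i = 0 it is of first
  order, and \<open>sum_lexpq_deriv2\<close> gives - t / 2: the trace of the quasimodularity of the
  series of weight 2.\<close>

lemma sigma_part_expands:
  "expands (\<lambda>t. t ^ (2 * i + 2) * sigma_part (2 * i + 1) t / fact (2 * i +
      1)) (of_real (zeta_nat (2 * i + 2))) (if i = 0 then - 1 / 2 else 0)"
proof -
  define n where "n = Suc (2 * i)"
  have eq: "t ^ (2 * i + 2) * sigma_part (2 * i + 1) t / fact (2 * i + 1) - of_real (zeta_nat (2 * i +
      2)) =
      - (t ^ Suc n * (\<Sum>k. (deriv ^^ Suc n) lexpq (of_nat (Suc k) * t)) / fact n)" if t: "t \<in> sector" "t \<noteq>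
          0" "norm t \<le> 1" for t
  proof -
    have e: "2 * i + 2 = Suc n" "2 * i + 1 = n" by (simp_all add: n_def)
    show ?thesis unfolding e sigma_part_eq[OF t n_def]
      by (simp add: diff_divide_distrib del: power_Suc funpow.simps of_nat_Suc)
  qed
  show ?thesis
  proof (cases "i = 0")
    case True
    obtain C where C: "\<forall>t\<in>sector. t \<noteq> 0 \<longrightarrow> norm t \<le> 1 \<longrightarrow>
        norm (t * (\<Sum>k. (deriv ^^ 2) lexpq (of_nat (Suc k) * t)) - 1 / 2) \<le> C * norm t"
      using sum_lexpq_deriv2 by (elim exE)
    show ?thesis
    proof (rule expandsI)
      fix t assume t: "t \<in> sector" "t \<noteq> 0" "norm t \<le> 1"
      have "t ^ (2 * i + 2) * sigma_part (2 * i + 1) t / fact (2 * i + 1) - (of_real (zeta_nat (2 * i +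
          2)) + (if i = 0 then - 1 / 2 else 0) * t)
        = - (t * (t * (\<Sum>k. (deriv ^^ 2) lexpq (of_nat (Suc k) * t)) - 1 / 2))"
        using eq[OF t] True by (simp add: n_def algebra_simps numeral_eq_Suc)
      also have "norm \<dots> = norm t * norm (t * (\<Sum>k. (deriv ^^ 2) lexpq (of_nat (Suc k) * t)) - 1 / 2)"
          by (simp only: norm_minus_cancel norm_mult)
      also have "\<dots> \<le> norm t * (C * norm t)" using C t by (intro mult_left_mono) auto
      finally show "norm (t ^ (2 * i + 2) * sigma_part (2 * i + 1) t / fact (2 * i + 1) -
          (of_real (zeta_nat (2 * i + 2)) + (if i = 0 then - 1 / 2 else 0) * t)) \<le> C * norm t ^ 2"
        by (simp add: power2_eq_square mult_ac)
    qed
  next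
    case False
    have "Suc n \<ge> 2" by (simp add: n_def)
    from sum_lexpq_deriv[OF this] obtain C where C0: "C \<ge> 0" and C: "\<forall>t\<in>sector. t \<noteq> 0 \<longrightarrow> norm t \<le> 1 \<longrightarrow>
        summable (\<lambda>k. (deriv ^^ Suc n) lexpq (of_nat (Suc k) * t)) \<and>
     norm (\<Sum>k. (deriv ^^ Suc n) lexpq (of_nat (Suc k) * t)) \<le> C / norm t"
      by (elim exE conjE)
    show ?thesis
    proof (rule expandsI)
      fix t assume t: "t \<in> sector" "t \<noteq> 0" "norm t \<le> 1"
      let ?S = "\<Sum>k. (deriv ^^ Suc n) lexpq (of_nat (Suc k) * t)"
      have "norm (t ^ (2 * i + 2) * sigma_part (2 * i + 1) t / fact (2 * i + 1) -
          (of_real (zeta_nat (2 * i + 2)) + (if i = 0 then - 1 / 2 else 0) * t))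
        = norm t ^ Suc n * norm ?S / fact n"
        using eq[OF t] False by (simp add: norm_mult norm_divide norm_power del: power_Suc)
      also have "\<dots> \<le> norm t ^ Suc n * (C / norm t) / 1"
        using C t by (intro frac_le mult_left_mono) (auto simp: C0)
      also have "\<dots> = C * norm t ^ n" using t by simp
      also have "\<dots> \<le> C * norm t ^ 2" using t False C0
          by (intro mult_left_mono power_decreasing) (auto simp: n_def)
      finally show "norm (t ^ (2 * i + 2) * sigma_part (2 * i + 1) t / fact (2 * i + 1) -
          (of_real (zeta_nat (2 * i + 2)) + (if i = 0 then - 1 / 2 else 0) * t)) \<le> C * norm t ^ 2" .
    qed
  qed
qed

definition quot_part :: "nat \<Rightarrow> complex \<Rightarrow> complex" where
  "quot_part j t = eval_fps (cfps (crank_quot j)) (exp (- t))"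

text \<open>Division by the factorials turns the binomial recursion of \<open>crank_quot\<close>
  into a plain convolution; the factor 2 j comes from (2 j)! = 2 j (2 j - 1)!.\<close>

lemma quot_part_rec:
  assumes "Re t > 0" "j > 0"
  shows "of_nat (2 * j) * (t ^ (2 * j) * quot_part j t / fact (2 * j)) =
     (\<Sum>i<j. 2 * (t ^ (2 * i + 2) * sigma_part (2 * i + 1) t / fact (2 * i + 1)) * (t ^ (2 * (j - Suc i))
         * quot_part (j - Suc i) t / fact (2 * (j - Suc i))))"
proof -
  have n: "norm (exp (- t)) < 1" using assms by simp
  have "of_nat (2 * j) * (t ^ (2 * j) * quot_part j t / fact (2 * j)) =
      t ^ (2 * j) * quot_part j t / fact (2 * j - 1)"
  proof -
    have "fact (2 * j) = of_nat (2 * j) * (fact (2 * j - 1) :: complex)" using assms(2)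
        by (intro fact_reduce) auto
    thus ?thesis using assms(2) by simp
  qed
  also have "\<dots> = (\<Sum>i<j. t ^ (2 * j) * (2 * of_nat ((2 * j - 1) choose (2 * i + 1)) * (sigma_part (2 * i +
      1) t * quot_part (j - Suc i) t)) / fact (2 * j - 1))"
    unfolding quot_part_def sigma_part_def
    by (subst eval_crank_quot[OF n]) (use assms(2) in \<open>simp only: if_False neq0_conv[symmetric]
        sum_distrib_left sum_divide_distrib\<close>)
  also have "\<dots> = (\<Sum>i<j. 2 * (t ^ (2 * i + 2) * sigma_part (2 * i + 1) t / fact (2 * i +
      1)) * (t ^ (2 * (j - Suc i)) * quot_part (j - Suc i) t / fact (2 * (j - Suc i))))"
  proof (rule sum.cong[OF refl])
    fix i assume i: "i \<in> {..<j}"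
    have e: "2 * j - 1 - (2 * i + 1) = 2 * (j - Suc i)" "2 * j = (2 * i + 2) + 2 * (j - Suc i)" using i
        by auto
    have e1: "of_nat ((2 * j - 1) choose (2 * i + 1)) = (fact (2 * j - 1) / (fact (2 * i +
        1) * fact (2 * (j - Suc i))) :: complex)"
      using i by (subst binomial_fact) (auto simp: e(1)[simplified])
    have e2: "t ^ (2 * j) = t ^ (2 * i + 2) * t ^ (2 * (j - Suc i))"
        by (subst e(2)) (simp only: power_add)
    have alg: "x * y * (2 * (G / (F1 * F2)) * (s * q)) / G = 2 * (x * s / F1) * (y * q / F2)"
      if "G \<noteq> 0" for x y G F1 F2 s q :: complex
      using that by (simp add: field_simps)
    show "t ^ (2 * j) * (2 * of_nat ((2 * j - 1) choose (2 * i + 1)) * (sigma_part (2 * i +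
        1) t * quot_part (j - Suc i) t)) / fact (2 * j - 1)
       = 2 * (t ^ (2 * i + 2) * sigma_part (2 * i + 1) t / fact (2 * i + 1)) * (t ^ (2 * (j - Suc i)) *
           quot_part (j - Suc i) t / fact (2 * (j - Suc i)))"
      unfolding e1 e2 by (rule alg) simp
  qed
  finally show ?thesis .
qed

text \<open>Only the convolution recursion of \<open>A\<close> enters. In the linear coefficient the
  earlier linear terms contribute - (j - 1) A (j - 1) and the - 1/2 of the weight 2 series
  contributes - A (j - 1); their sum divided by 2 j is - A (j - 1) / 2, which reproduces the
  pattern.\<close>

lemma quot_part_expands:
  fixes A :: "nat \<Rightarrow> real"
  assumes A0: "A 0 = 1" and rec: "\<And>j. j > 0 \<Longrightarrow> 2 * real j * A j = (\<Sum>i<j. 2 * zeta_nat (2 * i + 2) * A (j -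
      Suc i))"
  shows "expands (\<lambda>t. t ^ (2 * j) * quot_part j t / fact (2 * j)) (of_real (A j)) (of_real (if j =
      0 then 0 else - A (j - 1) / 2))"
proof (induction j rule: less_induct)
  case (less j)
  show ?case
  proof (cases "j = 0")
    case True
    have "quot_part 0 t = 1" if "t \<in> sector" "t \<noteq> 0" for t
      using eval_crank_quot[of "exp (- t)" 0] wedge_posD[OF sector_wedge_pos[OF that]]
          by (simp add: quot_part_def)
    thus ?thesis using True A0 by (intro expands_cong[OF expands_const[of 1]]) auto
  next
    case False
    define B where "B = (\<lambda>j. if j = 0 then 0 else - A (j - 1) / 2)"
    have IH: "expands (\<lambda>t. t ^ (2 * m) * quot_part m t / fact (2 * m)) (of_real (A m)) (of_real (B m))"
        if "m < j" for m
      unfolding B_def by (rule less.IH[OF that])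
    have "expands (\<lambda>t. \<Sum>i<j. (2 * (t ^ (2 * i + 2) * sigma_part (2 * i + 1) t / fact (2 * i +
        1))) * (t ^ (2 * (j - Suc i)) * quot_part (j - Suc i) t / fact (2 * (j - Suc i))))
       (\<Sum>i<j. (2 * of_real (zeta_nat (2 * i + 2))) * of_real (A (j - Suc i)))
       (\<Sum>i<j. (2 * of_real (zeta_nat (2 * i + 2))) * of_real (B (j - Suc i)) + (2 * (if i = 0 then - 1 /
           2 else 0)) * of_real (A (j - Suc i)))"
      by (intro expands_sum expands_mult expands_cmult sigma_part_expands IH) auto
    from expands_cmult[OF this, of "1 / of_nat (2 * j)"]
    show ?thesis
    proof (rule expands_cong)
      fix t assume t: "t \<in> sector" "t \<noteq> 0"
      have Re: "Re t > 0" using wedge_posD[OF sector_wedge_pos[OF t(1,2)]] by simp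
      show "1 / of_nat (2 * j) * (\<Sum>i<j. 2 * (t ^ (2 * i + 2) * sigma_part (2 * i + 1) t / fact (2 * i +
          1)) * (t ^ (2 * (j - Suc i)) * quot_part (j - Suc i) t / fact (2 * (j - Suc i)))) = t ^ (2 * j)
          * quot_part j t / fact (2 * j)"
        using quot_part_rec[OF Re, of j, symmetric] False by simp
    next
      have "(\<Sum>i<j. (2 * of_real (zeta_nat (2 * i + 2))) * of_real (A (j - Suc i))) =
          complex_of_real (\<Sum>i<j. 2 * zeta_nat (2 * i + 2) * A (j - Suc i))" by simp
      also have "(\<Sum>i<j. 2 * zeta_nat (2 * i + 2) * A (j - Suc i)) = 2 * real j * A j"
        using rec[of j] False by simp
      finally show "1 / of_nat (2 * j) * (\<Sum>i<j. (2 * of_real (zeta_nat (2 * i + 2))) * of_real (A (j -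
          Suc i))) = complex_of_real (A j)"
        using False by simp
    next
      obtain m where j: "j = Suc m" using False by (cases j) auto
      \<comment> \<open>As \<open>B 0\<close> vanishes, the last summand drops out; the others are -
        1/2 times the recursion for \<open>A m\<close>.\<close>
      have "(\<Sum>i<j. 2 * zeta_nat (2 * i + 2) * B (j - Suc i)) = - real m * A m"
      proof -
        have "(\<Sum>i<j. 2 * zeta_nat (2 * i + 2) * B (j - Suc i)) = (\<Sum>i<m. 2 * zeta_nat (2 * i + 2) * B (m -
            i))"
          unfolding j by (simp add: B_def)
        also have "\<dots> = (\<Sum>i<m. - (1 / 2) * (2 * zeta_nat (2 * i + 2) * A (m - Suc i)))"
          by (intro sum.cong refl) (auto simp: B_def)
        also have "\<dots> = - (1 / 2) * (\<Sum>i<m. 2 * zeta_nat (2 * i + 2) * A (m - Suc i))"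
            by (simp only: sum_distrib_left)
        also have "\<dots> = - real m * A m" by (cases "m = 0") (use rec[of m] in simp_all)
        finally show ?thesis .
      qed
      moreover have "(\<Sum>i<j. (2 * (if i = 0 then - 1 / 2 else 0)) * A (j - Suc i)) = - A m"
        unfolding j sum.lessThan_Suc_shift by simp
      ultimately have 1: "(\<Sum>i<j. 2 * zeta_nat (2 * i + 2) * B (j - Suc i) + (2 * (if i =
          0 then - 1 / 2 else 0)) * A (j - Suc i)) = - real j * A m"
        unfolding sum.distrib by (simp add: j algebra_simps)
      have "(\<Sum>i<j. (2 * of_real (zeta_nat (2 * i + 2))) * of_real (B (j - Suc i)) + (2 * (if i =
          0 then - 1 / 2 else 0)) * of_real (A (j - Suc i)))
        = complex_of_real (\<Sum>i<j. 2 * zeta_nat (2 * i + 2) * B (j - Suc i) + (2 * (if i = 0 then - 1 / 2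
            else 0)) * A (j - Suc i))"
        by (simp only: of_real_sum, intro sum.cong refl) auto
      also have "\<dots> = complex_of_real (- real j * A m)" unfolding 1 ..
      finally have S: "(\<Sum>i<j. (2 * of_real (zeta_nat (2 * i + 2))) * of_real (B (j - Suc i)) +
          (2 * (if i = 0 then - 1 / 2 else 0)) * of_real (A (j - Suc i)))
        = complex_of_real (- real j * A m)" .
      have Am: "A (j - 1) = A m" by (simp add: j)
      show "1 / of_nat (2 * j) * (\<Sum>i<j. (2 * of_real (zeta_nat (2 * i + 2))) * of_real (B (j - Suc i)) +
          (2 * (if i = 0 then - 1 / 2 else 0)) * of_real (A (j - Suc i)))
         = complex_of_real (if j = 0 then 0 else - A (j - 1) / 2)"
        unfolding S using False Am by (simp add: field_simps)
    qed
  qed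
qed

section \<open>The numbers $B_{2j}(1/2)$\<close>

text \<open>The logarithmic derivative of z / (\<Gamma>(1 + z) \<Gamma>(1 - z)) = sin(pi z) / pi,
  multiplied out so that the zero of the sine at z = 0 is included.\<close>

lemma sin_pi_log_deriv:
  fixes z :: complex
  assumes z: "norm z < 1"
  shows "sin (of_real pi * z) * (1 + z * (Digamma (1 - z) - Digamma (1 + z))) =
      of_real pi * z * cos (of_real pi * z)"
proof -
  define f where "f = (\<lambda>z. rGamma (1 + z) * rGamma (1 - z :: complex))"
  have zf: "z * f z = sin (of_real pi * z) / of_real pi" for z :: complex
    using rGamma_reflection_complex[of z] rGamma_plus1[of z]
        by (simp add: f_def add.commute mult.assoc[symmetric])
  have no: "1 + w \<notin> \<int>\<^sub>\<le>\<^sub>0" if "norm w < 1" for w :: complex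
  proof
    assume "1 + w \<in> \<int>\<^sub>\<le>\<^sub>0"
    then obtain n where "1 + w = - of_nat n" by (elim nonpos_Ints_cases')
    hence "w = - of_nat (Suc n)" by (simp add: algebra_simps eq_neg_iff_add_eq_0)
    hence "norm w = real (Suc n)" by (simp only: norm_minus_cancel norm_of_nat)
    thus False using that by simp
  qed
  have d1: "((\<lambda>z. rGamma (1 + z)) has_field_derivative - rGamma (1 + z) * Digamma (1 + z)) (at z)"
    using has_field_derivative_rGamma_complex'[of "1 + z" UNIV] no[OF z]
    by (intro DERIV_chain2[where f = rGamma and g = "\<lambda>z. 1 + z"
        and Db = 1, simplified]) (auto intro!: derivative_eq_intros)
  have d2: "((\<lambda>z. rGamma (1 - z)) has_field_derivative (- rGamma (1 - z) * Digamma (1 -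
      z)) * (-1)) (at z)"
    using has_field_derivative_rGamma_complex'[of "1 - z" UNIV] no[of "-z"] z
    by (intro DERIV_chain2[where f = rGamma and g = "\<lambda>z. 1 - z" and Db =
        "-1"]) (auto intro!: derivative_eq_intros)
  have df: "(f has_field_derivative f z * (Digamma (1 - z) - Digamma (1 + z))) (at z)"
    unfolding f_def by (rule DERIV_cong[OF DERIV_mult[OF d1 d2]]) (simp add: algebra_simps)
  have "((\<lambda>z. z * f z) has_field_derivative 1 * f z + f z * (Digamma (1 - z) - Digamma (1 +
      z)) * z) (at z)"
    by (rule DERIV_mult[OF DERIV_ident df])
  moreover have "((\<lambda>z. sin (of_real pi * z) / of_real pi) has_field_derivative cos (of_real pi *
      z)) (at z)"
    by (auto intro!: derivative_eq_intros)
  ultimately have "1 * f z + f z * (Digamma (1 - z) - Digamma (1 + z)) * z = cos (of_real pi * z)"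
    unfolding zf by (rule DERIV_unique)
  hence "(of_real pi * (z * f z)) * (1 + z * (Digamma (1 - z) - Digamma (1 + z))) =
      of_real pi * z * cos (of_real pi * z)"
    by (metis (no_types, opaque_lifting) mult.assoc mult.commute distrib_left mult_1_right mult_1_left)
  thus ?thesis unfolding zf by simp
qed

text \<open>The digamma difference has the partial fractions 2 z^2 / (N^2 - z^2) with N \<ge> 1, and
  each of them is a geometric series in (z / N)^2.\<close>

lemma double_geometric_has_sum:
  fixes z :: complex
  assumes z: "norm z < 1"
  shows "((\<lambda>(N,i). 2 * (z / of_nat (Suc N)) ^ (2 * i + 2)) has_sum z * (Digamma (1 + z) - Digamma (1 -
      z))) UNIV"
proof -
  define f where "f = (\<lambda>N i. 2 * (z / of_nat (Suc N)) ^ (2 * i + 2))"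
  define r where "r = norm z"
  have r: "0 \<le> r" "r < 1" using z by (auto simp: r_def)
  \<comment> \<open>Generic in the field: the same computation is used for z and, to obtain absolute
    summability, for its norm.\<close>
  have row: "((\<lambda>i. 2 * (x / of_nat (Suc N)) ^ (2 * i + 2)) has_sum 2 * x ^ 2 / (of_nat (Suc N) ^ 2 -
      x ^ 2)) UNIV"
    if x: "norm x < 1" for x :: "'a :: {real_normed_field, banach}" and N
  proof -
    define y where "y = x / of_nat (Suc N)"
    have n1: "norm (of_nat (Suc N) :: 'a) \<ge> 1" unfolding norm_of_nat by simp
    have "norm y \<le> norm x / 1" unfolding y_def norm_divide using n1 by (intro frac_le) auto
    hence "norm y < 1" using x by simp
    hence y: "norm (y ^ 2) < 1" by (simp add: norm_power power_less_one_iff)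
    have "((\<lambda>i. (y ^ 2) ^ i) has_sum (1 / (1 - y ^ 2))) UNIV"
      using y by (intro norm_summable_imp_has_sum geometric_sums) (auto simp: norm_power
          summable_geometric)
    hence "((\<lambda>i. 2 * y ^ 2 * (y ^ 2) ^ i) has_sum 2 * y ^ 2 * (1 / (1 - y ^ 2))) UNIV"
        by (rule has_sum_cmult_right)
    also have "(\<lambda>i. 2 * y ^ 2 * (y ^ 2) ^ i) = (\<lambda>i. 2 * y ^ (2 * i + 2))"
      by (rule ext) (simp only: power_mult[symmetric] power_add mult_ac)
    also have "2 * y ^ 2 * (1 / (1 - y ^ 2)) = 2 * x ^ 2 / (of_nat (Suc N) ^ 2 - x ^ 2)"
    proof -
      have "(of_nat (Suc N) :: 'a) \<noteq> 0" by (simp del: of_nat_Suc)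
      moreover from this have "of_nat (Suc N) ^ 2 - x ^ 2 = of_nat (Suc N) ^ 2 * (1 - y ^ 2)"
        by (simp add: y_def power_divide right_diff_distrib del: of_nat_Suc)
      ultimately show ?thesis by (simp add: y_def power_divide del: of_nat_Suc)
    qed
    finally show ?thesis by (simp add: y_def)
  qed
  have normf: "norm (f N i) = 2 * (r / of_nat (Suc N)) ^ (2 * i + 2)" for N i
    by (simp add: f_def r_def norm_mult norm_power norm_divide del: of_nat_Suc)
  have rown: "((\<lambda>i. norm (f N i)) has_sum 2 * r ^ 2 / (of_nat (Suc N) ^ 2 - r ^ 2)) UNIV" for N
    unfolding normf using row[of r N] r by simp
  have "(\<lambda>p. norm (case_prod f p)) summable_on UNIV \<times> UNIV"
    unfolding Infinite_Sum.abs_summable_on_Sigma_iff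
  proof (intro conjI ballI)
    show "(\<lambda>i. norm (case (N, i) of (N, i) \<Rightarrow> f N i)) summable_on UNIV" for N
      using rown[of N] by (auto simp: summable_on_def)
    have "(\<lambda>N. 1 / (real N + 1) ^ 2) summable_on UNIV"
      by (rule norm_summable_imp_summable_on) (use inverse_squares_sums in \<open>simp add: sums_iff
          add.commute\<close>)
    hence "(\<lambda>N. 2 / (1 - r ^ 2) * (1 / (real N + 1) ^ 2)) summable_on UNIV"
        by (rule summable_on_cmult_right)
    thus "(\<lambda>N. norm (\<Sum>\<^sub>\<infinity>i. norm (case (N, i) of (N, i) \<Rightarrow> f N i))) summable_on UNIV"
    proof (rule summable_on_comparison_test)
      fix N
      have r2: "r ^ 2 < 1" using r by (simp add: power_less_one_iff)
      have "real (Suc N) ^ 2 * (1 - r ^ 2) \<le> real (Suc N) ^ 2 - r ^ 2"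
      proof -
        have "1 * r ^ 2 \<le> real (Suc N) ^ 2 * r ^ 2"
            by (intro mult_right_mono) (auto simp del: of_nat_Suc)
        thus ?thesis by (simp add: right_diff_distrib del: of_nat_Suc)
      qed
      moreover have "real (Suc N) ^ 2 * (1 - r ^ 2) > 0" using r2 by (intro mult_pos_pos) auto
      ultimately have "2 * r ^ 2 / (of_nat (Suc N) ^ 2 - r ^ 2) \<le> 2 * 1 / (real (Suc N) ^ 2 * (1 -
          r ^ 2))"
        using r2 by (intro frac_le) auto
      also have "\<dots> = 2 / (1 - r ^ 2) * (1 / (real N + 1) ^ 2)" by (simp add: add.commute)
      finally show "norm (\<Sum>\<^sub>\<infinity>i. norm (case (N, i) of (N, i) \<Rightarrow> f N i)) \<le> 2 / (1 - r ^ 2) * (1 / (real N +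
          1) ^ 2)"
        using infsumI[OF rown[of N]] \<open>real (Suc N) ^ 2 * (1 - r ^ 2) \<le> real (Suc N) ^ 2 - r ^ 2\<close> \<open>real
            (Suc N) ^ 2 * (1 - r ^ 2) > 0\<close>
        by (auto simp del: of_nat_Suc)
    qed auto
  qed
  from abs_summable_summable[OF this] have "(\<lambda>(N,i). f N i) summable_on UNIV" by simp
  then obtain S where S: "((\<lambda>(N,i). f N i) has_sum S) UNIV" by (auto simp: summable_on_def)
  have "((\<lambda>N. \<Sum>\<^sub>\<infinity>i. f N i) has_sum S) UNIV" using has_sum_rows[OF S] .
  hence "(\<lambda>N. \<Sum>\<^sub>\<infinity>i. f N i) sums S" by (rule has_sum_imp_sums)
  moreover have "(\<lambda>N. \<Sum>\<^sub>\<infinity>i. f N i) sums (z * (Digamma (1 + z) - Digamma (1 - z)))"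
  proof -
    have nz: "1 + z \<noteq> 0" "1 - z \<noteq> 0" using z by (auto simp: add_eq_0_iff)
    have D: "(\<lambda>k. inverse (of_nat (Suc k)) - inverse (w + of_nat k)) sums (Digamma w + euler_mascheroni)"
        if "w \<noteq> 0" for w :: complex
      using summable_sums[OF summable_Digamma[OF that]] by (simp add: Digamma_def)
    from sums_mult[OF sums_diff[OF D[OF nz(1)] D[OF nz(2)]], of z]
    have "(\<lambda>k. z * ((inverse (of_nat (Suc k)) - inverse (1 + z + of_nat k)) - (inverse (of_nat (Suc k)) -
        inverse (1 - z + of_nat k)))) sums (z * (Digamma (1 + z) - Digamma (1 - z)))"
      by simp
    also have "(\<lambda>k. z * ((inverse (of_nat (Suc k)) - inverse (1 + z + of_nat k)) -
        (inverse (of_nat (Suc k)) - inverse (1 - z + of_nat k)))) = (\<lambda>N. \<Sum>\<^sub>\<infinity>i. f N i)"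
    proof
      fix k
      have n1: "norm (of_nat (Suc k) :: complex) \<ge> 1" unfolding norm_of_nat by simp
      have nz1: "of_nat (Suc k) + z \<noteq> 0" using n1 z by (metis add_eq_0_iff norm_minus_cancel not_less)
      have nz2: "of_nat (Suc k) - z \<noteq> 0" using n1 z by (metis eq_iff_diff_eq_0 not_less)
      note nz = nz1 nz2
      hence p: "of_nat (Suc k) ^ 2 - z ^ 2 \<noteq> 0" by (simp add: power2_eq_square
          square_diff_square_factored)
      have "(\<Sum>\<^sub>\<infinity>i. f k i) = 2 * z ^ 2 / (of_nat (Suc k) ^ 2 - z ^ 2)"
        unfolding f_def by (rule infsumI[OF row[OF z]])
      also have "\<dots> = z * (inverse (of_nat (Suc k) - z) - inverse (of_nat (Suc k) + z))"
      proof -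
        have sq: "of_nat (Suc k) ^ 2 - z ^ 2 = (of_nat (Suc k) + z) * (of_nat (Suc k) - z)"
          by (simp add: power2_eq_square algebra_simps)
        show ?thesis unfolding sq using nz by (simp add: divide_simps power2_eq_square del: of_nat_Suc)
      qed
      finally show "z * ((inverse (of_nat (Suc k)) - inverse (1 + z + of_nat k)) -
          (inverse (of_nat (Suc k)) - inverse (1 - z + of_nat k))) = (\<Sum>\<^sub>\<infinity>i. f k i)"
        by (simp add: algebra_simps)
    qed
    finally show ?thesis .
  qed
  ultimately have "S = z * (Digamma (1 + z) - Digamma (1 - z))" by (rule sums_unique2)
  thus ?thesis using S by (simp add: f_def)
qed

text \<open>The expansion of 1 - pi z cot(pi z).\<close>

definition zeta_fps :: "complex fps" where
  "zeta_fps = Abs_fps (\<lambda>m. if even m \<and> m > 0 then of_real (2 * zeta_nat m) else 0)"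

text \<open>The double sum of \<open>double_geometric_has_sum\<close> in the other order: for a
  fixed power of z, the sum over N is a zeta value.\<close>

lemma zeta_fps_has_sum:
  fixes z :: complex
  assumes z: "norm z < 1"
  shows "((\<lambda>m. fps_nth zeta_fps m * z ^ m) has_sum z * (Digamma (1 + z) - Digamma (1 - z))) UNIV"
proof -
  have "((\<lambda>(i,N). 2 * (z / of_nat (Suc N)) ^ (2 * i + 2)) has_sum z * (Digamma (1 + z) - Digamma (1 -
      z))) UNIV"
    using double_geometric_has_sum[OF z]
    by (subst has_sum_reindex_bij_witness[of _ prod.swap prod.swap UNIV
        "\<lambda>(N,i). 2 * (z / of_nat (Suc N)) ^ (2 * i + 2)"]) auto
  from has_sum_rows[OF this]
  have "((\<lambda>i. \<Sum>\<^sub>\<infinity>N. 2 * (z / of_nat (Suc N)) ^ (2 * i + 2)) has_sum z * (Digamma (1 + z) - Digamma (1 -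
      z))) UNIV" .
  also have "(\<lambda>i. \<Sum>\<^sub>\<infinity>N. 2 * (z / of_nat (Suc N)) ^ (2 * i + 2)) = (\<lambda>i. fps_nth zeta_fps (2 * i +
      2) * z ^ (2 * i + 2))"
  proof
    fix i
    have "(\<lambda>N. complex_of_real (1 / real (Suc N) ^ (2 * i + 2))) sums of_real (zeta_nat (2 * i + 2))"
      by (intro sums_of_real zeta_nat_sums) auto
    hence "((\<lambda>N. complex_of_real (1 / real (Suc N) ^ (2 * i + 2))) has_sum of_real (zeta_nat (2 * i +
        2))) UNIV"
      using zeta_nat_sums[of "2 * i + 2"]
      by (intro norm_summable_imp_has_sum) (auto simp: sums_iff norm_divide norm_power simp del:
          of_nat_Suc power_Suc)
    from has_sum_cmult_right[OF this, of "2 * z ^ (2 * i + 2)"]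
    have "((\<lambda>N. 2 * (z / of_nat (Suc N)) ^ (2 * i + 2)) has_sum 2 * z ^ (2 * i +
        2) * of_real (zeta_nat (2 * i + 2))) UNIV"
      by (simp add: power_divide del: of_nat_Suc power_Suc)
    thus "(\<Sum>\<^sub>\<infinity>N. 2 * (z / of_nat (Suc N)) ^ (2 * i + 2)) = fps_nth zeta_fps (2 * i + 2) * z ^ (2 * i + 2)"
      by (intro infsumI) (simp add: zeta_fps_def mult_ac)
  qed
  also have "((\<lambda>i. fps_nth zeta_fps (2 * i + 2) * z ^ (2 * i + 2)) has_sum z * (Digamma (1 + z) -
      Digamma (1 - z))) UNIV \<longleftrightarrow>
      ((\<lambda>m. fps_nth zeta_fps m * z ^ m) has_sum z * (Digamma (1 + z) - Digamma (1 - z))) (range (\<lambda>i. 2 *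
          i + 2))"
    by (subst has_sum_reindex) (auto simp: inj_on_def o_def)
  also have "\<dots> \<longleftrightarrow> ?thesis"
  proof (rule has_sum_cong_neutral)
    fix m assume "m \<in> UNIV - range (\<lambda>i::nat. 2 * i + 2)"
    hence "\<not> (even m \<and> m > 0)"
    proof (rule contrapos_pn)
      assume "even m \<and> m > 0"
      then obtain i where "m = 2 * i" "i > 0" by (auto elim!: evenE)
      hence "m = 2 * (i - 1) + 2" by simp
      thus "\<not> m \<in> UNIV - range (\<lambda>i::nat. 2 * i + 2)" by blast
    qed
    thus "fps_nth zeta_fps m * z ^ m = 0" by (auto simp: zeta_fps_def)
  qed auto
  finally show ?thesis .
qed

lemma zeta_fps_sums: "norm z < 1 \<Longrightarrow> (\<lambda>m. fps_nth zeta_fps m * z ^ m) sums (z * (Digamma (1 + z) -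
    Digamma (1 - z)))"
  by (rule has_sum_imp_sums) (rule zeta_fps_has_sum)

lemma zeta_fps_conv_radius: "fps_conv_radius zeta_fps \<ge> 1"
  unfolding fps_conv_radius_def
proof (rule conv_radius_geI_ex')
  fix r :: real assume "0 < r" "ereal r < 1"
  thus "summable (\<lambda>n. fps_nth zeta_fps n * of_real r ^ n)"
    using zeta_fps_sums[of "of_real r"] by (auto simp: one_ereal_def sums_iff)
qed

text \<open>\<open>fps_sin\<close> has no constant term and thus no inverse, so the cotangent
  expansion is stated multiplied out. Equality of values near 0 gives equality of the
  series.\<close>

lemma cot_zeta_fps: "fps_sin (of_real pi) * (1 - zeta_fps) =
    fps_const (of_real pi) * fps_X * fps_cos (of_real pi)"
proof (rule eval_fps_eqD)
  have 1: "fps_conv_radius (fps_sin (of_real pi) * (1 - zeta_fps)) \<ge> 1"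
  proof (rule fps_conv_radius_mult_ge)
    have "1 \<le> min (fps_conv_radius (1 :: complex fps)) (fps_conv_radius zeta_fps)"
        using zeta_fps_conv_radius by simp
    also note fps_conv_radius_diff[of 1 zeta_fps]
    finally show "1 \<le> fps_conv_radius (1 - zeta_fps)" .
  qed simp
  thus "0 < fps_conv_radius (fps_sin (of_real pi) * (1 - zeta_fps))"
      by (rule less_le_trans[rotated]) simp
  have 2: "fps_conv_radius (fps_const (of_real pi) * fps_X * fps_cos (of_real pi) :: complex fps) \<ge> 1"
    by (intro fps_conv_radius_mult_ge) auto
  thus "0 < fps_conv_radius (fps_const (of_real pi) * fps_X * fps_cos (of_real pi) :: complex fps)"
      by (rule less_le_trans[rotated]) simp
  have "eventually (\<lambda>z::complex. norm z < 1) (nhds 0)"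
    using eventually_nhds_in_open[of "ball 0 1" "0::complex"] by simp
  thus "\<forall>\<^sub>F z in nhds 0. eval_fps (fps_sin (of_real pi) * (1 - zeta_fps)) z =
      eval_fps (fps_const (of_real pi) * fps_X * fps_cos (of_real pi)) z"
  proof eventually_elim
    case (elim z)
    have zz: "ereal (norm z) < fps_conv_radius zeta_fps" using zeta_fps_conv_radius elim
        by (rule unit_disc_conv)
    have d: "ereal (norm z) < fps_conv_radius (1 - zeta_fps)"
      using fps_conv_radius_diff[of 1 zeta_fps] zz by (auto intro: less_le_trans)
    have e: "eval_fps zeta_fps z = z * (Digamma (1 + z) - Digamma (1 - z))"
      using zeta_fps_sums[OF elim] by (simp add: eval_fps_def sums_iff)
    have "eval_fps (fps_sin (of_real pi) * (1 - zeta_fps)) z = sin (of_real pi * z) * (1 -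
        eval_fps zeta_fps z)"
      using zz d by (simp add: eval_fps_mult eval_fps_diff)
    also have "\<dots> = sin (of_real pi * z) * (1 + z * (Digamma (1 - z) - Digamma (1 + z)))"
      unfolding e by (simp add: algebra_simps)
    also have "\<dots> = of_real pi * z * cos (of_real pi * z)" by (rule sin_pi_log_deriv[OF elim])
    also have "\<dots> = eval_fps (fps_const (of_real pi) * fps_X * fps_cos (of_real pi)) z"
    proof -
      have "ereal (norm z) < fps_conv_radius (fps_const (of_real pi) * fps_X :: complex fps)"
        using fps_conv_radius_mult[of "fps_const (of_real pi)" "fps_X :: complex fps"]
            by (auto intro: less_le_trans)
      thus ?thesis by (simp add: eval_fps_mult)
    qed
    finally show ?case .
  qed
qed

text \<open>The coefficient of \<open>z\<^sup>2\<^sup>j\<close> in \<open>\<pi> z / sin (\<pi> z)\<close>.\<close>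

definition csc_coeff :: "nat \<Rightarrow> real" where
  "csc_coeff j = (2 * pi) ^ (2 * j) * (-1) ^ j * bernoulli_poly (2 * j) (1 / 2) / fact (2 * j)"

text \<open>The generating function t exp(t / 2) / (exp t - 1) equals t / (exp(t / 2) - exp(- t /
  2)), which at t = 2 pi i z is pi z / sin(pi z). Its logarithmic derivative z H' / H is 1 - pi z
  cot(pi z), and the recursion is the comparison of coefficients in z H' = \<open>zeta_fps\<close>
  H.\<close>

lemma csc_coeff_rec:
  shows "csc_coeff 0 = 1"
    and "j > 0 \<Longrightarrow> 2 * real j * csc_coeff j = (\<Sum>i<j. 2 * zeta_nat (2 * i + 2) * csc_coeff (j - Suc i))"
proof -
  define G where "G = fps_X * fps_exp (1 / 2) / (fps_exp 1 - 1 :: real fps)"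
  have bG: "bernoulli_poly n (1 / 2) / fact n = fps_nth G n" for n
    by (simp add: bernoulli_poly_def G_def)
  have sub: "subdegree (fps_exp 1 - 1 :: real fps) = 1"
    by (intro subdegreeI) auto
  \<comment> \<open>The divisor in \<open>bernoulli_poly\<close> is not a unit; numerator and
    denominator both have order 1 at 0, which makes the division exact.\<close>
  have "(fps_exp 1 - 1 :: real fps) dvd fps_X * fps_exp (1 / 2)"
  proof (subst fps_dvd_iff)
    show "(fps_exp 1 - 1 :: real fps) \<noteq> 0" using sub by (metis subdegree_0 zero_neq_one)
    show "subdegree (fps_exp 1 - 1 :: real fps) \<le> subdegree (fps_X * fps_exp (1 / 2) :: real fps)"
      unfolding sub by (subst subdegree_mult) auto
  qed auto
  hence G1: "G * (fps_exp 1 - 1) = fps_X * fps_exp (1 / 2)"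
    unfolding G_def by (rule dvd_div_mult_self)
  have "G * (fps_exp (1/2) - fps_exp (- 1 / 2)) = fps_X"
  proof -
    have e: "fps_exp (1/2) * fps_exp (- 1 / 2) = (1 :: real fps)"
        "fps_exp 1 * fps_exp (- 1 / 2) = (fps_exp (1/2) :: real fps)"
      by (simp_all flip: fps_exp_add_mult)
    have "G * (fps_exp 1 - 1) * fps_exp (- 1 / 2) = fps_X * (fps_exp (1 / 2) * fps_exp (- 1 / 2))"
        unfolding G1 by (simp add: mult_ac)
    thus ?thesis by (simp only: e mult.assoc left_diff_distrib mult_1_left mult_1_right)
  qed
  hence "cfps (G * (fps_exp (1/2) - fps_exp (- 1 / 2))) = cfps fps_X" by simp
  moreover have "cfps (fps_exp (1/2) - fps_exp (- 1 / 2)) = fps_exp (1 / 2) - fps_exp (- 1 / 2)"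
      "cfps fps_X = fps_X"
    by (rule fps_ext, simp)+
  ultimately have G2: "cfps G * (fps_exp (1 / 2) - fps_exp (- 1 / 2)) = fps_X" by (simp add: cfps_mult)
  define c where "c = 2 * of_real pi * \<i>"
  define H where "H = cfps G oo (fps_const c * fps_X)"
  have Hn: "fps_nth H n = c ^ n * of_real (fps_nth G n)" for n
    by (simp add: H_def fps_compose_linear)
  have ex: "fps_exp a oo (fps_const c * fps_X) = fps_exp (c * a)" for a :: complex
    by (rule fps_ext) (simp add: fps_compose_linear power_mult_distrib)
  have "H * (fps_exp (c * (1 / 2)) - fps_exp (c * (- 1 / 2))) = (cfps G * (fps_exp (1 / 2) -
      fps_exp (- 1 / 2))) oo (fps_const c * fps_X)"
    unfolding H_def ex[symmetric] by (simp add: fps_compose_mult_distrib fps_compose_sub_distrib)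
  also have "\<dots> = fps_const c * fps_X" unfolding G2 by simp
  also have "fps_exp (c * (1 / 2)) - fps_exp (c * (- 1 / 2)) = fps_const (2 * \<i>) * fps_sin (of_real pi)"
  proof (rule eval_fps_eqD)
    have s: "fps_conv_radius (fps_const (2 * \<i>) * fps_sin (of_real pi)) \<ge> 1"
      "fps_conv_radius (fps_exp (c * (1 / 2)) - fps_exp (c * (- 1 / 2))) \<ge> 1"
      using fps_conv_radius_diff[of "fps_exp (c * (1 / 2))" "fps_exp (c * (- 1 / 2))"]
      by (auto intro!: fps_conv_radius_mult_ge)
    thus "0 < fps_conv_radius (fps_const (2 * \<i>) * fps_sin (of_real pi))"
      "0 < fps_conv_radius (fps_exp (c * (1 / 2)) - fps_exp (c * (- 1 / 2)))"
      by (auto intro: less_le_trans[of _ 1])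
    show "\<forall>\<^sub>F z in nhds 0. eval_fps (fps_exp (c * (1 / 2)) - fps_exp (c * (- 1 / 2))) z =
        eval_fps (fps_const (2 * \<i>) * fps_sin (of_real pi)) z"
      by (rule always_eventually) (simp add: eval_fps_mult eval_fps_diff c_def sin_exp_eq mult_ac)
  qed
  finally have "fps_const (2 * \<i>) * (H * fps_sin (of_real pi)) =
      fps_const (2 * \<i>) * (fps_const (of_real pi) * fps_X)"
    by (simp add: c_def mult_ac flip: fps_const_mult)
  hence Hs: "H * fps_sin (of_real pi) = fps_const (of_real pi) * fps_X" by simp
  have s0: "fps_sin (complex_of_real pi) \<noteq> 0"
  proof
    assume "fps_sin (complex_of_real pi) = 0"
    hence "fps_nth (fps_sin (complex_of_real pi)) 1 = 0" by simp
    thus False by (simp add: fps_sin_def)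
  qed
  have "fps_deriv (H * fps_sin (of_real pi)) = fps_const (of_real pi)" unfolding Hs by simp
  hence "fps_deriv H * fps_sin (of_real pi) + H * (fps_const (of_real pi) * fps_cos (of_real pi)) =
      fps_const (of_real pi)"
    by (simp add: fps_sin_deriv algebra_simps)
  hence "fps_X * (fps_deriv H * fps_sin (of_real pi) +
      H * (fps_const (of_real pi) * fps_cos (of_real pi))) = fps_X * fps_const (of_real pi)"
    by simp
  hence "fps_X * fps_deriv H * fps_sin (of_real pi) + H * (fps_const (of_real pi) * fps_X *
      fps_cos (of_real pi)) = H * fps_sin (of_real pi)"
    unfolding Hs by (simp add: algebra_simps)
  hence "fps_X * fps_deriv H * fps_sin (of_real pi) = zeta_fps * H * fps_sin (of_real pi)"
    unfolding cot_zeta_fps[symmetric] by (simp add: algebra_simps)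
  hence ode: "fps_X * fps_deriv H = zeta_fps * H" using s0 by simp
  have Hc: "fps_nth H (2 * j) = of_real (csc_coeff j)" for j
  proof -
    have "c ^ (2 * j) = of_real ((2 * pi) ^ (2 * j) * (-1) ^ j)"
    proof -
      have "(2 * pi) ^ (2 * j) * (-1) ^ j = (- ((2 * pi) ^ 2)) ^ j"
        by (subst power_minus) (simp add: power_mult)
      moreover have "c ^ 2 = of_real (- ((2 * pi) ^ 2))" by (simp add: c_def power_mult_distrib)
      ultimately show ?thesis by (simp only: power_mult of_real_power)
    qed
    thus ?thesis unfolding Hn csc_coeff_def by (simp add: bG[symmetric] del: of_real_power)
  qed
  show "csc_coeff 0 = 1"
  proof -
    have "fps_nth (G * (fps_exp 1 - 1)) 1 = fps_nth (fps_X * fps_exp (1 / 2)) (1 :: nat)"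
        by (simp only: G1)
    hence "fps_nth G 0 = 1" by (simp add: fps_mult_nth)
    thus ?thesis using bG[of 0] by (simp add: csc_coeff_def)
  qed
  show "2 * real j * csc_coeff j = (\<Sum>i<j. 2 * zeta_nat (2 * i + 2) * csc_coeff (j - Suc i))" if "j > 0"
  proof -
    have "of_nat (2 * j) * fps_nth H (2 * j) = fps_nth (fps_X * fps_deriv H) (2 * j)" using that
        by (cases j) auto
    also have "\<dots> = (\<Sum>m\<in>{0..2 * j}. fps_nth zeta_fps m * fps_nth H (2 * j - m))"
        by (simp add: ode fps_mult_nth)
    also have "\<dots> = (\<Sum>m\<in>(\<lambda>i. 2 * i + 2) ` {..<j}. fps_nth zeta_fps m * fps_nth H (2 * j - m))"
    proof (rule sum.mono_neutral_right)
      show "\<forall>m\<in>{0..2 * j} - (\<lambda>i. 2 * i + 2) ` {..<j}. fps_nth zeta_fps m * fps_nth H (2 * j - m) = 0"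
      proof
        fix m assume m: "m \<in> {0..2 * j} - (\<lambda>i. 2 * i + 2) ` {..<j}"
        have "\<not> (even m \<and> m > 0)"
        proof
          assume "even m \<and> m > 0"
          then obtain i where "m = 2 * i" "i > 0" by (auto elim!: evenE)
          hence "m = 2 * (i - 1) + 2" "i - 1 < j" using m by auto
          with m show False by blast
        qed
        thus "fps_nth zeta_fps m * fps_nth H (2 * j - m) = 0" by (auto simp: zeta_fps_def)
      qed
    qed auto
    also have "\<dots> = (\<Sum>i<j. fps_nth zeta_fps (2 * i + 2) * fps_nth H (2 * j - (2 * i + 2)))"
      by (subst sum.reindex) (auto simp: inj_on_def)
    also have "\<dots> = (\<Sum>i<j. of_real (2 * zeta_nat (2 * i + 2) * csc_coeff (j - Suc i)))"
    proof (rule sum.cong[OF refl])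
      fix i assume "i \<in> {..<j}"
      have "2 * j - (2 * i + 2) = 2 * (j - Suc i)" by simp
      thus "fps_nth zeta_fps (2 * i + 2) * fps_nth H (2 * j - (2 * i + 2)) =
          of_real (2 * zeta_nat (2 * i + 2) * csc_coeff (j - Suc i))"
        by (simp only: Hc) (simp add: zeta_fps_def)
    qed
    finally have "complex_of_real (2 * real j * csc_coeff j) =
        complex_of_real (\<Sum>i<j. 2 * zeta_nat (2 * i + 2) * csc_coeff (j - Suc i))"
      unfolding Hc by simp
    thus ?thesis by (simp only: of_real_eq_iff)
  qed
qed

section \<open>Truncated Hankel integrals\<close>

lemma bessel_term_summable:
  assumes z: "z > 0"
  shows "summable (\<lambda>m. (z / 2) powr (2 * real m + \<nu>) * rGamma (real m + \<nu> + 1) / fact m)"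
proof -
  define x where "x = z / 2"
  have x: "x > 0" using z by (simp add: x_def)
  \<comment> \<open>For m \<ge> N the factor m + \<nu> + 1 is positive and at least 2 x^2, whatever
    the sign of \<nu>.\<close>
  obtain N :: nat where N: "real N \<ge> 2 * x ^ 2 + 1 + \<bar>\<nu>\<bar>" using real_arch_simple by blast
  show ?thesis unfolding x_def[symmetric]
  proof (rule summable_ratio_test[of "1/2" N])
    fix m assume "m \<ge> N"
    hence m: "real m \<ge> 2 * x ^ 2 + 1 + \<bar>\<nu>\<bar>" using N by linarith
    have "x ^ 2 \<ge> 0" by simp
    hence p1: "real m + \<nu> + 1 \<ge> 2 * x ^ 2" "real m + \<nu> + 1 > 0" using m by linarith+
    have rg: "rGamma (real m + \<nu> + 1) = (real m + \<nu> + 1) * rGamma (real (Suc m) + \<nu> + 1)"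
      using rGamma_plus1[of "real m + \<nu> + 1"] by (simp add: algebra_simps)
    have pw: "x powr (2 * real (Suc m) + \<nu>) = x ^ 2 * x powr (2 * real m + \<nu>)"
    proof -
      have "2 * real (Suc m) + \<nu> = 2 + (2 * real m + \<nu>)" by simp
      thus ?thesis using x by (simp only: powr_add) (simp add: powr_numeral)
    qed
    have "norm (x powr (2 * real (Suc m) + \<nu>) * rGamma (real (Suc m) + \<nu> + 1) / fact (Suc m)) =
       x ^ 2 * (x powr (2 * real m + \<nu>) * \<bar>rGamma (real (Suc m) + \<nu> + 1)\<bar> / fact (Suc m))"
      unfolding pw by (simp add: abs_mult)
    also have "\<dots> \<le> ((real m + \<nu> + 1) / 2) * (x powr (2 * real m + \<nu>) * \<bar>rGamma (real (Suc m) + \<nu> +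
        1)\<bar> / fact m)"
    proof (intro mult_mono)
      show "x powr (2 * real m + \<nu>) * \<bar>rGamma (real (Suc m) + \<nu> + 1)\<bar> / fact (Suc m) \<le>
          x powr (2 * real m + \<nu>) * \<bar>rGamma (real (Suc m) + \<nu> + 1)\<bar> / fact m"
        by (intro divide_left_mono) (auto intro!: fact_mono)
    qed (use p1 in auto)
    also have "\<dots> = 1 / 2 * norm (x powr (2 * real m + \<nu>) * rGamma (real m + \<nu> + 1) / fact m)"
      unfolding rg using p1 by (simp add: abs_mult)
    finally show "norm (x powr (2 * real (Suc m) + \<nu>) * rGamma (real (Suc m) + \<nu> + 1) / fact (Suc m)) \<le>
        1 / 2 * norm (x powr (2 * real m + \<nu>) * rGamma (real m + \<nu> + 1) / fact m)" .
  qed simp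
qed

lemma bessel_I_rec:
  assumes z: "z > 0"
  shows "bessel_I (\<nu> - 1) z - bessel_I (\<nu> + 1) z = 2 * \<nu> / z * bessel_I \<nu> z"
proof -
  define x where "x = z / 2"
  have x: "x > 0" using z by (simp add: x_def)
  define t where "t = (\<lambda>\<nu> m. x powr (2 * real m + \<nu>) * rGamma (real m + \<nu> + 1) / fact m)"
  have t: "t \<nu> sums bessel_I \<nu> z" for \<nu>
    unfolding t_def x_def bessel_I_def by (rule summable_sums[OF bessel_term_summable[OF z]])
  have pm: "x powr (a - 1) = x powr a / x" for a using x by (simp add: powr_diff)
  \<comment> \<open>The factor m makes the term at 0 vanish; shifted by one, the series is that of
    order \<nu> + 1.\<close>
  define c where "c = (\<lambda>m. real m * (x powr (2 * real m + \<nu>) / x) * rGamma (real m + \<nu> + 1) / fact m)"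
  have "t (\<nu> - 1) m - \<nu> / x * t \<nu> m = c m" for m
  proof -
    have a: "rGamma (real m + (\<nu> - 1) + 1) = (real m + \<nu>) * rGamma (real m + \<nu> + 1)"
      using rGamma_plus1[of "real m + \<nu>"] by simp
    have b: "x powr (2 * real m + (\<nu> - 1)) = x powr (2 * real m + \<nu>) / x"
      using pm[of "2 * real m + \<nu>"] by (simp add: algebra_simps)
    show ?thesis unfolding t_def c_def a b using x by (simp add: field_simps)
  qed
  hence c: "c sums (bessel_I (\<nu> - 1) z - \<nu> / x * bessel_I \<nu> z)"
    using sums_diff[OF t[of "\<nu> - 1"] sums_mult[OF t[of \<nu>], of "\<nu> / x"]] by simp
  have "c (Suc m) = t (\<nu> + 1) m" for m
  proof -
    have "x powr (2 * real (Suc m) + \<nu>) / x = x powr (2 * real m + (\<nu> + 1))"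
      using pm[of "2 * real (Suc m) + \<nu>"] by (simp add: algebra_simps)
    thus ?thesis unfolding c_def t_def by (simp add: add_ac)
  qed
  hence "(\<lambda>m. c (Suc m)) sums bessel_I (\<nu> + 1) z" using t[of "\<nu> + 1"] by simp
  moreover have "c 0 = 0" by (simp add: c_def)
  ultimately have "c sums bessel_I (\<nu> + 1) z" by (subst (asm) sums_Suc_iff) simp
  with c have "bessel_I (\<nu> - 1) z - \<nu> / x * bessel_I \<nu> z = bessel_I (\<nu> + 1) z" by (rule sums_unique2)
  thus ?thesis by (simp add: x_def field_simps)
qed

lemma rGamma_half: "rGamma (real m + 1 / 2) = 4 ^ m * fact m / (fact (2 * m) * sqrt pi)"
proof (induction m)
  case 0
  show ?case by (simp add: rGamma_inverse_Gamma Gamma_one_half_real inverse_eq_divide)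
next
  case (Suc m)
  have "(real m + 1 / 2) * rGamma (real (Suc m) + 1 / 2) = 4 ^ m * fact m / (fact (2 * m) * sqrt pi)"
    using rGamma_plus1[of "real m + 1 / 2"] Suc by (simp add: algebra_simps)
  hence "rGamma (real (Suc m) + 1 / 2) = 4 ^ m * fact m / (fact (2 * m) * sqrt pi) / (real m + 1 / 2)"
    by (simp add: field_simps add_nonneg_eq_0_iff)
  also have "\<dots> = 4 ^ Suc m * fact (Suc m) / (fact (2 * Suc m) * sqrt pi)"
    by (simp add: divide_simps add_nonneg_eq_0_iff) (simp add: algebra_simps)
  finally show ?case .
qed

lemma exp_even_odd_sums:
  fixes z :: real
  shows "(\<lambda>m. z ^ (2 * m) / fact (2 * m)) sums cosh z"
      "(\<lambda>m. z ^ (2 * m + 1) / fact (2 * m + 1)) sums sinh z"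
proof -
  have 1: "strict_mono (\<lambda>m::nat. 2 * m)" "strict_mono (\<lambda>m::nat. 2 * m + 1)"
      by (auto simp: strict_mono_def)
  have "(\<lambda>m. (\<lambda>n. if even n then z ^ n /\<^sub>R fact n else 0) (2 * m)) sums cosh z"
    using cosh_converges[of z] by (subst sums_mono_reindex[OF 1(1)]) (auto elim!: evenE)
  thus "(\<lambda>m. z ^ (2 * m) / fact (2 * m)) sums cosh z" by (simp add: divide_inverse mult.commute)
  have "(\<lambda>m. (\<lambda>n. if even n then 0 else z ^ n /\<^sub>R fact n) (2 * m + 1)) sums sinh z"
    using sinh_converges[of z] by (subst sums_mono_reindex[OF 1(2)]) (auto elim!: oddE)
  thus "(\<lambda>m. z ^ (2 * m + 1) / fact (2 * m + 1)) sums sinh z"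
    by (simp add: divide_inverse mult.commute del: fact_Suc)
qed

text \<open>By \<open>rGamma_half\<close>, m! \<Gamma>(m + 1/2) is (2 m)! sqrt(pi) / 4^m, which
  turns the Bessel series into those of the hyperbolic functions.\<close>

lemma bessel_I_half:
  assumes z: "z > 0"
  shows "bessel_I (- (1 / 2)) z = cosh z / sqrt (pi * z / 2)"
      "bessel_I (1 / 2) z = sinh z / sqrt (pi * z / 2)"
proof -
  define x where "x = z / 2"
  have x: "x > 0" using z by (simp add: x_def)
  have sq: "sqrt (pi * z / 2) = sqrt pi * sqrt x" by (simp add: x_def real_sqrt_mult[symmetric])
  have sqx: "sqrt x * sqrt x = x" using x by simp
  have pw: "x powr (2 * real m + (- (1 / 2))) = x ^ (2 * m) / sqrt x"
      "x powr (2 * real m + 1 / 2) = x ^ (2 * m) * sqrt x" for m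
    using x powr_realpow[of x "2 * m"] by (simp_all add: powr_add powr_diff powr_half_sqrt)
  have z4: "z ^ (2 * m) = 4 ^ m * x ^ (2 * m)" for m by (simp add: x_def power_mult power_divide)
  have "(\<lambda>m. x powr (2 * real m + (- (1 / 2))) * rGamma (real m + (- (1 / 2)) + 1) / fact m) =
      (\<lambda>m. 1 / sqrt (pi * z / 2) * (z ^ (2 * m) / fact (2 * m)))"
  proof
    fix m
    have "real m + (- (1 / 2)) + 1 = real m + 1 / 2" by simp
    thus "x powr (2 * real m + (- (1 / 2))) * rGamma (real m + (- (1 / 2)) + 1) / fact m =
        1 / sqrt (pi * z / 2) * (z ^ (2 * m) / fact (2 * m))"
      unfolding pw z4 sq by (simp only: rGamma_half) (use x in \<open>simp add: field_simps\<close>)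
  qed
  moreover from sums_mult[OF exp_even_odd_sums(1)[of z], of "1 / sqrt (pi * z / 2)"]
  have "(\<lambda>m. 1 / sqrt (pi * z / 2) * (z ^ (2 * m) / fact (2 * m))) sums (1 / sqrt (pi * z / 2) * cosh z)"
      .
  ultimately show "bessel_I (- (1 / 2)) z = cosh z / sqrt (pi * z / 2)"
    unfolding bessel_I_def x_def by (simp add: sums_iff)
  have "(\<lambda>m. x powr (2 * real m + 1 / 2) * rGamma (real m + 1 / 2 + 1) / fact m) =
      (\<lambda>m. 1 / sqrt (pi * z / 2) * (z ^ (2 * m + 1) / fact (2 * m + 1)))"
  proof
    fix m
    have "(real m + 1 / 2) * rGamma (real m + 1 / 2 + 1) = 4 ^ m * fact m / (fact (2 * m) * sqrt pi)"
      using rGamma_plus1[of "real m + 1 / 2"] rGamma_half[of m] by simp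
    hence rg: "rGamma (real m + 1 / 2 + 1) = 4 ^ m * fact m / (fact (2 * m) * sqrt pi) / (real m +
        1 / 2)"
      by (simp add: field_simps add_nonneg_eq_0_iff)
    have "x powr (2 * real m + 1 / 2) * rGamma (real m + 1 / 2 + 1) / fact m =
        4 ^ m * x ^ (2 * m) * (sqrt x / sqrt pi) * (2 / fact (2 * m + 1))"
      unfolding pw rg by (simp add: divide_simps add_nonneg_eq_0_iff)
    also have "sqrt x / sqrt pi = x / (sqrt pi * sqrt x)" using x sqx by (simp add: field_simps)
    also have "4 ^ m * x ^ (2 * m) * (x / (sqrt pi * sqrt x)) * (2 / fact (2 * m + 1)) =
        1 / sqrt (pi * z / 2) * (z ^ (2 * m + 1) / fact (2 * m + 1))"
      unfolding sq power_add z4 by (simp add: x_def)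
    finally show "x powr (2 * real m + 1 / 2) * rGamma (real m + 1 / 2 + 1) / fact m =
        1 / sqrt (pi * z / 2) * (z ^ (2 * m + 1) / fact (2 * m + 1))" .
  qed
  moreover from sums_mult[OF exp_even_odd_sums(2)[of z], of "1 / sqrt (pi * z / 2)"]
  have "(\<lambda>m. 1 / sqrt (pi * z / 2) * (z ^ (2 * m + 1) / fact (2 * m + 1))) sums (1 / sqrt (pi * z / 2) *
      sinh z)" .
  ultimately show "bessel_I (1 / 2) z = sinh z / sqrt (pi * z / 2)"
    unfolding bessel_I_def x_def by (simp add: sums_iff)
qed

section \<open>Gaussian integrals\<close>

lemma gauss_half_line:
  assumes "k > 0"
  shows "((\<lambda>x. exp (- k * x\<^sup>2)) has_integral sqrt (pi / k) / 2) {0..}"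
proof -
  have "has_bochner_integral lborel (\<lambda>x. indicator {0..} (0 + sqrt k * x) *\<^sub>R exp (- (0 +
      sqrt k * x)\<^sup>2)) ((sqrt pi / 2) /\<^sub>R \<bar>sqrt k\<bar>)"
    using gaussian_moment_0 assms by (subst lborel_has_bochner_integral_real_affine_iff[symmetric]) auto
  also have "(\<lambda>x. indicator {0..} (0 + sqrt k * x) *\<^sub>R exp (- (0 + sqrt k * x)\<^sup>2)) =
      (\<lambda>x. if x \<in> {0..} then exp (- k * x\<^sup>2) else 0)"
    using assms by (auto simp: fun_eq_iff indicator_def power_mult_distrib zero_le_mult_iff)
  also have "(sqrt pi / 2) /\<^sub>R \<bar>sqrt k\<bar> = sqrt (pi / k) / 2" using assms
      by (simp add: real_sqrt_divide field_simps)
  finally have "has_bochner_integral lborel (\<lambda>x. if x \<in> {0..} then exp (- k * x\<^sup>2) else 0) (sqrt (pi /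
      k) / 2)" .
  note bi = this[unfolded has_bochner_integral_iff]
  have "((\<lambda>x. if x \<in> {0..} then exp (- k * x\<^sup>2) else 0) has_integral sqrt (pi / k) / 2) UNIV"
    using has_integral_integral_lborel[OF conjunct1[OF bi]] unfolding conjunct2[OF bi] .
  thus ?thesis by (simp only: has_integral_restrict_UNIV)
qed

text \<open>For x \<ge> b and k \<ge> 1, k x^2 \<ge> (k - 1) b^2 + x^2. The tail is thus at most
  exp(- (k - 1) b^2) times the fixed integral of exp(- x^2), whence the factor exp(b^2).\<close>

lemma gauss_truncated:
  assumes k: "k \<ge> 1" and b: "b \<ge> 0"
  shows "\<bar>integral {-b..b} (\<lambda>x. exp (- k * x\<^sup>2)) - sqrt (pi / k)\<bar> \<le> exp (b\<^sup>2) * sqrt pi * exp (- k * b\<^sup>2)"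
    and "integral {-b..b} (\<lambda>x. exp (- k * x\<^sup>2)) \<le> sqrt (pi / k)"
proof -
  let ?f = "\<lambda>x. exp (- k * x\<^sup>2 :: real)"
  have int: "?f integrable_on {u..v}" for u v by (intro integrable_continuous_interval continuous_intros)
  have half: "(?f has_integral sqrt (pi / k) / 2) {0..}" by (rule gauss_half_line) (use k in auto)
  define I where "I = integral {0..b} ?f"
  have I: "(?f has_integral I) {0..b}" unfolding I_def using int by (simp add: integrable_integral)
  hence "(?f has_integral I) {-b..0}"
    using has_integral_reflect_real[where f = ?f and a = 0 and b = b and i = I] by simp
  hence "(?f has_integral I + I) {-b..b}" using I b by (intro has_integral_combine[of "-b" 0 b]) auto
  hence J: "integral {-b..b} ?f = 2 * I" by (simp add: integral_unique)
  have tail: "((\<lambda>x. ?f x - (if x \<in> {0..b} then ?f x else 0)) has_integral (sqrt (pi / k) / 2 - I)) {0..}"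
    using I b by (intro has_integral_diff half) (subst has_integral_restrict, auto)
  have t0: "0 \<le> sqrt (pi / k) / 2 - I" by (rule has_integral_nonneg[OF tail]) auto
  have one: "((\<lambda>x. exp (- (k - 1) * b\<^sup>2) * exp (- 1 * x\<^sup>2)) has_integral exp (- (k -
      1) * b\<^sup>2) * (sqrt (pi / 1) / 2)) {0..}"
    by (intro has_integral_mult_right gauss_half_line) simp
  have "sqrt (pi / k) / 2 - I \<le> exp (- (k - 1) * b\<^sup>2) * (sqrt (pi / 1) / 2)"
  proof (rule has_integral_le)
    show "((\<lambda>x. ?f x - (if x \<in> {0..b} then ?f x else 0)) has_integral (sqrt (pi / k) / 2 - I)) {0..}"
      by (rule tail)
    show "((\<lambda>x. exp (- (k - 1) * b\<^sup>2) * exp (- 1 * x\<^sup>2)) has_integral exp (- (k -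
        1) * b\<^sup>2) * (sqrt (pi / 1) / 2)) {0..}" by (rule one)
    fix x :: real assume "x \<in> {0..}"
    have "?f x \<le> exp (- (k - 1) * b\<^sup>2) * exp (- 1 * x\<^sup>2)" if "x \<ge> b"
    proof -
      have "(k - 1) * b\<^sup>2 \<le> (k - 1) * x\<^sup>2" using that b k by (intro mult_left_mono power_mono) auto
      hence "- k * x\<^sup>2 \<le> - (k - 1) * b\<^sup>2 + (- 1 * x\<^sup>2)" by (simp add: algebra_simps)
      thus ?thesis unfolding exp_add[symmetric] by simp
    qed
    thus "?f x - (if x \<in> {0..b} then ?f x else 0) \<le> exp (- (k - 1) * b\<^sup>2) * exp (- 1 * x\<^sup>2)"
      using \<open>x \<in> {0..}\<close> by (cases "x \<le> b") auto
  qed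
  also have "exp (- (k - 1) * b\<^sup>2) = exp (b\<^sup>2) * exp (- k * b\<^sup>2)"
      by (simp add: exp_add[symmetric] algebra_simps)
  finally show "\<bar>integral {-b..b} ?f - sqrt (pi / k)\<bar> \<le> exp (b\<^sup>2) * sqrt pi * exp (- k * b\<^sup>2)"
    unfolding J using t0 by (simp add: mult_ac)
  show "integral {-b..b} ?f \<le> sqrt (pi / k)" unfolding J using t0 by simp
qed

section \<open>The contour segment and its kernel\<close>

definition vline :: "real \<Rightarrow> complex" where "vline v = 1 + \<i> * of_real v"

lemma Re_vline [simp]: "Re (vline v) = 1" by (simp add: vline_def)

lemma not_nonpos: "Re s > 0 \<Longrightarrow> s \<notin> \<real>\<^sub>\<le>\<^sub>0"
  by (auto simp: complex_nonpos_Reals_iff)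

text \<open>Along the segment ds = i dv, so integrating in v divides the increment of the primitive
  by i.\<close>

lemma vline_integral:
  assumes "\<And>s. Re s > 0 \<Longrightarrow> (g has_field_derivative g' s) (at s)"
  shows "((\<lambda>v. g' (vline v)) has_integral (g (1 + \<i>) - g (1 - \<i>)) / \<i>) {-1..1}"
proof -
  have "((\<lambda>v. g (vline v)) has_vector_derivative g' (vline v) * \<i>) (at v within {-1..1})" for v
  proof -
    have "((\<lambda>z. g (1 + \<i> * z)) has_field_derivative g' (1 + \<i> * of_real v) * \<i>) (at (of_real v))"
      by (rule DERIV_chain2[where f = g and g = "\<lambda>z. 1 + \<i> * z"])
         (auto intro!: assms derivative_eq_intros)
    from has_vector_derivative_real_field[OF this] show ?thesis by (simp add: vline_def)
  qed
  from fundamental_theorem_of_calculus[OF _ this]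
  have "((\<lambda>v. g' (vline v) * \<i>) has_integral (g (vline 1) - g (vline (-1)))) {-1..1}" by simp
  moreover have "\<i> * (1 / \<i>) = 1" "vline 1 = 1 + \<i>" "vline (-1) = 1 - \<i>" by (simp_all add: vline_def)
  ultimately show ?thesis using has_integral_mult_left[of _ _ "{-1..1}" "1 / \<i>"]
    by (metis (no_types, lifting) has_integral_cong mult.assoc mult.right_neutral times_divide_eq_right)
qed

definition kern :: "real \<Rightarrow> complex \<Rightarrow> complex" where
  "kern k s = exp (of_real k * (s + 1 / s))"

text \<open>Hankel's integral for \<open>I\<^sub>m(2k)\<close>, truncated to the segment from \<open>1 - \<i>\<close> to \<open>1 + \<i>\<close>, at whose ends the
  kernel has modulus \<open>exp (3k / 2)\<close>.\<close>

definition hankel :: "real \<Rightarrow> real \<Rightarrow> complex" where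
  "hankel m k = integral {-1..1} (\<lambda>v. vline v powr of_real (- m - 1) * kern k (vline v)) / of_real (2 *
      pi)"

lemma kern_deriv: "Re s > 0 \<Longrightarrow> (kern k has_field_derivative kern k s * (of_real k * (1 -
    1 / s ^ 2))) (at s)"
  unfolding kern_def[abs_def] by (auto intro!: derivative_eq_intros simp: power2_eq_square)

lemma powr_kern_continuous: "continuous_on {-1..1} (\<lambda>v. vline v powr p * kern k (vline v))"
proof -
  have "continuous_on {s. Re s > 0} (\<lambda>s. s powr p * kern k s)"
    by (intro continuous_at_imp_continuous_on ballI isCont_mult DERIV_isCont[OF
        has_field_derivative_powr] DERIV_isCont[OF kern_deriv] not_nonpos) auto
  moreover have "continuous_on {-1..1} vline" unfolding vline_def[abs_def] by (intro continuous_intros)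
  ultimately show ?thesis by (rule continuous_on_compose2) auto
qed

lemma hankel_has_integral:
  "((\<lambda>v. vline v powr of_real (- m - 1) * kern k (vline v)) has_integral of_real (2 * pi) *
      hankel m k) {-1..1}"
proof -
  have "(\<lambda>v. vline v powr of_real (- m - 1) * kern k (vline v)) integrable_on {-1..1}"
    by (intro integrable_continuous_interval powr_kern_continuous)
  thus ?thesis by (simp add: hankel_def has_integral_iff)
qed

text \<open>Integration of the derivative of s^(- m) \<open>kern k s\<close>. On Hankel's full
  contour this is the Bessel recurrence; on the segment the two ends leave boundary terms.\<close>

lemma hankel_rec:
  "of_real (2 * pi) * (of_real k * (hankel (m - 1) k - hankel (m + 1) k) - of_real m * hankel m k) =
    ((1 + \<i>) powr of_real (- m) * kern k (1 + \<i>) - (1 - \<i>) powr of_real (- m) * kern k (1 - \<i>)) / \<i>"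
proof -
  let ?g = "\<lambda>s. s powr of_real (- m) * kern k s"
  let ?h = "\<lambda>m s. s powr of_real (- m - 1) * kern k s"
  have "((\<lambda>v. of_real k * (?h (m - 1) (vline v) - ?h (m + 1) (vline v)) -
      of_real m * ?h m (vline v)) has_integral (?g (1 + \<i>) - ?g (1 - \<i>)) / \<i>) {-1..1}"
  proof (rule vline_integral[where g = ?g and g' =
      "\<lambda>s. of_real k * (?h (m - 1) s - ?h (m + 1) s) - of_real m * ?h m s"])
    fix s :: complex assume s: "Re s > 0"
    hence s0: "s \<noteq> 0" by auto
    have p: "s powr of_real (- (m + 1) - 1) = s powr of_real (- m) / s ^ 2"
    proof -
      have "complex_of_real (- (m + 1) - 1) = of_real (- m) - of_nat 2" by simp
      thus ?thesis using s0 by (simp only: powr_diff powr_nat') (auto simp: s0)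
    qed
    have p': "s powr of_real (- (m - 1) - 1) = s powr of_real (- m)" by simp
    have "(?g has_field_derivative s powr of_real (- m) * (kern k s * (of_real k * (1 - 1 / s ^ 2))) +
        of_real (- m) * s powr (of_real (- m) - 1) * kern k s) (at s)"
      by (rule DERIV_mult'[OF has_field_derivative_powr[OF not_nonpos[OF s]] kern_deriv[OF s]])
    also have "s powr of_real (- m) * (kern k s * (of_real k * (1 - 1 / s ^ 2))) +
        of_real (- m) * s powr (of_real (- m) - 1) * kern k s
       = of_real k * (?h (m - 1) s - ?h (m + 1) s) - of_real m * ?h m s"
      unfolding p p' by (simp add: algebra_simps)
    finally show "(?g has_field_derivative of_real k * (?h (m - 1) s - ?h (m + 1) s) -
        of_real m * ?h m s) (at s)" .
  qed
  moreover have "((\<lambda>v. of_real k * (?h (m - 1) (vline v) - ?h (m + 1) (vline v)) -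
      of_real m * ?h m (vline v)) has_integral
     of_real k * (of_real (2 * pi) * hankel (m - 1) k - of_real (2 * pi) * hankel (m + 1) k) - of_real m
         * (of_real (2 * pi) * hankel m k)) {-1..1}"
    by (intro has_integral_diff has_integral_mult_right hankel_has_integral)
  ultimately have "of_real k * (of_real (2 * pi) * hankel (m - 1) k - of_real (2 * pi) * hankel (m +
      1) k) - of_real m * (of_real (2 * pi) * hankel m k) = (?g (1 + \<i>) - ?g (1 - \<i>)) / \<i>"
    by (rule has_integral_unique[rotated])
  thus ?thesis by (simp add: algebra_simps)
qed

text \<open>At s = 1 + i and s = 1 - i the real part of s + 1/s is 1 + 1/2.\<close>

lemma norm_kern: "norm (kern k (1 + \<i>)) = exp (3 * k / 2)" "norm (kern k (1 - \<i>)) = exp (3 * k / 2)"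
  by (simp_all add: kern_def Re_divide power2_eq_square)

text \<open>For half-integral \<open>m\<close>, the functions \<open>I\<^sub>m(2k)\<close> and \<open>I\<^sub>-\<^sub>m(2k)\<close> differ
    by a multiple of \<open>K\<^sub>m(2k)\<close>, which is
  exponentially small; the negated order is the one in the theorem.\<close>

definition near :: "real \<Rightarrow> bool" where
  "near m \<longleftrightarrow> (\<exists>C\<ge>0. \<forall>k\<ge>1. norm (hankel m k - of_real (bessel_I (- m) (2 * k))) \<le> C * exp (3 * k / 2))"

section \<open>Propagation of the comparison along the recurrence\<close>

text \<open>Under m \<mapsto> - m both sides of the Bessel recurrence change sign, so I of order - m
  obeys the recurrence of the Hankel integrals in m. The differences satisfy it up to boundary
  terms.\<close>

lemma hankel_bessel_rec:
  "\<exists>C\<ge>0. \<forall>k\<ge>1. norm ((hankel (m - 1) k - of_real (bessel_I (- (m - 1)) (2 * k))) - (hankel (m + 1) k -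
      of_real (bessel_I (- (m + 1)) (2 * k)))
     - of_real (m / k) * (hankel m k - of_real (bessel_I (- m) (2 * k)))) \<le> C * exp (3 * k / 2)"
proof -
  define C where "C = norm ((1 + \<i>) powr of_real (- m)) + norm ((1 - \<i>) powr of_real (- m))"
  show ?thesis
  proof (intro exI[of _ C] conjI allI impI)
    fix k :: real assume k: "k \<ge> 1"
    have e: "- (m - 1) = - m + 1" "- (m + 1) = - m - 1" by simp_all
    have c: "2 * (- m) / (2 * k) = - (m / k)" using k by simp
    have b: "bessel_I (- (m - 1)) (2 * k) - bessel_I (- (m + 1)) (2 * k) =
        m / k * bessel_I (- m) (2 * k)"
    proof -
      have "bessel_I (- (m - 1)) (2 * k) - bessel_I (- (m + 1)) (2 * k) = - (bessel_I (- m - 1) (2 * k) -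
          bessel_I (- m + 1) (2 * k))"
        unfolding e by (rule minus_diff_eq[symmetric])
      also have "\<dots> = - (2 * (- m) / (2 * k) * bessel_I (- m) (2 * k))"
        using k by (subst bessel_I_rec) (auto simp: mult.assoc)
      also have "\<dots> = m / k * bessel_I (- m) (2 * k)" unfolding c by simp
      finally show ?thesis .
    qed
    let ?B = "((1 + \<i>) powr of_real (- m) * kern k (1 + \<i>) - (1 - \<i>) powr of_real (- m) * kern k (1 -
        \<i>)) / \<i>"
    have h: "hankel (m - 1) k - hankel (m + 1) k - of_real (m / k) * hankel m k =
        ?B / of_real (2 * pi * k)"
      unfolding hankel_rec[symmetric] using k by (simp add: field_simps)
    have "(hankel (m - 1) k - of_real (bessel_I (- (m - 1)) (2 * k))) - (hankel (m + 1) k -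
        of_real (bessel_I (- (m + 1)) (2 * k)))
     - of_real (m / k) * (hankel m k - of_real (bessel_I (- m) (2 * k))) =
       (hankel (m - 1) k - hankel (m + 1) k - of_real (m / k) * hankel m k) - of_real (bessel_I (- (m -
           1)) (2 * k) - bessel_I (- (m + 1)) (2 * k) - m / k * bessel_I (- m) (2 * k))"
      by (simp add: algebra_simps)
    also have "\<dots> = ?B / of_real (2 * pi * k)" unfolding h b by simp
    also have "norm \<dots> \<le> (C * exp (3 * k / 2)) / 1"
    proof -
      have "norm ?B \<le> C * exp (3 * k / 2)"
      proof -
        let ?X = "(1 + \<i>) powr of_real (- m) * kern k (1 + \<i>)" and ?Y =
            "(1 - \<i>) powr of_real (- m) * kern k (1 - \<i>)"
        have "norm ?B = norm (?X - ?Y)" by (simp only: norm_divide norm_ii div_by_1)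
        also have "\<dots> \<le> norm ?X + norm ?Y" by (rule norm_triangle_ineq4)
        also have "\<dots> = C * exp (3 * k / 2)" by (simp only: norm_mult norm_kern C_def distrib_right)
        finally show ?thesis .
      qed
      moreover have "1 \<le> 2 * pi * k" using k pi_gt3 mult_mono[of 1 "2 * pi" 1 k] by simp
      ultimately show ?thesis unfolding norm_divide[of ?B] norm_of_real using k
          by (intro frac_le) (auto simp: C_def abs_mult)
    qed
    finally show "norm ((hankel (m - 1) k - of_real (bessel_I (- (m - 1)) (2 * k))) - (hankel (m + 1) k -
        of_real (bessel_I (- (m + 1)) (2 * k)))
     - of_real (m / k) * (hankel m k - of_real (bessel_I (- m) (2 * k)))) \<le> C * exp (3 * k / 2)" by simp
  qed (simp add: C_def)
qed

text \<open>For k \<ge> 1 the coefficient m / k is bounded, so closeness at the middle order lets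
  closeness pass between the outer orders in both directions.\<close>

lemma near_step:
  assumes "near m"
  shows "near (m + 1) \<longleftrightarrow> near (m - 1)"
proof -
  define e where "e = (\<lambda>m k. hankel m k - of_real (bessel_I (- m) (2 * k)))"
  obtain A where A: "A \<ge> 0" "\<And>k. k \<ge> 1 \<Longrightarrow> norm (e m k) \<le> A * exp (3 * k / 2)" using assms
      by (auto simp: near_def e_def)
  obtain C where C: "C \<ge> 0" "\<And>k. k \<ge> 1 \<Longrightarrow> norm (e (m - 1) k - e (m + 1) k - of_real (m / k) * e m k) \<le>
      C * exp (3 * k / 2)"
    using hankel_bessel_rec[of m] by (auto simp: e_def)
  have mk: "norm (of_real (m / k) * e m k) \<le> \<bar>m\<bar> * A * exp (3 * k / 2)" if k: "k \<ge> 1" for k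
  proof -
    have "norm (of_real (m / k) * e m k) = \<bar>m\<bar> / k * norm (e m k)" using k
        by (simp add: norm_mult norm_divide)
    also have "\<dots> \<le> \<bar>m\<bar> / 1 * (A * exp (3 * k / 2))" using k by (intro mult_mono A frac_le) auto
    finally show ?thesis by simp
  qed
  have d: "norm (e (m - 1) k - e (m + 1) k) \<le> (C + \<bar>m\<bar> * A) * exp (3 * k / 2)" if k: "k \<ge> 1" for k
    using norm_triangle_ineq[of "e (m - 1) k - e (m + 1) k - of_real (m / k) * e m k"
        "of_real (m / k) * e m k"] C(2)[OF k] mk[OF k]
    by (simp add: distrib_right)
  show ?thesis
  proof
    assume "near (m + 1)"
    then obtain D where D: "D \<ge> 0" "\<And>k. k \<ge> 1 \<Longrightarrow> norm (e (m + 1) k) \<le> D * exp (3 * k / 2)"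
        by (auto simp: near_def e_def)
    have "norm (e (m - 1) k) \<le> (C + \<bar>m\<bar> * A + D) * exp (3 * k / 2)" if k: "k \<ge> 1" for k
      using norm_triangle_ineq[of "e (m - 1) k - e (m + 1) k" "e (m + 1) k"] d[OF k] D(2)[OF k]
          by (simp add: distrib_right)
    thus "near (m - 1)" unfolding near_def e_def using A C D by (intro exI[of _ "C + \<bar>m\<bar> * A + D"]) auto
  next
    assume "near (m - 1)"
    then obtain D where D: "D \<ge> 0" "\<And>k. k \<ge> 1 \<Longrightarrow> norm (e (m - 1) k) \<le> D * exp (3 * k / 2)"
        by (auto simp: near_def e_def)
    have "norm (e (m + 1) k) \<le> (C + \<bar>m\<bar> * A + D) * exp (3 * k / 2)" if k: "k \<ge> 1" for k
      using norm_triangle_ineq4[of "e (m - 1) k" "e (m - 1) k - e (m + 1) k"] d[OF k] D(2)[OF k]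
          by (simp add: distrib_right)
    thus "near (m + 1)" unfolding near_def e_def using A C D by (intro exI[of _ "C + \<bar>m\<bar> * A + D"]) auto
  qed
qed

section \<open>The orders 1/2 and -1/2\<close>

lemma gauss_primitive:
  obtains E where "\<And>z. (E has_field_derivative exp (of_real k * z ^ 2)) (at (z :: complex))" "E 0 = 0"
proof -
  have "(\<lambda>z. exp (of_real k * z ^ 2)) holomorphic_on UNIV" by (intro holomorphic_intros)
  then obtain g where g: "\<And>z. (g has_field_derivative exp (of_real k * z ^ 2)) (at (z :: complex))"
    using holomorphic_convex_primitive'[of UNIV "\<lambda>z. exp (of_real k * z ^ 2)"] by auto
  show ?thesis
    by (rule that[of "\<lambda>z. g z - g 0"]) (use DERIV_diff[OF g DERIV_const] in auto)
qed

lemma hankel_half_sum: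
  "hankel (- (1 / 2)) k + of_real c * hankel (1 / 2) k =
    integral {-1..1} (\<lambda>v. (vline v powr of_real (- (1 / 2)) + of_real c * vline v powr of_real (- (3 /
        2))) * kern k (vline v)) / of_real (2 * pi)"
proof -
  have "((\<lambda>v. vline v powr of_real (- (- (1 / 2)) - 1) * kern k (vline v) +
      of_real c * (vline v powr of_real (- (1 / 2) - 1) * kern k (vline v))) has_integral
    of_real (2 * pi) * hankel (- (1 / 2)) k + of_real c * (of_real (2 * pi) * hankel (1 / 2) k)) {-1..1}"
    by (intro has_integral_add has_integral_mult_right hankel_has_integral)
  moreover have "- (- (1 / 2)) - 1 = - (1 / 2 :: real)" "- (1 / 2) - 1 = - (3 / 2 :: real)" by simp_all
  ultimately have "((\<lambda>v. (vline v powr of_real (- (1 / 2)) + of_real c * vline v powr of_real (- (3 /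
      2))) * kern k (vline v)) has_integral
    of_real (2 * pi) * hankel (- (1 / 2)) k + of_real c * (of_real (2 * pi) * hankel (1 / 2) k)) {-1..1}"
    by (simp only: distrib_right mult.assoc)
  from integral_unique[OF this] show ?thesis by (simp add: add_divide_distrib)
qed

text \<open>The substitution \<open>u = s\<^sup>1\<^sup>/\<^sup>2 \<mp> s\<^sup>-\<^sup>1\<^sup>/\<^sup>2\<close> turns the exponent \<open>s + 1 / s\<close> into \<open>u\<^sup>2 \<plusminus> 2\<close>.\<close>

lemma hankel_half_primitive:
  assumes E: "\<And>z. (E has_field_derivative exp (of_real k * z ^ 2)) (at (z :: complex))" and c:
      "c = 1 \<or> c = -1"
  defines "u \<equiv> \<lambda>s. csqrt s - of_real c / csqrt s"
  shows "hankel (- (1 / 2)) k + of_real c * hankel (1 / 2) k =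
     exp (2 * of_real (c * k)) * (E (u (1 + \<i>)) - E (u (1 - \<i>))) / (\<i> * of_real pi)"
proof -
  have "((\<lambda>v. (vline v powr of_real (- (1 / 2)) + of_real c * vline v powr of_real (- (3 / 2))) *
      kern k (vline v)) has_integral
     (2 * exp (2 * of_real (c * k)) * E (u (1 + \<i>)) - 2 * exp (2 * of_real (c * k)) * E (u (1 - \<i>))) / \<i>)
         {-1..1}"
  proof (rule vline_integral[where g = "\<lambda>s. 2 * exp (2 * of_real (c * k)) * E (u s)" and g' =
      "\<lambda>s. (s powr of_real (- (1 / 2)) + of_real c * s powr of_real (- (3 / 2))) * kern k s"])
    fix s :: complex assume s: "Re s > 0"
    have s0: "s \<noteq> 0" using s by auto
    define r where "r = csqrt s"
    have r: "r ^ 2 = s" "r \<noteq> 0" using s0 by (simp_all add: r_def)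
    have p1: "s powr of_real (- (1 / 2)) = 1 / r"
      using s0 by (simp add: powr_minus r_def csqrt_conv_powr inverse_eq_divide)
    have p3: "s powr of_real (- (3 / 2)) = 1 / (r * s)"
    proof -
      have "complex_of_real (- (3 / 2)) = of_real (- (1 / 2)) - 1" by simp
      thus ?thesis using s0 p1 by (simp only: powr_diff) simp
    qed
    have dr: "(csqrt has_field_derivative 1 / (2 * r)) (at s)"
      using has_field_derivative_csqrt[OF not_nonpos[OF s]] by (simp add: r_def field_simps)
    \<comment> \<open>The powers in the integrand combine to 2 du/ds; for this reason the sum and
      the difference of the two orders are treated rather than each order alone.\<close>
    have du: "(u has_field_derivative (1 / r + of_real c / (r * s)) / 2) (at s)"
    proof -
      have "(u has_field_derivative 1 / (2 * r) - (0 * csqrt s - of_real c * (1 / (2 * r))) / (csqrt s *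
          csqrt s)) (at s)"
        unfolding u_def using r(2) by (intro DERIV_diff dr DERIV_divide DERIV_const) (simp add: r_def)
      also have "1 / (2 * r) - (0 * csqrt s - of_real c * (1 / (2 * r))) / (csqrt s * csqrt s) =
          (1 / r + of_real c / (r * s)) / 2"
        unfolding r_def[symmetric] unfolding r(1)[symmetric] using r(2)
            by (simp add: field_simps power2_eq_square)
      finally show ?thesis .
    qed
    have usq: "u s ^ 2 = s + 1 / s - 2 * of_real c"
      unfolding u_def r_def[symmetric] unfolding r(1)[symmetric] using r(2) c
          by (auto simp: field_simps power2_eq_square)
    have "((\<lambda>s. E (u s)) has_field_derivative exp (of_real k * u s ^ 2) * ((1 / r +
        of_real c / (r * s)) / 2)) (at s)"
      by (rule DERIV_chain2[OF E du])
    from DERIV_cmult[OF this, of "2 * exp (2 * of_real (c * k))"]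
    have "((\<lambda>s. 2 * exp (2 * of_real (c * k)) * E (u s)) has_field_derivative (1 / r +
        of_real c / (r * s)) * (exp (2 * of_real (c * k)) * exp (of_real k * u s ^ 2))) (at s)"
      by (simp add: mult_ac)
    also have "exp (2 * of_real (c * k)) * exp (of_real k * u s ^ 2) = kern k s"
      unfolding usq kern_def exp_add[symmetric] by (simp add: algebra_simps)
    finally show "((\<lambda>s. 2 * exp (2 * of_real (c * k)) *
        E (u s)) has_field_derivative (s powr of_real (- (1 / 2)) + of_real c * s powr of_real (- (3 /
        2))) * kern k s) (at s)"
      unfolding p1 p3 by simp
  qed
  note I = integral_unique[OF this]
  show ?thesis unfolding hankel_half_sum I by (simp add: field_simps)
qed

lemma csqrt_facts:
  defines "r \<equiv> csqrt (1 + \<i>)"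
  shows "csqrt (1 - \<i>) = cnj r" "r ^ 2 = 1 + \<i>" "Im r > 0" "r \<noteq> 0" "Im (1 / r) < 0"
proof -
  show r2: "r ^ 2 = 1 + \<i>" by (simp add: r_def)
  show r0: "r \<noteq> 0" using r2 by (auto simp: complex_eq_iff)
  have Re: "Re r \<ge> 0" unfolding r_def using csqrt_principal[of "1 + \<i>"] by (auto simp: complex_eq_iff)
  have "2 * Re r * Im r = 1" using arg_cong[OF r2, of Im] by (simp add: power2_eq_square mult_ac)
  thus Im: "Im r > 0" using Re by (metis mult_le_0_iff mult_nonneg_nonpos not_le zero_less_one order.asym
      mult_2 add_nonneg_nonneg)
  have "(Re r)\<^sup>2 + (Im r)\<^sup>2 > 0" using Im by (simp add: sum_power2_gt_zero_iff)
  thus "Im (1 / r) < 0" using Im by (simp add: Im_divide divide_neg_pos)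
  show "csqrt (1 - \<i>) = cnj r"
    unfolding r_def by (subst cnj_csqrt) (auto simp: complex_nonpos_Reals_iff)
qed

text \<open>The integral of exp(k z^2) from the conjugate of u to u is moved to the imaginary axis.
  There it is a Gaussian with mass near sqrt(pi / k), the Bessel value; the two horizontal
  connections and the Gaussian tail are O(exp(- k / 2)), because Re u^2 = - 1/2. The prefactor exp(2
  k) makes the error exp(3 k / 2).\<close>

lemma near_half_sum:
  "\<exists>C\<ge>0. \<forall>k\<ge>1. norm ((hankel (- (1 / 2)) k + hankel (1 / 2) k) - of_real (bessel_I (1 / 2) (2 * k) +
      bessel_I (- (1 / 2)) (2 * k))) \<le> C * exp (3 * k / 2)"
proof -
  define r where "r = csqrt (1 + \<i>)"
  note r = csqrt_facts[folded r_def]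
  define u where "u = r - 1 / r"
  define a b where "a = Re u" and "b = Im u"
  have b: "b > 0" using r by (simp add: b_def u_def)
  have "u ^ 2 = r ^ 2 + 1 / r ^ 2 - 2" using r(4) by (simp add: u_def field_simps power2_eq_square)
  also have "\<dots> = - 1 / 2 + \<i> / 2" unfolding r(2)
      by (simp add: complex_eq_iff Re_divide Im_divide power2_eq_square)
  finally have u2: "u ^ 2 = - 1 / 2 + \<i> / 2" .
  have ab: "a\<^sup>2 - b\<^sup>2 = - 1 / 2" using arg_cong[OF u2, of Re] by (simp add: a_def b_def power2_eq_square)
  have u_eq: "u = Complex a b" by (simp add: a_def b_def)
  define C where "C = (exp (b\<^sup>2) * sqrt pi + 2 * \<bar>a\<bar>) / pi"
  show ?thesis
  proof (intro exI[of _ C] conjI allI impI)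
    fix k :: real assume k: "k \<ge> 1"
    obtain E where E: "\<And>z. (E has_field_derivative exp (of_real k * z ^ 2)) (at (z :: complex))"
        "E 0 = 0"
      using gauss_primitive by blast
    have h: "hankel (- (1 / 2)) k + hankel (1 / 2) k = exp (2 * of_real k) * (E (Complex a b) -
        E (Complex a (- b))) / (\<i> * of_real pi)"
    proof -
      have "csqrt (1 - \<i>) - 1 / csqrt (1 - \<i>) = cnj u" unfolding r(1) u_def by simp
      also have "\<dots> = Complex a (- b)" by (simp add: u_eq complex_eq_iff)
      finally show ?thesis using hankel_half_primitive[OF E(1), of 1] u_eq by (simp add: r_def u_def)
    qed
    \<comment> \<open>Along the connection Re z^2 = t^2 a^2 - b^2 is largest at the end, where it is
      a^2 - b^2 = - 1/2.\<close>
    have horiz: "norm (E (Complex a y) - E (Complex 0 y)) \<le> \<bar>a\<bar> * exp (- k / 2)" if "y\<^sup>2 = b\<^sup>2" for y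
    proof -
      have "norm (E (Complex a y) - E (Complex 0 y)) \<le> exp (- k / 2) * norm (Complex a y - Complex 0 y)"
      proof (rule field_differentiable_bound[of "closed_segment (Complex 0 y) (Complex a y)"])
        fix z assume z: "z \<in> closed_segment (Complex 0 y) (Complex a y)"
        show "(E has_field_derivative exp (of_real k *
            z ^ 2)) (at z within closed_segment (Complex 0 y) (Complex a y))"
          by (rule has_field_derivative_at_within[OF E(1)])
        obtain t where t: "0 \<le> t" "t \<le> 1" "z = (1 - t) *\<^sub>R Complex 0 y + t *\<^sub>R Complex a y"
          using z unfolding closed_segment_def by auto
        have "Re z = t * a" "Im z = y" by (simp_all add: t(3) algebra_simps)
        hence "Re (z ^ 2) = t\<^sup>2 * a\<^sup>2 - b\<^sup>2" using that by (simp add: power2_eq_square mult_ac)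
        also have "\<dots> \<le> 1 * a\<^sup>2 - b\<^sup>2" using t by (intro diff_right_mono mult_right_mono) (auto simp:
            power_le_one)
        finally have "Re (z ^ 2) \<le> - 1 / 2" using ab by simp
        hence "k * Re (z ^ 2) \<le> k * (- 1 / 2)" using k by (intro mult_left_mono) auto
        thus "norm (exp (of_real k * z ^ 2)) \<le> exp (- k / 2)" by simp
      qed auto
      also have "Complex a y - Complex 0 y = of_real a" by (simp add: complex_eq_iff)
      finally show ?thesis by (simp add: mult.commute)
    qed
    \<comment> \<open>With z = i y the integrand becomes the real Gaussian; this piece carries the
      main term.\<close>
    have vert: "E (Complex 0 b) - E (Complex 0 (- b)) =
        \<i> * of_real (integral {-b..b} (\<lambda>y. exp (- k * y\<^sup>2)))"
    proof -
      have "((\<lambda>y. E (\<i> * of_real y)) has_vector_derivative exp (of_real k * (\<i> * of_real y) ^ 2) *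
          \<i>) (at y within {-b..b})" for y
        by (rule has_vector_derivative_real_field[where f = "\<lambda>z. E (\<i> * z)"], rule DERIV_chain2[OF E(1)])
           (auto intro!: derivative_eq_intros)
      from fundamental_theorem_of_calculus[OF _ this] b
      have "((\<lambda>y. exp (of_real k * (\<i> * of_real y) ^ 2) * \<i>) has_integral (E (\<i> * of_real b) -
          E (\<i> * of_real (- b)))) {-b..b}" by simp
      moreover have "(\<lambda>y. exp (of_real k * (\<i> * of_real y) ^ 2) * \<i>) =
          (\<lambda>y. \<i> * of_real (exp (- k * y\<^sup>2)))"
        by (simp add: fun_eq_iff power_mult_distrib exp_of_real[symmetric] mult.commute)
      moreover have "((\<lambda>y. \<i> * of_real (exp (- k * y\<^sup>2))) has_integral (\<i> *
          of_real (integral {-b..b} (\<lambda>y. exp (- k * y\<^sup>2))))) {-b..b}"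
        by (intro has_integral_mult_right has_integral_of_real integrable_integral
            integrable_continuous_interval continuous_intros)
      ultimately have "E (\<i> * of_real b) - E (\<i> * of_real (- b)) =
          \<i> * of_real (integral {-b..b} (\<lambda>y. exp (- k * y\<^sup>2)))"
        using has_integral_unique by metis
      moreover have "\<i> * of_real b = Complex 0 b" "\<i> * of_real (- b) = Complex 0 (- b)"
          by (simp_all add: complex_eq_iff)
      ultimately show ?thesis by simp
    qed
    define D where "D = (E (Complex a b) - E (Complex 0 b)) - (E (Complex a (- b)) -
        E (Complex 0 (- b)))"
    define I where "I = integral {-b..b} (\<lambda>y. exp (- k * y\<^sup>2))"
    have D: "norm D \<le> 2 * \<bar>a\<bar> * exp (- k / 2)"
      unfolding D_def using norm_triangle_ineq4[of "E (Complex a b) - E (Complex 0 b)"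
          "E (Complex a (- b)) - E (Complex 0 (- b))"] horiz[of b] horiz[of "- b"] by simp
    have I: "\<bar>I - sqrt (pi / k)\<bar> \<le> exp (b\<^sup>2) * sqrt pi * exp (- k / 2)"
    proof -
      have "\<bar>I - sqrt (pi / k)\<bar> \<le> exp (b\<^sup>2) * sqrt pi * exp (- k * b\<^sup>2)"
        unfolding I_def using gauss_truncated(1)[OF k, of b] b by simp
      also have "\<dots> \<le> exp (b\<^sup>2) * sqrt pi * exp (- k / 2)"
      proof -
        have "b\<^sup>2 \<ge> 1 / 2" using ab zero_le_power2[of a] by linarith
        hence "k * (1 / 2) \<le> k * b\<^sup>2" using k by (intro mult_left_mono) auto
        thus ?thesis by (intro mult_left_mono) auto
      qed
      finally show ?thesis .
    qed
    have bes: "bessel_I (1 / 2) (2 * k) + bessel_I (- (1 / 2)) (2 * k) =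
        exp (2 * k) * sqrt (pi / k) / pi"
    proof -
      have "bessel_I (1 / 2) (2 * k) + bessel_I (- (1 / 2)) (2 * k) = exp (2 * k) / sqrt (pi * k)"
        using bessel_I_half[of "2 * k"] k by (simp add: sinh_def cosh_def field_simps)
      also have "1 / sqrt (pi * k) = sqrt (pi / k) / pi"
        using k by (simp add: real_sqrt_mult real_sqrt_divide field_simps)
      hence "exp (2 * k) / sqrt (pi * k) = exp (2 * k) * sqrt (pi / k) / pi"
          by (metis times_divide_eq_right mult.right_neutral)
      finally show ?thesis .
    qed
    have "(hankel (- (1 / 2)) k + hankel (1 / 2) k) - of_real (bessel_I (1 / 2) (2 * k) +
        bessel_I (- (1 / 2)) (2 * k))
       = of_real (exp (2 * k) / pi) * (of_real (I - sqrt (pi / k)) + D / \<i>)"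
    proof -
      have "E (Complex a b) - E (Complex a (- b)) = \<i> * of_real I + D" using vert
          by (simp add: D_def I_def algebra_simps)
      thus ?thesis unfolding h bes by (simp add: field_simps exp_of_real[symmetric])
    qed
    also have "norm \<dots> \<le> exp (2 * k) / pi * (exp (b\<^sup>2) * sqrt pi * exp (- k / 2) +
        2 * \<bar>a\<bar> * exp (- k / 2))"
    proof -
      have "norm (complex_of_real (I - sqrt (pi / k)) + D / \<i>) \<le> norm (complex_of_real (I -
          sqrt (pi / k))) + norm (D / \<i>)"
        by (rule norm_triangle_ineq)
      also have "\<dots> = \<bar>I - sqrt (pi / k)\<bar> + norm D"
          by (simp only: norm_of_real norm_divide norm_ii div_by_1)
      finally have "norm (complex_of_real (I - sqrt (pi / k)) + D / \<i>) \<le>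
          exp (b\<^sup>2) * sqrt pi * exp (- k / 2) + 2 * \<bar>a\<bar> * exp (- k / 2)"
        using I D by linarith
      moreover have "norm (complex_of_real (exp (2 * k) / pi)) = exp (2 * k) / pi"
          by (simp only: norm_of_real) simp
      ultimately show ?thesis unfolding norm_mult
          by (simp only: mult_left_mono exp_ge_zero pi_ge_zero divide_nonneg_nonneg)
    qed
    also have "\<dots> = C * (exp (2 * k) * exp (- k / 2))" by (simp add: C_def field_simps)
    also have "exp (2 * k) * exp (- k / 2) = exp (3 * k / 2)" by (simp add: exp_add[symmetric])
    finally show "norm ((hankel (- (1 / 2)) k + hankel (1 / 2) k) - of_real (bessel_I (1 / 2) (2 * k) +
        bessel_I (- (1 / 2)) (2 * k))) \<le> C * exp (3 * k / 2)" .
  qed (simp add: C_def)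
qed

text \<open>In this combination everything is error: the Bessel difference is - exp(- 2 k) / sqrt(pi
  k), and the prefactor exp(- 2 k) brings the integral, of size exp(7 k / 2) since Re u^2 = 7/2,
  down to exp(3 k / 2).\<close>

lemma near_half_diff:
  "\<exists>C\<ge>0. \<forall>k\<ge>1. norm ((hankel (- (1 / 2)) k - hankel (1 / 2) k) - of_real (bessel_I (1 / 2) (2 * k) -
      bessel_I (- (1 / 2)) (2 * k))) \<le> C * exp (3 * k / 2)"
proof -
  define r where "r = csqrt (1 + \<i>)"
  note r = csqrt_facts[folded r_def]
  define u where "u = r + 1 / r"
  have "u ^ 2 = r ^ 2 + 1 / r ^ 2 + 2" using r(4) by (simp add: u_def field_simps power2_eq_square)
  also have "\<dots> = 7 / 2 + \<i> / 2" unfolding r(2) by (simp add: complex_eq_iff Re_divide Im_divide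
      power2_eq_square)
  finally have u2: "u ^ 2 = 7 / 2 + \<i> / 2" .
  define C where "C = 2 * norm u / pi + 1"
  show ?thesis
  proof (intro exI[of _ C] conjI allI impI)
    fix k :: real assume k: "k \<ge> 1"
    obtain E where E: "\<And>z. (E has_field_derivative exp (of_real k * z ^ 2)) (at (z :: complex))"
        "E 0 = 0"
      using gauss_primitive by blast
    have h: "hankel (- (1 / 2)) k - hankel (1 / 2) k = exp (- 2 * of_real k) * (E u -
        E (cnj u)) / (\<i> * of_real pi)"
    proof -
      have "csqrt (1 - \<i>) + 1 / csqrt (1 - \<i>) = cnj u" unfolding r(1) u_def by simp
      thus ?thesis using hankel_half_primitive[OF E(1), of "-1"] by (simp add: r_def u_def)
    qed
    have bound: "norm (E w) \<le> norm w * exp (7 * k / 2)" if w: "Re (w ^ 2) = 7 / 2" for w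
    proof -
      have "norm (E w - E 0) \<le> exp (7 * k / 2) * norm (w - 0)"
      proof (rule field_differentiable_bound[of "closed_segment 0 w"])
        fix z assume z: "z \<in> closed_segment 0 w"
        show "(E has_field_derivative exp (of_real k * z ^ 2)) (at z within closed_segment 0 w)"
          by (rule has_field_derivative_at_within[OF E(1)])
        obtain t where t: "0 \<le> t" "t \<le> 1" "z = t *\<^sub>R w"
          using z unfolding closed_segment_def by auto
        have "z ^ 2 = of_real (t ^ 2) * w ^ 2" by (simp add: t(3) scaleR_conv_of_real power_mult_distrib)
        hence "Re (z ^ 2) = t ^ 2 * (7 / 2)" by (simp only: Re_complex_of_real Im_complex_of_real
            times_complex.sel w mult_zero_left diff_zero)
        also have "\<dots> \<le> 1 * (7 / 2)" using t by (intro mult_right_mono) (auto simp: power_le_one)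
        finally have "k * Re (z ^ 2) \<le> k * (7 / 2)" using k by (intro mult_left_mono) auto
        thus "norm (exp (of_real k * z ^ 2)) \<le> exp (7 * k / 2)" by (simp add: mult.commute)
      qed auto
      thus ?thesis by (simp add: E(2) mult.commute)
    qed
    have ru: "Re (u ^ 2) = 7 / 2" "Re ((cnj u) ^ 2) = 7 / 2" using u2
        by (simp_all flip: complex_cnj_power)
    have "norm (E u - E (cnj u)) \<le> norm (E u) + norm (E (cnj u))" by (rule norm_triangle_ineq4)
    also have "\<dots> \<le> norm u * exp (7 * k / 2) + norm (cnj u) * exp (7 * k / 2)"
        by (intro add_mono bound ru)
    finally have EE: "norm (E u - E (cnj u)) \<le> 2 * norm u * exp (7 * k / 2)" by simp
    have "norm (hankel (- (1 / 2)) k - hankel (1 / 2) k) = exp (- 2 * k) * norm (E u - E (cnj u)) / pi"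
      unfolding h by (simp add: norm_divide norm_mult)
    also have "\<dots> \<le> exp (- 2 * k) * (2 * norm u * exp (7 * k / 2)) / pi"
      using EE by (intro divide_right_mono mult_left_mono) auto
    also have "\<dots> = 2 * norm u / pi * (exp (- 2 * k) * exp (7 * k / 2))" by simp
    also have "exp (- 2 * k) * exp (7 * k / 2) = exp (3 * k / 2)" by (simp add: exp_add[symmetric])
    finally have H: "norm (hankel (- (1 / 2)) k - hankel (1 / 2) k) \<le> 2 * norm u / pi * exp (3 * k / 2)"
        .
    have "bessel_I (1 / 2) (2 * k) - bessel_I (- (1 / 2)) (2 * k) = - (exp (- 2 * k) / sqrt (pi * k))"
      using bessel_I_half[of "2 * k"] k by (simp add: sinh_def cosh_def field_simps)
    moreover have "exp (- 2 * k) / sqrt (pi * k) \<le> exp (3 * k / 2) / 1"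
      using k pi_gt3 mult_mono[of 1 pi 1 k] by (intro frac_le) auto
    ultimately have B: "norm (complex_of_real (bessel_I (1 / 2) (2 * k) -
        bessel_I (- (1 / 2)) (2 * k))) \<le> exp (3 * k / 2)"
      using k by (simp only: norm_of_real) simp
    have "norm ((hankel (- (1 / 2)) k - hankel (1 / 2) k) - of_real (bessel_I (1 / 2) (2 * k) -
        bessel_I (- (1 / 2)) (2 * k))) \<le>
      2 * norm u / pi * exp (3 * k / 2) + exp (3 * k / 2)"
      by (rule order_trans[OF norm_triangle_ineq4 add_mono[OF H B]])
    thus "norm ((hankel (- (1 / 2)) k - hankel (1 / 2) k) - of_real (bessel_I (1 / 2) (2 * k) -
        bessel_I (- (1 / 2)) (2 * k))) \<le> C * exp (3 * k / 2)"
      by (simp add: C_def distrib_right)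
  qed (simp add: C_def)
qed

text \<open>Half the sum and half the difference of the two combinations isolate each order. The
  signs match because \<open>near\<close> pairs the Hankel integral of order m with the Bessel
  function of order - m.\<close>

lemma near_base: "near (- (1 / 2))" "near (1 / 2)"
proof -
  define e where "e = (\<lambda>m k. hankel m k - of_real (bessel_I (- m) (2 * k)))"
  obtain A where A: "A \<ge> 0" "\<And>k. k \<ge> 1 \<Longrightarrow> norm (e (- (1 / 2)) k + e (1 / 2) k) \<le> A * exp (3 * k / 2)"
    using near_half_sum by (auto simp: e_def algebra_simps)
  obtain B where B: "B \<ge> 0" "\<And>k. k \<ge> 1 \<Longrightarrow> norm (e (- (1 / 2)) k - e (1 / 2) k) \<le> B * exp (3 * k / 2)"
    using near_half_diff by (auto simp: e_def algebra_simps)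
  have "norm (e (- (1 / 2)) k) \<le> (A + B) / 2 * exp (3 * k / 2)"
      "norm (e (1 / 2) k) \<le> (A + B) / 2 * exp (3 * k / 2)" if k: "k \<ge> 1" for k
  proof -
    let ?x = "e (- (1 / 2)) k" and ?y = "e (1 / 2) k"
    have "norm (2 * ?x) \<le> norm (?x + ?y) + norm (?x - ?y)"
        using norm_triangle_ineq[of "?x + ?y" "?x - ?y"] by simp
    thus "norm ?x \<le> (A + B) / 2 * exp (3 * k / 2)" using A(2)[OF k] B(2)[OF k]
        by (simp add: norm_mult field_simps)
    have "norm (2 * ?y) \<le> norm (?x + ?y) + norm (?x - ?y)"
        using norm_triangle_ineq4[of "?x + ?y" "?x - ?y"] by simp
    thus "norm ?y \<le> (A + B) / 2 * exp (3 * k / 2)" using A(2)[OF k] B(2)[OF k]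
        by (simp add: norm_mult field_simps)
  qed
  thus "near (- (1 / 2))" "near (1 / 2)" unfolding near_def e_def using A B
      by (auto intro!: exI[of _ "(A + B) / 2"])
qed

text \<open>The recurrence has three terms, so the inductions, upwards and downwards, carry two
  neighbouring orders.\<close>

lemma near_half_integer: "near (real n - 1 / 2)" "near (- real n - 1 / 2)"
proof -
  have "near (real n - 1 / 2) \<and> near (real n + 1 / 2)"
  proof (induction n)
    case (Suc n)
    have e: "real n + 1 / 2 - 1 = real n - 1 / 2" "real (Suc n) - 1 / 2 = real n + 1 / 2"
        "real (Suc n) + 1 / 2 = real n + 1 / 2 + 1" by simp_all
    show ?case unfolding e using near_step[of "real n + 1 / 2", unfolded e] Suc by blast
  qed (use near_base in simp)
  thus "near (real n - 1 / 2)" ..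
  have "near (- real n - 1 / 2) \<and> near (- real n + 1 / 2)"
  proof (induction n)
    case (Suc n)
    have e: "- real n - 1 / 2 + 1 = - real n + 1 / 2" "- real (Suc n) + 1 / 2 = - real n - 1 / 2"
        "- real (Suc n) - 1 / 2 = - real n - 1 / 2 - 1" by simp_all
    show ?case unfolding e using near_step[of "- real n - 1 / 2", unfolded e] Suc by blast
  qed (use near_base in simp)
  thus "near (- real n - 1 / 2)" ..
qed

section \<open>The circle method\<close>

text \<open>This is where \<open>xi'\<close> gets its form: (2 j)! = 2 j (2 j - 1) (2 j - 2)!
  supplies its product, and the step from (2 pi)^(2 j - 2) to (2 pi)^(2 j) accounts for the divisor
  4 pi^2.\<close>

lemma quot_part_expands_xi:
  "expands (\<lambda>t. t ^ (2 * j) * quot_part j t) (of_real ((2 * pi) ^ (2 * j) * xi j / 2)) (of_real ((2 *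
      pi) ^ (2 * j) * xi' j / (4 * pi\<^sup>2)))"
proof -
  have "expands (\<lambda>t. fact (2 * j) * (t ^ (2 * j) * quot_part j t / fact (2 * j))) (fact (2 * j) *
      of_real (csc_coeff j)) (fact (2 * j) * of_real (if j = 0 then 0 else - csc_coeff (j - 1) / 2))"
    by (intro expands_cmult quot_part_expands csc_coeff_rec)
  thus ?thesis
  proof (rule expands_cong)
    have c: "csc_coeff i = (2 * pi) ^ (2 * i) * xi i / 2 / fact (2 * i)" for i
        by (simp add: csc_coeff_def xi_def)
    show "fact (2 * j) * of_real (csc_coeff j) = complex_of_real ((2 * pi) ^ (2 * j) * xi j / 2)"
        by (simp add: c)
    show "fact (2 * j) * of_real (if j = 0 then 0 else - csc_coeff (j - 1) / 2) =
        complex_of_real ((2 * pi) ^ (2 * j) * xi' j / (4 * pi\<^sup>2))"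
    proof (cases j)
      case (Suc i)
      have f: "fact (2 * j) = real (2 * j) * (real (2 * j) - 1) * fact (2 * i)"
          by (simp add: Suc algebra_simps)
      have p: "(2 * pi) ^ (2 * j) = (2 * pi) ^ (2 * i) * (4 * pi\<^sup>2)" by (simp add: Suc power2_eq_square)
      have "fact (2 * j) * (- csc_coeff i / 2) = (2 * pi) ^ (2 * j) * xi' j / (4 * pi\<^sup>2)"
        unfolding f c p by (simp add: xi'_def Suc)
      hence "complex_of_real (fact (2 * j) * (- csc_coeff i / 2)) =
          complex_of_real ((2 * pi) ^ (2 * j) * xi' j / (4 * pi\<^sup>2))" by (simp only:)
      thus ?thesis by (simp add: Suc)
    qed (simp add: xi'_def)
  qed simp
qed

definition log_main :: "complex \<Rightarrow> complex" where
  "log_main t = of_real (pi\<^sup>2 / 6) / t + Ln t / 2 - of_real (ln (2 * pi) / 2) - t / 24"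

lemma norm_exp_minus_1: "norm (exp z - 1) \<le> norm z * exp (norm z)" for z :: complex
proof -
  have "norm (exp z - exp 0) \<le> exp (norm z) * norm (z - 0)"
  proof (rule field_differentiable_bound[of "cball 0 (norm z)"])
    fix w :: complex assume "w \<in> cball 0 (norm z)"
    thus "norm (exp w) \<le> exp (norm z)" using complex_Re_le_cmod[of w] by (auto intro: order_trans)
    show "(exp has_field_derivative exp w) (at w within cball 0 (norm z))"
        by (auto intro!: derivative_eq_intros)
  qed auto
  thus ?thesis by (simp add: mult.commute)
qed

text \<open>What \<open>log_main\<close> omits from ln P is O(t^2), so its exponential has no linear
  term and the linear coefficient of the product comes from the quotients alone.\<close>

lemma exp_log_part_expands: "expands (\<lambda>t. exp (log_part t - log_main t)) 1 0"
proof -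
  obtain C where C: "C > 0" "\<forall>t\<in>sector. t \<noteq> 0 \<longrightarrow> norm t \<le> 1 \<longrightarrow> norm (log_part t - log_main t) \<le>
      C * norm t ^ 2"
    using log_part_asymp unfolding log_main_def by (elim exE conjE)
  show ?thesis
  proof (rule expandsI)
    fix t assume t: "t \<in> sector" "t \<noteq> 0" "norm t \<le> 1"
    let ?d = "log_part t - log_main t"
    have d: "norm ?d \<le> C * norm t ^ 2" using C t by auto
    also have "\<dots> \<le> C * 1" using t C by (intro mult_left_mono) (auto simp: power_le_one)
    finally have d1: "norm ?d \<le> C" by simp
    have "norm (exp ?d - 1) \<le> norm ?d * exp (norm ?d)" by (rule norm_exp_minus_1)
    also have "\<dots> \<le> (C * norm t ^ 2) * exp C" using d d1 C by (intro mult_mono) auto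
    finally show "norm (exp ?d - (1 + 0 * t)) \<le> C * exp C * norm t ^ 2" by (simp add: mult_ac)
  qed
qed

definition triple_gf :: "nat \<Rightarrow> nat \<Rightarrow> nat \<Rightarrow> complex fps" where
  "triple_gf a b c = cfps (partition_gf * crank_quot a * crank_quot b * crank_quot c)"

lemma triple_gf_conv_radius: "fps_conv_radius (triple_gf a b c) \<ge> 1"
  unfolding triple_gf_def cfps_mult
  by (intro fps_conv_radius_mult_ge partition_gf_eval(1) crank_quot_conv_radius)

lemma triple_gf_eval:
  assumes "Re t > 0"
  shows "eval_fps (triple_gf a b c) (exp (- t)) =
      exp (log_part t) * (quot_part a t * quot_part b t * quot_part c t)"
proof -
  have n: "norm (exp (- t)) < 1" using assms by simp
  have "eval_fps (triple_gf a b c) q = eval_fps (cfps partition_gf) q *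
      (eval_fps (cfps (crank_quot a)) q * eval_fps (cfps (crank_quot b)) q * eval_fps (cfps (crank_quot
      c)) q)"
    if "norm q < 1" for q
    unfolding triple_gf_def cfps_mult using that
    by (simp add: eval_fps_mult unit_disc_conv fps_conv_radius_mult_ge partition_gf_eval(1)
        crank_quot_conv_radius)
  from this[OF n] show ?thesis unfolding log_part_def quot_part_def partition_gf_eval(2)[OF n] .
qed

text \<open>The linear coefficient follows the product rule, hence the shape of \<open>xi3'\<close>.
  The factors 1/2 of the three expansions give the 1/4 of \<open>xi3\<close> with a further 1/2, and
  in the linear term, where only two of them occur, the 1/4 of \<open>xi3'\<close>.\<close>

lemma triple_gf_expands:
  fixes a b c :: nat
  defines "k \<equiv> a + b + c"
  shows "expands (\<lambda>t. eval_fps (triple_gf a b c) (exp (- t)) * t ^ (2 * k) / exp (log_main t))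
    (of_real ((2 * pi) ^ (2 * k) * xi3 a b c / 2)) (of_real ((2 * pi) ^ (2 * k) * xi3' a b c / (4 *
        pi\<^sup>2)))"
proof -
  note E = expands_mult[OF exp_log_part_expands expands_mult[OF expands_mult[OF quot_part_expands_xi[of
      a] quot_part_expands_xi[of b]] quot_part_expands_xi[of c]]]
  show ?thesis
  proof (rule expands_cong[OF E])
    fix t assume t: "t \<in> sector" "t \<noteq> 0"
    have Re: "Re t > 0" using wedge_posD[OF sector_wedge_pos[OF t]] by simp
    show "exp (log_part t - log_main t) * ((t ^ (2 * a) * quot_part a t) * (t ^ (2 * b) *
        quot_part b t) * (t ^ (2 * c) * quot_part c t)) =
      eval_fps (triple_gf a b c) (exp (- t)) * t ^ (2 * k) / exp (log_main t)"
      unfolding triple_gf_eval[OF Re] by (simp add: k_def exp_diff power_add algebra_simps)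
  next
    show "1 * (of_real ((2 * pi) ^ (2 * a) * xi a / 2) * of_real ((2 * pi) ^ (2 * b) * xi b / 2) *
        of_real ((2 * pi) ^ (2 * c) * xi c / 2)) = complex_of_real ((2 * pi) ^ (2 * k) * xi3 a b c / 2)"
      unfolding k_def xi3_def by (simp add: power_add algebra_simps)
  next
    show "1 * ((of_real ((2 * pi) ^ (2 * a) * xi a / 2) * of_real ((2 * pi) ^ (2 * b) * xi b / 2)) *
        of_real ((2 * pi) ^ (2 * c) * xi' c / (4 * pi\<^sup>2)) +
      (of_real ((2 * pi) ^ (2 * a) * xi a / 2) * of_real ((2 * pi) ^ (2 * b) * xi' b / (4 * pi\<^sup>2)) +
          of_real ((2 * pi) ^ (2 * a) * xi' a / (4 * pi\<^sup>2)) * of_real ((2 * pi) ^ (2 * b) * xi b / 2)) *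
          of_real ((2 * pi) ^ (2 * c) * xi c / 2)) +
      0 * (of_real ((2 * pi) ^ (2 * a) * xi a / 2) * of_real ((2 * pi) ^ (2 * b) * xi b / 2) * of_real
          ((2 * pi) ^ (2 * c) * xi c / 2)) = complex_of_real ((2 * pi) ^ (2 * k) * xi3' a b c / (4 *
          pi\<^sup>2))"
      unfolding k_def xi3'_def by (simp add: power_add algebra_simps add_divide_distrib)
  qed
qed

section \<open>The minor arc\<close>

lemma one_minus_cos_ge:
  assumes "0 \<le> x" "x \<le> (1 :: real)"
  shows "x\<^sup>2 / 8 \<le> 1 - cos x"
proof -
  define y where "y = x / 2"
  have y: "0 \<le> y" "y \<le> 1 / 2" using assms by (auto simp: y_def)
  have "\<bar>sin y - (\<Sum>m<3. sin_coeff m * y ^ m)\<bar> \<le> inverse (fact 3) * \<bar>y\<bar> ^ 3" by (rule Maclaurin_sin_bound)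
  hence "\<bar>sin y - y\<bar> \<le> y ^ 3 / 6" using y by (simp add: numeral_eq_Suc sin_coeff_def)
  moreover have "y ^ 3 \<le> y" using power_decreasing[of 1 3 y] y by simp
  ultimately have "sin y \<ge> y / 2" using y by linarith
  hence "(y / 2)\<^sup>2 \<le> (sin y)\<^sup>2" using y by (intro power_mono) auto
  moreover have "1 - cos x = 2 * (sin y)\<^sup>2" using cos_double_sin[of y] by (simp add: y_def)
  ultimately show ?thesis by (simp add: y_def power_divide)
qed

text \<open>In the Lambert series of ln P no term has a real part above its value at |q|, so it is
  enough to find a loss in the first term q / (1 - q). For |\<theta>| \<ge> \<sigma> its denominator
  exceeds 1 - \<rho> by a fixed factor, and the term itself is of size 1 / \<sigma>.\<close>

lemma log_part_minor:
  assumes s: "0 < \<sigma>" "\<sigma> \<le> 1 / 2" and th: "\<sigma> \<le> \<bar>\<theta>\<bar>" "\<bar>\<theta>\<bar> \<le> pi"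
  shows "Re (log_part (Complex \<sigma> \<theta>)) \<le> Re (log_part (of_real \<sigma>)) - 1 / (40 * \<sigma>)"
proof -
  define t where "t = Complex \<sigma> \<theta>"
  define q where "q = exp (- t)"
  define \<rho> where "\<rho> = exp (- \<sigma>)"
  have nq: "norm q = \<rho>" by (simp add: q_def \<rho>_def t_def)
  have \<rho>: "\<rho> < 1" "\<rho> \<ge> 1 / 2" "1 - \<rho> \<le> \<sigma>" "\<rho> > 0"
    using s exp_ge_add_one_self[of "- \<sigma>"] by (auto simp: \<rho>_def)
  define f where "f = (\<lambda>m. of_real (1 / of_nat (Suc m)) * (q ^ Suc m / (1 - q ^ Suc m)))"
  define g where "g = (\<lambda>m. 1 / real (Suc m) * (\<rho> ^ Suc m / (1 - \<rho> ^ Suc m)))"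
  have f: "f sums log_part t"
  proof -
    have "norm q < 1" using nq \<rho> by simp
    from divsum_lambert_sums[OF weight_bounds(2) this] show ?thesis
      unfolding f_def log_part_def q_def[symmetric] by simp
  qed
  have g: "(\<lambda>m. complex_of_real (g m)) sums log_part (of_real \<sigma>)"
  proof -
    have e: "exp (- complex_of_real \<sigma>) = of_real \<rho>" by (simp add: \<rho>_def exp_of_real[symmetric])
    show ?thesis
      using divsum_lambert_sums[of "\<lambda>d. 1 / of_nat d" 0 "of_real \<rho>", OF weight_bounds(2)] \<rho>
      unfolding log_part_def e g_def by simp
  qed
  have le: "norm (q ^ Suc m / (1 - q ^ Suc m)) \<le> \<rho> ^ Suc m / (1 - \<rho> ^ Suc m)" for m
  proof -
    have "norm (1 :: complex) - norm (q ^ Suc m) \<le> norm (1 - q ^ Suc m)" by (rule norm_triangle_ineq2)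
    moreover have "\<rho> ^ Suc m < 1" using \<rho> by (simp add: power_less_one_iff del: power_Suc)
    ultimately show ?thesis unfolding norm_divide norm_power nq using \<rho>
        by (intro frac_le) (auto simp: norm_power nq simp del: power_Suc)
  qed
  have fg: "Re (f m) \<le> g m" for m
  proof -
    have "Re (f m) = 1 / real (Suc m) * Re (q ^ Suc m / (1 - q ^ Suc m))"
      unfolding f_def by (simp only: Re_complex_of_real Im_complex_of_real times_complex.sel
          mult_zero_left diff_zero)
    also have "\<dots> \<le> 1 / real (Suc m) * (\<rho> ^ Suc m / (1 - \<rho> ^ Suc m))"
      by (intro mult_left_mono order_trans[OF complex_Re_le_cmod le]) auto
    finally show ?thesis by (simp add: g_def)
  qed
  have "(\<lambda>m. g m - Re (f m)) sums (Re (log_part (of_real \<sigma>)) - Re (log_part t))"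
    using sums_diff[OF sums_Re[OF g] sums_Re[OF f]] by simp
  hence "g 0 - Re (f 0) \<le> Re (log_part (of_real \<sigma>)) - Re (log_part t)"
    using sum_le_suminf[of "\<lambda>m. g m - Re (f m)" "{0}"] fg by (auto simp: sums_iff)
  moreover have "g 0 - Re (f 0) \<ge> 1 / (40 * \<sigma>)"
  proof -
    have "Re q = \<rho> * cos \<theta>" "Im q = - (\<rho> * sin \<theta>)" by (simp_all add: q_def t_def \<rho>_def Re_exp Im_exp)
    hence "(norm (1 - q))\<^sup>2 = (1 - \<rho> * cos \<theta>)\<^sup>2 + (\<rho> * sin \<theta>)\<^sup>2" by (simp add: cmod_power2)
    also have "\<dots> = 1 - 2 * \<rho> * cos \<theta> + \<rho>\<^sup>2 * ((cos \<theta>)\<^sup>2 + (sin \<theta>)\<^sup>2)"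
      unfolding power2_diff power_mult_distrib distrib_left by simp
    also have "\<dots> = 1 - 2 * \<rho> * cos \<theta> + \<rho>\<^sup>2" by simp
    also have "\<dots> = (1 - \<rho>)\<^sup>2 + 2 * \<rho> * (1 - cos \<theta>)" by (simp add: power2_eq_square algebra_simps)
    finally have n2: "(norm (1 - q))\<^sup>2 = (1 - \<rho>)\<^sup>2 + 2 * \<rho> * (1 - cos \<theta>)" .
    have "cos \<theta> = cos \<bar>\<theta>\<bar>" by simp
    also have "\<dots> \<le> cos \<sigma>" using s th by (intro cos_monotone_0_pi_le) auto
    finally have "\<sigma>\<^sup>2 / 8 \<le> 1 - cos \<theta>" using one_minus_cos_ge[of \<sigma>] s by auto
    hence f1: "1 * (\<sigma>\<^sup>2 / 8) \<le> 2 * \<rho> * (1 - cos \<theta>)" using \<rho> by (intro mult_mono) auto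
    have f2: "(1 - \<rho>)\<^sup>2 \<le> \<sigma>\<^sup>2" using \<rho> by (intro power_mono) auto
    \<comment> \<open>The term 2 \<rho> (1 - cos \<theta>) is at least \<sigma>^2 / 8, hence at
      least (1 - \<rho>)^2 / 8. So |1 - q|^2 \<ge> (9/8) (1 - \<rho>)^2, and 53/50 is a rational
      number just below sqrt(9/8).\<close>
    have f3: "(53 / 50)\<^sup>2 * (1 - \<rho>)\<^sup>2 \<le> (9 / 8) * (1 - \<rho>)\<^sup>2"
      by (intro mult_right_mono) (simp_all add: power2_eq_square)
    have lin: "A \<le> P + R" if "A \<le> (9 / 8) * P" "P \<le> S" "1 * (S / 8) \<le> R" for A P S R :: real
      using that by linarith
    have "(norm (1 - q))\<^sup>2 \<ge> (53 / 50 * (1 - \<rho>))\<^sup>2" unfolding n2 power_mult_distrib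
        by (rule lin[OF f3 f2 f1])
    hence n: "norm (1 - q) \<ge> 53 / 50 * (1 - \<rho>)" by (rule power2_le_imp_le) simp
    have "Re (f 0) \<le> norm (f 0)" by (rule complex_Re_le_cmod)
    also have "\<dots> = \<rho> / norm (1 - q)" by (simp add: f_def norm_divide nq)
    also have "\<dots> \<le> \<rho> / (53 / 50 * (1 - \<rho>))" using n \<rho>
        by (intro divide_left_mono mult_pos_pos) (auto intro: less_le_trans[of _ "53 / 50 * (1 - \<rho>)"])
    finally have "g 0 - Re (f 0) \<ge> \<rho> / (1 - \<rho>) - \<rho> / (53 / 50 * (1 - \<rho>))" by (simp add: g_def)
    also have "\<rho> / (1 - \<rho>) - \<rho> / (53 / 50 * (1 - \<rho>)) = 3 / 53 * (\<rho> / (1 - \<rho>))"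
    proof -
      have "\<rho> / (53 / 50 * (1 - \<rho>)) = 50 / 53 * (\<rho> / (1 - \<rho>))" by simp
      moreover have "x - 50 / 53 * x = 3 / 53 * x" for x :: real by simp
      ultimately show ?thesis by metis
    qed
    finally have 1: "g 0 - Re (f 0) \<ge> 3 / 53 * (\<rho> / (1 - \<rho>))" .
    have "\<rho> / (1 - \<rho>) \<ge> (1 / 2) / \<sigma>" using \<rho> s by (intro frac_le) auto
    hence "3 / 53 * (\<rho> / (1 - \<rho>)) \<ge> 3 / 53 * ((1 / 2) / \<sigma>)" by (intro mult_left_mono) auto
    also have "3 / 53 * ((1 / 2) / \<sigma>) = 3 / 106 * (1 / \<sigma>)" by simp
    finally have "3 / 53 * (\<rho> / (1 - \<rho>)) \<ge> 3 / 106 * (1 / \<sigma>)" .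
    \<comment> \<open>The constant 1/40 is a round value below 3/106 = (1 - 50/53) / 2.\<close>
    moreover have "3 / 106 * (1 / \<sigma>) \<ge> 1 / 40 * (1 / \<sigma>)" using s by (intro mult_right_mono) auto
    ultimately show ?thesis using 1 by simp
  qed
  ultimately show ?thesis by (simp add: t_def)
qed

text \<open>Outside the sector nothing is known about the quotients except that the value at the
  real point of the circle dominates, and there the expansion applies. It yields powers of 1 /
  \<sigma>, while the saving exp(- 1 / (40 \<sigma>)) comes from P.\<close>

lemma minor_arc_bound:
  "\<exists>C\<ge>0. \<forall>\<sigma> \<theta>. 0 < \<sigma> \<longrightarrow> \<sigma> \<le> 1 / 2 \<longrightarrow> \<sigma> \<le> \<bar>\<theta>\<bar> \<longrightarrow> \<bar>\<theta>\<bar> \<le> pi \<longrightarrow>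
     norm (eval_fps (triple_gf a b c) (exp (- Complex \<sigma> \<theta>))) \<le> C * exp (pi\<^sup>2 / 6 / \<sigma> - 1 / (40 * \<sigma>)) / \<sigma> ^
         (2 * (a + b + c))"
proof -
  have Q: "\<exists>D\<ge>0. \<forall>\<sigma> \<theta>. 0 < \<sigma> \<longrightarrow> \<sigma> \<le> 1 / 2 \<longrightarrow> norm (quot_part j (Complex \<sigma> \<theta>)) \<le> D / \<sigma> ^ (2 * j)" for j
  proof -
    obtain D where D: "D \<ge> 0" "\<And>t. t \<in> sector \<Longrightarrow> t \<noteq> 0 \<Longrightarrow> norm t \<le> 1 \<Longrightarrow>
        norm (t ^ (2 * j) * quot_part j t - (of_real ((2 * pi) ^ (2 * j) * xi j / 2) + of_real ((2 * pi)
        ^ (2 * j) * xi' j / (4 * pi\<^sup>2)) * t)) \<le> D * norm t ^ 2"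
      by (rule expandsE[OF quot_part_expands_xi[of j]]) blast
    define A B where "A = complex_of_real ((2 * pi) ^ (2 * j) * xi j / 2)" and
        "B = complex_of_real ((2 * pi) ^ (2 * j) * xi' j / (4 * pi\<^sup>2))"
    have "norm (quot_part j (Complex \<sigma> \<theta>)) \<le> (D + norm A + norm B) / \<sigma> ^ (2 * j)" if s: "0 < \<sigma>"
        "\<sigma> \<le> 1 / 2" for \<sigma> \<theta>
    proof -
      let ?t = "complex_of_real \<sigma>"
      have t: "?t \<in> sector" "?t \<noteq> 0" "norm ?t \<le> 1" using s by (auto simp: sector_def)
      have "norm (quot_part j (Complex \<sigma> \<theta>)) \<le> norm (quot_part j ?t)"
        using crank_quot_norm_le[of "exp (- Complex \<sigma> \<theta>)" j] s
            by (simp add: quot_part_def exp_of_real[symmetric])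
      also have "norm (quot_part j ?t) = norm (?t ^ (2 * j) * quot_part j ?t) / \<sigma> ^ (2 * j)"
        using s by (simp add: norm_mult norm_power)
      also have "\<dots> \<le> (D + norm A + norm B) / \<sigma> ^ (2 * j)"
      proof (intro divide_right_mono)
        have "norm (?t ^ (2 * j) * quot_part j ?t) \<le> norm (?t ^ (2 * j) * quot_part j ?t - (A +
            B * ?t)) + norm (A + B * ?t)"
          using norm_triangle_ineq[of "?t ^ (2 * j) * quot_part j ?t - (A + B * ?t)" "A + B * ?t"]
              by simp
        also have "norm (?t ^ (2 * j) * quot_part j ?t - (A + B * ?t)) \<le> D * norm ?t ^ 2"
            unfolding A_def B_def by (rule D(2)[OF t])
        also have "\<dots> \<le> D * 1" using t D(1) by (intro mult_left_mono power_le_one) auto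
        also have "norm (A + B * ?t) \<le> norm A + norm B * norm ?t" by (metis norm_triangle_ineq norm_mult)
        also have "norm B * norm ?t \<le> norm B * 1" using t by (intro mult_left_mono) auto
        finally show "norm (?t ^ (2 * j) * quot_part j ?t) \<le> D + norm A + norm B" by simp
      qed (use s in auto)
      finally show ?thesis .
    qed
    thus ?thesis using D(1) by (intro exI[of _ "D + norm A + norm B"]) auto
  qed
  have "\<forall>j. \<exists>D\<ge>0. \<forall>\<sigma> \<theta>. 0 < \<sigma> \<longrightarrow> \<sigma> \<le> 1 / 2 \<longrightarrow> norm (quot_part j (Complex \<sigma> \<theta>)) \<le> D / \<sigma> ^ (2 * j)"
    by (intro allI Q)
  from choice[OF this] obtain D where D': "\<forall>j. D j \<ge> 0 \<and> (\<forall>\<sigma> \<theta>. 0 < \<sigma> \<longrightarrow> \<sigma> \<le> 1 / 2 \<longrightarrow>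
      norm (quot_part j (Complex \<sigma> \<theta>)) \<le> D j / \<sigma> ^ (2 * j))"
    by (elim exE)
  hence D: "D j \<ge> 0" "0 < \<sigma> \<Longrightarrow> \<sigma> \<le> 1 / 2 \<Longrightarrow> norm (quot_part j (Complex \<sigma> \<theta>)) \<le> D j / \<sigma> ^ (2 * j)" for j \<sigma> \<theta>
    by simp_all
  obtain L where L: "L > 0" "\<forall>t\<in>sector. t \<noteq> 0 \<longrightarrow> norm t \<le> 1 \<longrightarrow> norm (log_part t - (of_real (pi\<^sup>2 / 6) / t +
      Ln t / 2 - of_real (ln (2 * pi) / 2) - t / 24)) \<le> L * norm t ^ 2"
    using log_part_asymp by (elim exE conjE)
  have LR: "Re (log_part (of_real \<sigma>)) \<le> pi\<^sup>2 / 6 / \<sigma> + L" if s: "0 < \<sigma>" "\<sigma> \<le> 1 / 2" for \<sigma>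
  proof -
    let ?t = "complex_of_real \<sigma>"
    have t: "?t \<in> sector" "?t \<noteq> 0" "norm ?t \<le> 1" using s by (auto simp: sector_def)
    let ?m = "of_real (pi\<^sup>2 / 6) / ?t + Ln ?t / 2 - of_real (ln (2 * pi) / 2) - ?t / 24"
    have "Re (log_part ?t) - Re ?m \<le> norm (log_part ?t - ?m)"
        using complex_Re_le_cmod[of "log_part ?t - ?m"] by simp
    also have "\<dots> \<le> L * norm ?t ^ 2" using L(2) t by blast
    also have "\<dots> \<le> L * 1" using t L(1) by (intro mult_left_mono power_le_one) auto
    finally have "Re (log_part ?t) \<le> Re ?m + L" by simp
    also have "?m = of_real (pi\<^sup>2 / 6 / \<sigma> + ln \<sigma> / 2 - ln (2 * pi) / 2 - \<sigma> / 24)" using s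
        by (simp add: Ln_of_real)
    also have "Re \<dots> \<le> pi\<^sup>2 / 6 / \<sigma>"
    proof -
      have "ln \<sigma> \<le> 0" using s by simp
      moreover have "ln (2 * pi) \<ge> 0" using pi_gt3 by (intro ln_ge_zero) auto
      ultimately show ?thesis using s by (simp only: Re_complex_of_real)
    qed
    finally show ?thesis by simp
  qed
  show ?thesis
  proof (intro exI[of _ "exp L * (D a * D b * D c)"] conjI allI impI)
    fix \<sigma> \<theta> :: real assume s: "0 < \<sigma>" "\<sigma> \<le> 1 / 2" and th: "\<sigma> \<le> \<bar>\<theta>\<bar>" "\<bar>\<theta>\<bar> \<le> pi"
    let ?t = "Complex \<sigma> \<theta>"
    have "norm (exp (log_part ?t)) \<le> exp (Re (log_part (of_real \<sigma>)) - 1 / (40 * \<sigma>))"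
      using log_part_minor[OF s th] by simp
    also have "\<dots> \<le> exp (L + (pi\<^sup>2 / 6 / \<sigma> - 1 / (40 * \<sigma>)))" using LR[OF s] by simp
    finally have e: "norm (exp (log_part ?t)) \<le> exp L * exp (pi\<^sup>2 / 6 / \<sigma> - 1 / (40 * \<sigma>))"
        by (simp only: exp_add)
    have "norm (eval_fps (triple_gf a b c) (exp (- ?t))) =
        norm (exp (log_part ?t)) * (norm (quot_part a ?t) * norm (quot_part b ?t) * norm (quot_part c
        ?t))"
      using s by (subst triple_gf_eval) (simp_all only: norm_mult complex.sel)
    also have "\<dots> \<le> exp L * exp (pi\<^sup>2 / 6 / \<sigma> - 1 / (40 * \<sigma>)) * (D a / \<sigma> ^ (2 * a) * (D b / \<sigma> ^ (2 * b)) *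
        (D c / \<sigma> ^ (2 * c)))"
      using s by (intro mult_mono e D mult_nonneg_nonneg divide_nonneg_nonneg) auto
    also have "\<dots> = exp L * (D a * D b * D c) * exp (pi\<^sup>2 / 6 / \<sigma> - 1 / (40 * \<sigma>)) / \<sigma> ^ (2 * (a + b + c))"
      using s by (simp add: power_add distrib_left)
    finally show "norm (eval_fps (triple_gf a b c) (exp (- ?t))) \<le>
        exp L * (D a * D b * D c) * exp (pi\<^sup>2 / 6 / \<sigma> - 1 / (40 * \<sigma>)) / \<sigma> ^ (2 * (a + b + c))" .
  qed (use D in auto)
qed

section \<open>The major arc\<close>

lemma vline_bounds:
  assumes "v \<in> {-1..1}"
  shows "norm (vline v) \<le> 2" "1 \<le> norm (vline v)" "vline v \<noteq> 0" "vline v \<in> sector"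
proof -
  have "norm (vline v) \<le> 1 + \<bar>v\<bar>"
    using norm_triangle_ineq[of 1 "\<i> * complex_of_real v"] by (simp add: vline_def norm_mult)
  also have "\<bar>v\<bar> \<le> 1" using assms by auto
  finally show "norm (vline v) \<le> 2" by simp
  show "1 \<le> norm (vline v)" using abs_Re_le_cmod[of "vline v"] by simp
  thus "vline v \<noteq> 0" by auto
  show "vline v \<in> sector" using assms by (auto simp: sector_def vline_def)
qed

text \<open>On the segment Re (s + 1/s) = 1 + 1 / (1 + v^2), which is at most 2 - v^2 / 2 for |v|
  \<le> 1: the Gaussian decay away from the saddle point s = 1.\<close>

lemma norm_kern_vline_le:
  assumes v: "v \<in> {-1..1}" and k: "k \<ge> 0"
  shows "norm (kern k (vline v)) \<le> exp (2 * k) * exp (- (k / 2) * v\<^sup>2)"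
proof -
  have v2: "v\<^sup>2 \<le> 1" using v by (auto simp: abs_square_le_1)
  have "Re (vline v + 1 / vline v) = 1 + 1 / (1 + v\<^sup>2)"
    by (simp add: vline_def Re_divide power2_eq_square)
  also have "\<dots> \<le> 2 - v\<^sup>2 / 2"
  proof -
    have "1 \<le> (1 - v\<^sup>2 / 2) * (1 + v\<^sup>2)"
    proof -
      have "0 \<le> v\<^sup>2 * (1 - v\<^sup>2)" using v2 by (intro mult_nonneg_nonneg) auto
      thus ?thesis by (simp add: algebra_simps)
    qed
    moreover have "1 + v\<^sup>2 > 0" by (simp add: add_pos_nonneg)
    ultimately have "1 / (1 + v\<^sup>2) \<le> 1 - v\<^sup>2 / 2" by (simp add: pos_divide_le_eq)
    thus ?thesis by simp
  qed
  finally have "k * Re (vline v + 1 / vline v) \<le> k * (2 - v\<^sup>2 / 2)" using k by (rule mult_left_mono)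
  hence "exp (k * Re (vline v + 1 / vline v)) \<le> exp (2 * k + - (k / 2) * v\<^sup>2)"
      by (simp add: algebra_simps)
  moreover have "norm (kern k (vline v)) = exp (k * Re (vline v + 1 / vline v))"
    unfolding kern_def norm_exp_eq_Re by (simp only: times_complex.sel Re_complex_of_real
        Im_complex_of_real) simp
  ultimately show ?thesis by (simp only: exp_add)
qed

text \<open>The two hypotheses on \<kappa> give 1/s and s the same coefficient, the second one after
  - t / 24 has been absorbed. The square root from Ln t / 2 makes the exponent 1/2 - j, and so the
  Bessel order half-integral.\<close>

lemma exp_log_main:
  assumes \<sigma>: "\<sigma> > 0" and s: "Re s > 0" and k: "pi\<^sup>2 / 6 = \<kappa> * \<sigma>" "(n - 1 / 24) * \<sigma> = \<kappa>"
  shows "exp (log_main (of_real \<sigma> * s)) * exp (of_real n * (of_real \<sigma> * s)) / (of_real \<sigma> * s) ^ j =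
    of_real (\<sigma> powr (1 / 2 - real j) / sqrt (2 * pi)) * (s powr of_real (1 / 2 - real j) * kern \<kappa> s)"
proof -
  have s0: "s \<noteq> 0" using s by auto
  have L: "Ln (of_real \<sigma> * s) = of_real (ln \<sigma>) + Ln s" using \<sigma> s0
      by (simp add: Ln_times_of_real Ln_of_real)
  have n: "n * \<sigma> = \<kappa> + \<sigma> / 24" using k(2) by (simp add: algebra_simps)
  have 1: "log_main (of_real \<sigma> * s) + of_real n * (of_real \<sigma> * s) =
    of_real \<kappa> * (s + 1 / s) + (of_real (ln \<sigma> / 2) + Ln s / 2 + of_real (- (ln (2 * pi) / 2)))"
  proof -
    have "of_real (pi\<^sup>2 / 6) / (of_real \<sigma> * s) = of_real \<kappa> * (1 / s)"
      unfolding k(1) using \<sigma> s0 by (simp add: field_simps)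
    moreover have "of_real n * (of_real \<sigma> * s) = of_real (n * \<sigma>) * s" by simp
    hence "of_real n * (of_real \<sigma> * s) = of_real \<kappa> * s + of_real \<sigma> * s / 24"
      unfolding n by (simp add: distrib_right)
    ultimately show ?thesis unfolding log_main_def L by (simp add: algebra_simps add_divide_distrib)
  qed
  have sq: "exp (- (ln (2 * pi) / 2)) = 1 / sqrt (2 * pi)"
    by (simp add: exp_minus ln_sqrt[symmetric] inverse_eq_divide)
  have A: "exp (log_main (of_real \<sigma> * s)) * exp (of_real n * (of_real \<sigma> * s)) =
    kern \<kappa> s * (of_real (exp (ln \<sigma> / 2)) * exp (Ln s / 2) * of_real (1 / sqrt (2 * pi)))"
    unfolding exp_add[symmetric] 1 unfolding exp_add kern_def exp_of_real sq ..
  have B: "exp (Ln s / 2) / s ^ j = s powr of_real (1 / 2 - real j)"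
  proof -
    have "s ^ j = exp (of_nat j * Ln s)" using s0 by (simp add: exp_of_nat_mult)
    thus ?thesis using s0 by (simp add: powr_def exp_diff[symmetric] algebra_simps)
  qed
  have C: "exp (ln \<sigma> / 2) / \<sigma> ^ j = \<sigma> powr (1 / 2 - real j)"
    using \<sigma> by (simp add: powr_def left_diff_distrib exp_diff exp_of_nat_mult)
  have "exp (log_main (of_real \<sigma> * s)) * exp (of_real n * (of_real \<sigma> * s)) / (of_real \<sigma> * s) ^ j =
    kern \<kappa> s * (of_real (exp (ln \<sigma> / 2) / \<sigma> ^ j) * (exp (Ln s / 2) / s ^ j) * of_real (1 / sqrt (2 *
        pi)))"
    unfolding A by (simp add: power_mult_distrib)
  also have "\<dots> = of_real (\<sigma> powr (1 / 2 - real j) / sqrt (2 * pi)) * (s powr of_real (1 / 2 -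
      real j) * kern \<kappa> s)"
    unfolding B C by simp
  finally show ?thesis .
qed

lemma integral_gauss_le:
  assumes "\<kappa> \<ge> 2"
  shows "integral {-1..1} (\<lambda>v. exp (- (\<kappa> / 2) * v\<^sup>2)) \<le> sqrt (2 * pi / \<kappa>)"
  using gauss_truncated(2)[of "\<kappa> / 2" 1] assms by (simp add: mult.commute)

lemma norm_vline_powr_le:
  assumes "v \<in> {-1..1}"
  shows "norm (vline v powr of_real p) \<le> 2 powr \<bar>p\<bar>"
proof -
  have "norm (vline v powr of_real p) = norm (vline v) powr p"
    using vline_bounds(3)[OF assms] by (auto simp: powr_def norm_exp_eq_Re)
  also have "\<dots> \<le> 2 powr \<bar>p\<bar>"
    using vline_bounds[OF assms] by (meson abs_ge_self abs_ge_zero order_trans powr_mono powr_mono2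
        zero_le_one)
  finally show ?thesis .
qed

text \<open>The substitution \<theta> = \<sigma> v puts t = \<sigma> (1 + i v). The constant term of
  the expansion comes with s to the power 1/2 - 2 k, which is order 2 k - 3/2; the linear term
  raises the power and lowers the order by one. The quadratic remainder is integrated against the
  Gaussian bound.\<close>

lemma major_arc:
  fixes a b c :: nat
  defines "k \<equiv> a + b + c"
  defines "A \<equiv> (2 * pi) ^ (2 * k) * xi3 a b c / 2" and "B \<equiv> (2 * pi) ^ (2 * k) * xi3' a b c / (4 * pi\<^sup>2)"
  shows "\<exists>C\<ge>0. \<forall>\<sigma> \<kappa> n. 0 < \<sigma> \<longrightarrow> \<sigma> \<le> 1 / 2 \<longrightarrow> \<kappa> \<ge> 2 \<longrightarrow> pi\<^sup>2 / 6 = \<kappa> * \<sigma> \<longrightarrow> (real n - 1 / 24) * \<sigma> = \<kappa> \<longrightarrow>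
    norm (integral {-\<sigma>..\<sigma>} (\<lambda>\<theta>. eval_fps (triple_gf a b c) (exp (- Complex \<sigma> \<theta>)) * exp (of_nat n *
        Complex \<sigma> \<theta>)) -
      of_real (sqrt (2 * pi) * \<sigma> powr (3 / 2 - 2 * real k)) * (of_real A * hankel (2 * real k - 3 / 2) \<kappa>
          + of_real (B * \<sigma>) * hankel (2 * real k - 5 / 2) \<kappa>))
    \<le> C * (\<sigma> powr (7 / 2 - 2 * real k) * exp (2 * \<kappa>) / sqrt \<kappa>)"
proof -
  let ?p = "1 / 2 - 2 * real k"
  define g where "g = (\<lambda>t. eval_fps (triple_gf a b c) (exp (- t)) * t ^ (2 * k) / exp (log_main t))"
  obtain D where D: "D \<ge> 0" "\<And>t. t \<in> sector \<Longrightarrow> t \<noteq> 0 \<Longrightarrow> norm t \<le> 1 \<Longrightarrow>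
      norm (g t - (of_real A + of_real B * t)) \<le> D * norm t ^ 2"
    using expandsE[OF triple_gf_expands[of a b c]] unfolding g_def k_def A_def B_def by blast
  show ?thesis
  \<comment> \<open>The 4 bounds |s|^2 on the segment, and the power of 2 bounds the power of
    s.\<close>
  proof (intro exI[of _ "4 * D * 2 powr \<bar>?p\<bar>"] conjI allI impI)
    show "0 \<le> 4 * D * 2 powr \<bar>?p\<bar>" using D by simp
    fix \<sigma> \<kappa> :: real and n :: nat
    assume \<sigma>: "0 < \<sigma>" "\<sigma> \<le> 1 / 2" and \<kappa>: "\<kappa> \<ge> 2" "pi\<^sup>2 / 6 = \<kappa> * \<sigma>" "(real n - 1 / 24) * \<sigma> = \<kappa>"
    define f where "f = (\<lambda>\<theta>. eval_fps (triple_gf a b c) (exp (- Complex \<sigma> \<theta>)) * exp (of_nat n *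
        Complex \<sigma> \<theta>))"
    define I where "I = integral {-\<sigma>..\<sigma>} f"
    define c0 where "c0 = \<sigma> powr ?p / sqrt (2 * pi)"
    have c0: "c0 \<ge> 0" by (simp add: c0_def)
    define h where "h = (\<lambda>p v. vline v powr of_real p * kern \<kappa> (vline v))"
    define H where "H = of_real A * hankel (2 * real k - 3 / 2) \<kappa> +
        of_real (B * \<sigma>) * hankel (2 * real k - 5 / 2) \<kappa>"
    \<comment> \<open>Integrability over the arc is inherited from Cauchy's integral over the whole
      circle.\<close>
    have "f integrable_on {-pi..pi}"
      unfolding f_def using Cauchy_coeff_eq[OF triple_gf_conv_radius \<sigma>(1)] by blast
    hence "f integrable_on {-\<sigma>..\<sigma>}"
      using \<sigma> pi_gt3 by (elim integrable_on_subinterval) auto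
    hence "(f has_integral I) (cbox (-\<sigma>) \<sigma>)" unfolding I_def by (simp add: integrable_integral)
    from has_integral_affinity'[OF this \<sigma>(1), of 0]
    have fI: "((\<lambda>v. f (\<sigma> * v)) has_integral I / of_real \<sigma>) {-1..1}"
      using \<sigma> by (simp add: scaleR_conv_of_real field_simps)
    have hI: "(h ?p has_integral of_real (2 * pi) * hankel (2 * real k - 3 / 2) \<kappa>) {-1..1}"
      "(h (?p + 1) has_integral of_real (2 * pi) * hankel (2 * real k - 5 / 2) \<kappa>) {-1..1}"
      using hankel_has_integral[of "2 * real k - 3 / 2" \<kappa>] hankel_has_integral[of "2 * real k - 5 / 2" \<kappa>]
      unfolding h_def by (simp_all add: algebra_simps)
    have "((\<lambda>v. of_real c0 * (of_real A * h ?p v + of_real (B * \<sigma>) * h (?p + 1) v)) has_integral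
       of_real c0 * (of_real A * (of_real (2 * pi) * hankel (2 * real k - 3 / 2) \<kappa>) + of_real (B * \<sigma>) *
           (of_real (2 * pi) * hankel (2 * real k - 5 / 2) \<kappa>))) {-1..1}"
      by (intro has_integral_mult_right has_integral_add hI)
    also have "of_real c0 * (of_real A * (of_real (2 * pi) * hankel (2 * real k - 3 / 2) \<kappa>) +
        of_real (B * \<sigma>) * (of_real (2 * pi) * hankel (2 * real k - 5 / 2) \<kappa>)) = of_real (2 * pi * c0) *
        H"
      unfolding H_def by (simp add: algebra_simps)
    finally have dI: "((\<lambda>v. f (\<sigma> * v) - of_real c0 * (of_real A * h ?p v + of_real (B * \<sigma>) * h (?p +
        1) v)) has_integral
       I / of_real \<sigma> - of_real (2 * pi * c0) * H) {-1..1}"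
      by (intro has_integral_diff fI)
    have gI: "(\<lambda>v. exp (- (\<kappa> / 2) * v\<^sup>2)) integrable_on {-1..1}"
      by (intro integrable_continuous_interval continuous_intros)
    have pw: "norm (f (\<sigma> * v) - of_real c0 * (of_real A * h ?p v + of_real (B * \<sigma>) * h (?p + 1) v)) \<le>
       (4 * D * 2 powr \<bar>?p\<bar> * \<sigma>\<^sup>2 * c0 * exp (2 * \<kappa>)) * exp (- (\<kappa> / 2) * v\<^sup>2)" if v: "v \<in> {-1..1}" for v
    proof -
      define s where "s = vline v"
      define t where "t = of_real \<sigma> * s"
      have s: "norm s \<le> 2" "s \<noteq> 0" "s \<in> sector" "Re s = 1" using vline_bounds[OF v] by (auto simp: s_def)
      have nt: "norm t = \<sigma> * norm s" using \<sigma> by (simp add: t_def norm_mult)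
      have t: "t \<in> sector" "t \<noteq> 0" using s \<sigma> by (auto simp: t_def sector_mult)
      have t1: "norm t \<le> 1" unfolding nt using mult_mono[OF \<sigma>(2) s(1)] by simp
      have ct: "Complex \<sigma> (\<sigma> * v) = t" by (simp add: t_def s_def vline_def complex_eq_iff)
      have "exp (log_main t) * exp (of_real (real n) * t) / t ^ (2 * k) = of_real c0 * h ?p v"
        using exp_log_main[OF \<sigma>(1), of s \<kappa> "real n" "2 * k"] \<kappa> s(4)
            by (simp add: t_def c0_def h_def s_def)
      hence e: "f (\<sigma> * v) = g t * (of_real c0 * h ?p v)"
        unfolding f_def ct g_def using t(2) by (simp add: field_simps)
      have h1: "h (?p + 1) v = s * h ?p v"
        unfolding h_def of_real_add powr_add of_real_1 powr_to_1 s_def by simp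
      have "f (\<sigma> * v) - of_real c0 * (of_real A * h ?p v + of_real (B * \<sigma>) * h (?p + 1) v) =
        (g t - (of_real A + of_real B * t)) * (of_real c0 * h ?p v)"
        unfolding e h1 t_def by (simp add: algebra_simps)
      also have "norm \<dots> = norm (g t - (of_real A +
          of_real B * t)) * (c0 * (norm (vline v powr of_real ?p) * norm (kern \<kappa> (vline v))))"
        using c0 by (simp only: norm_mult h_def norm_of_real abs_of_nonneg)
      also have "\<dots> \<le> (D * (\<sigma> * 2)\<^sup>2) * (c0 * (2 powr \<bar>?p\<bar> * (exp (2 * \<kappa>) * exp (- (\<kappa> / 2) * v\<^sup>2))))"
      proof (intro mult_mono mult_nonneg_nonneg)
        have "norm (g t - (of_real A + of_real B * t)) \<le> D * norm t ^ 2" using D(2) t t1 by blast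
        also have "\<dots> \<le> D * (\<sigma> * 2)\<^sup>2" unfolding nt using D(1) s(1) \<sigma>
            by (intro mult_left_mono power_mono) auto
        finally show "norm (g t - (of_real A + of_real B * t)) \<le> D * (\<sigma> * 2)\<^sup>2" .
        show "norm (kern \<kappa> (vline v)) \<le> exp (2 * \<kappa>) * exp (- (\<kappa> / 2) * v\<^sup>2)" using v \<kappa>
            by (intro norm_kern_vline_le) auto
        show "norm (vline v powr of_real ?p) \<le> 2 powr \<bar>?p\<bar>" by (rule norm_vline_powr_le[OF v])
      qed (use D(1) in \<open>auto simp: c0_def\<close>)
      finally show ?thesis by (simp add: power_mult_distrib mult_ac)
    qed
    have "norm (I / of_real \<sigma> - of_real (2 * pi * c0) * H) \<le>
      integral {-1..1} (\<lambda>v. (4 * D * 2 powr \<bar>?p\<bar> * \<sigma>\<^sup>2 * c0 * exp (2 * \<kappa>)) * exp (- (\<kappa> / 2) * v\<^sup>2))"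
      unfolding integral_unique[OF dI, symmetric]
      by (rule integral_norm_bound_integral[OF has_integral_integrable[OF dI] integrable_on_mult_right[OF
          gI] pw])
    also have "\<dots> \<le> (4 * D * 2 powr \<bar>?p\<bar> * \<sigma>\<^sup>2 * c0 * exp (2 * \<kappa>)) * sqrt (2 * pi / \<kappa>)"
      unfolding integral_mult_right using D(1) by (intro mult_left_mono integral_gauss_le \<kappa>(1)) (auto
          simp: c0_def)
    finally have n1: "norm (I / of_real \<sigma> - of_real (2 * pi * c0) * H) \<le>
        (4 * D * 2 powr \<bar>?p\<bar> * \<sigma>\<^sup>2 * c0 * exp (2 * \<kappa>)) * sqrt (2 * pi / \<kappa>)" .
    have s1: "\<sigma> * (2 * pi * c0) = sqrt (2 * pi) * \<sigma> powr (3 / 2 - 2 * real k)"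
    proof -
      have "\<sigma> powr (3 / 2 - 2 * real k) = \<sigma> * \<sigma> powr ?p"
        using \<sigma>(1) powr_add[of \<sigma> 1 ?p] by simp
      moreover have "2 * pi / sqrt (2 * pi) = sqrt (2 * pi)" by (rule real_div_sqrt) simp
      ultimately show ?thesis unfolding c0_def by (simp add: field_simps)
    qed
    have s2: "\<sigma> * (\<sigma>\<^sup>2 * c0 * sqrt (2 * pi / \<kappa>)) = \<sigma> powr (7 / 2 - 2 * real k) / sqrt \<kappa>"
    proof -
      have "\<sigma> powr (7 / 2 - 2 * real k) = \<sigma> ^ 3 * \<sigma> powr ?p"
        using \<sigma>(1) powr_add[of \<sigma> 3 ?p] by simp
      thus ?thesis unfolding c0_def by (simp add: real_sqrt_divide power3_eq_cube power2_eq_square)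
    qed
    have "I - of_real (sqrt (2 * pi) * \<sigma> powr (3 / 2 - 2 * real k)) * H = of_real \<sigma> * (I / of_real \<sigma> -
        of_real (2 * pi * c0) * H)"
      using \<sigma>(1) unfolding s1[symmetric] by (simp add: right_diff_distrib)
    hence "norm (I - of_real (sqrt (2 * pi) * \<sigma> powr (3 / 2 - 2 * real k)) * H) =
        \<sigma> * norm (I / of_real \<sigma> - of_real (2 * pi * c0) * H)"
      using \<sigma>(1) by (simp only: norm_mult norm_of_real abs_of_pos)
    also have "\<dots> \<le> \<sigma> * ((4 * D * 2 powr \<bar>?p\<bar> * \<sigma>\<^sup>2 * c0 * exp (2 * \<kappa>)) * sqrt (2 * pi / \<kappa>))"
      using \<sigma>(1) n1 by (intro mult_left_mono) auto
    also have "\<dots> = 4 * D * 2 powr \<bar>?p\<bar> * (\<sigma> * (\<sigma>\<^sup>2 * c0 * sqrt (2 * pi / \<kappa>)) * exp (2 * \<kappa>))"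
        by (simp only: mult_ac)
    also have "\<dots> = 4 * D * 2 powr \<bar>?p\<bar> * (\<sigma> powr (7 / 2 - 2 * real k) * exp (2 * \<kappa>) / sqrt \<kappa>)"
      unfolding s2 by simp
    finally show "norm (integral {-\<sigma>..\<sigma>} (\<lambda>\<theta>. eval_fps (triple_gf a b c) (exp (- Complex \<sigma> \<theta>)) *
        exp (of_nat n * Complex \<sigma> \<theta>)) -
      of_real (sqrt (2 * pi) * \<sigma> powr (3 / 2 - 2 * real k)) * (of_real A * hankel (2 * real k - 3 / 2) \<kappa>
          + of_real (B * \<sigma>) * hankel (2 * real k - 5 / 2) \<kappa>))
      \<le> 4 * D * 2 powr \<bar>?p\<bar> * (\<sigma> powr (7 / 2 - 2 * real k) * exp (2 * \<kappa>) / sqrt \<kappa>)"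
      unfolding I_def f_def H_def .
  qed
qed

lemma triple_gf_coeff_asymp:
  fixes a b c :: nat
  defines "k \<equiv> a + b + c"
  defines "A \<equiv> (2 * pi) ^ (2 * k) * xi3 a b c / 2" and "B \<equiv> (2 * pi) ^ (2 * k) * xi3' a b c / (4 * pi\<^sup>2)"
  shows "\<exists>C\<ge>0. \<forall>\<sigma> \<kappa> n. 0 < \<sigma> \<longrightarrow> \<sigma> \<le> 1 / 2 \<longrightarrow> \<kappa> \<ge> 2 \<longrightarrow> pi\<^sup>2 / 6 = \<kappa> * \<sigma> \<longrightarrow> (real n - 1 / 24) * \<sigma> = \<kappa> \<longrightarrow>
    norm (of_real (2 * pi) * fps_nth (triple_gf a b c) n -
      of_real (sqrt (2 * pi) * \<sigma> powr (3 / 2 - 2 * real k)) * (of_real A * hankel (2 * real k - 3 / 2) \<kappa>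
          + of_real (B * \<sigma>) * hankel (2 * real k - 5 / 2) \<kappa>))
    \<le> C * (\<sigma> powr (7 / 2 - 2 * real k) * exp (2 * \<kappa>) / sqrt \<kappa> + exp (2 * \<kappa> - 1 / (40 * \<sigma>)) / \<sigma> ^ (2 *
        k))"
proof -
  obtain C where C: "C \<ge> 0" "\<And>\<sigma> \<kappa> n. 0 < \<sigma> \<Longrightarrow> \<sigma> \<le> 1 / 2 \<Longrightarrow> \<kappa> \<ge> 2 \<Longrightarrow> pi\<^sup>2 / 6 = \<kappa> * \<sigma> \<Longrightarrow>
      (real n - 1 / 24) * \<sigma> = \<kappa> \<Longrightarrow>
    norm (integral {-\<sigma>..\<sigma>} (\<lambda>\<theta>. eval_fps (triple_gf a b c) (exp (- Complex \<sigma> \<theta>)) * exp (of_nat n *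
        Complex \<sigma> \<theta>)) -
      of_real (sqrt (2 * pi) * \<sigma> powr (3 / 2 - 2 * real k)) * (of_real A * hankel (2 * real k - 3 / 2) \<kappa>
          + of_real (B * \<sigma>) * hankel (2 * real k - 5 / 2) \<kappa>))
    \<le> C * (\<sigma> powr (7 / 2 - 2 * real k) * exp (2 * \<kappa>) / sqrt \<kappa>)"
    using major_arc[of a b c] unfolding k_def A_def B_def by blast
  obtain M where M: "M \<ge> 0" "\<And>\<sigma> \<theta>. 0 < \<sigma> \<Longrightarrow> \<sigma> \<le> 1 / 2 \<Longrightarrow> \<sigma> \<le> \<bar>\<theta>\<bar> \<Longrightarrow> \<bar>\<theta>\<bar> \<le> pi \<Longrightarrow>
     norm (eval_fps (triple_gf a b c) (exp (- Complex \<sigma> \<theta>))) \<le> M * exp (pi\<^sup>2 / 6 / \<sigma> - 1 / (40 * \<sigma>)) / \<sigma> ^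
         (2 * k)"
    using minor_arc_bound[of a b c] unfolding k_def by blast
  show ?thesis
  \<comment> \<open>There are two outer arcs of length at most pi each; \<open>exp 1\<close> covers
    the excess \<sigma> / 24 of n \<sigma> over \<kappa>.\<close>
  proof (intro exI[of _ "C + 2 * pi * M * exp 1"] conjI allI impI)
    show "0 \<le> C + 2 * pi * M * exp 1" using C(1) M(1) by simp
    fix \<sigma> \<kappa> :: real and n :: nat
    assume \<sigma>: "0 < \<sigma>" "\<sigma> \<le> 1 / 2" and \<kappa>: "\<kappa> \<ge> 2" "pi\<^sup>2 / 6 = \<kappa> * \<sigma>" "(real n - 1 / 24) * \<sigma> = \<kappa>"
    define f where "f = (\<lambda>\<theta>. eval_fps (triple_gf a b c) (exp (- Complex \<sigma> \<theta>)) * exp (of_nat n *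
        Complex \<sigma> \<theta>))"
    define main where "main = of_real (sqrt (2 * pi) * \<sigma> powr (3 / 2 -
        2 * real k)) * (of_real A * hankel (2 * real k - 3 / 2) \<kappa> + of_real (B * \<sigma>) * hankel (2 * real k
        - 5 / 2) \<kappa>)"
    define e1 where "e1 = \<sigma> powr (7 / 2 - 2 * real k) * exp (2 * \<kappa>) / sqrt \<kappa>"
    define e2 where "e2 = exp (2 * \<kappa> - 1 / (40 * \<sigma>)) / \<sigma> ^ (2 * k)"
    have e: "e1 \<ge> 0" "e2 \<ge> 0" using \<kappa>(1) \<sigma>(1) by (auto simp: e1_def e2_def)
    have fI: "(f has_integral of_real (2 * pi) * fps_nth (triple_gf a b c) n) {-pi..pi}"
      unfolding f_def by (rule Cauchy_coeff_eq[OF triple_gf_conv_radius \<sigma>(1)])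
    note fi = has_integral_integrable[OF fI]
    have \<sigma>pi: "\<sigma> \<le> pi" using \<sigma> pi_gt3 by simp
    have sub: "f integrable_on {u..v}" if "-pi \<le> u" "v \<le> pi" for u v
      using that by (intro integrable_on_subinterval[OF fi]) auto
    have n: "real n * \<sigma> \<le> \<kappa> + 1" using \<kappa>(3) \<sigma> by (simp add: algebra_simps)
    have fb: "norm (f \<theta>) \<le> M * exp 1 * e2" if "\<sigma> \<le> \<bar>\<theta>\<bar>" "\<bar>\<theta>\<bar> \<le> pi" for \<theta>
    proof -
      have "pi\<^sup>2 / 6 / \<sigma> = \<kappa>" using \<kappa>(2) \<sigma>(1) by (simp add: field_simps)
      hence "norm (f \<theta>) \<le> (M * exp (\<kappa> - 1 / (40 * \<sigma>)) / \<sigma> ^ (2 * k)) * exp (\<kappa> + 1)"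
        unfolding f_def norm_mult using M(2)[OF \<sigma> that] n M(1) \<sigma>(1)
        by (intro mult_mono) (auto simp: norm_exp_eq_Re)
      also have "\<dots> = M * exp 1 * e2"
        unfolding e2_def by (simp add: exp_add[symmetric] field_simps)
      finally show ?thesis .
    qed
    have arc: "norm (integral {u..v} f) \<le> pi * (M * exp 1 * e2)" if uv: "-pi \<le> u" "v \<le> pi" "u \<le> v"
        "v - u \<le> pi" and ge: "\<And>\<theta>. \<theta> \<in> {u..v} \<Longrightarrow> \<sigma> \<le> \<bar>\<theta>\<bar>" for u v
    proof -
      have "norm (integral {u..v} f) \<le> (M * exp 1 * e2) * measure lborel {u..v}"
      proof (rule has_integral_bound_real[OF _ _ integrable_integral[OF sub[OF uv(1,2)]], where S =
          "{}"])
        fix x assume "x \<in> {u..v} - {}"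
        thus "norm (f x) \<le> M * exp 1 * e2" using uv ge[of x] by (intro fb) auto
      qed (use M(1) e in auto)
      also have "\<dots> \<le> (M * exp 1 * e2) * pi" using uv M(1) e by (intro mult_left_mono) auto
      finally show ?thesis by (simp only: mult.commute)
    qed
    have "of_real (2 * pi) * fps_nth (triple_gf a b c) n = integral {-pi..-\<sigma>} f + integral {-\<sigma>..\<sigma>} f +
        integral {\<sigma>..pi} f"
      using integral_unique[OF fI] Henstock_Kurzweil_Integration.integral_combine[of "-pi"
          "\<sigma>" pi f] Henstock_Kurzweil_Integration.integral_combine[of "-pi" "-\<sigma>" \<sigma> f] \<sigma>(1) \<sigma>pi fi sub[of
          "-pi" \<sigma>] by simp
    hence "of_real (2 * pi) * fps_nth (triple_gf a b c) n - main = integral {-pi..-\<sigma>} f +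
        (integral {-\<sigma>..\<sigma>} f - main) + integral {\<sigma>..pi} f" by simp
    also have "norm \<dots> \<le> pi * (M * exp 1 * e2) + C * e1 + pi * (M * exp 1 * e2)"
    proof (intro norm_triangle_mono arc)
      show "norm (integral {-\<sigma>..\<sigma>} f - main) \<le> C * e1"
        using C(2)[OF \<sigma> \<kappa>] unfolding f_def main_def e1_def .
    qed (use \<sigma> \<sigma>pi in auto)
    also have "\<dots> \<le> (C + 2 * pi * M * exp 1) * (e1 + e2)"
      using e C(1) M(1) by (simp add: algebra_simps)
    finally show "norm (of_real (2 * pi) * fps_nth (triple_gf a b c) n -
      of_real (sqrt (2 * pi) * \<sigma> powr (3 / 2 - 2 * real k)) * (of_real A * hankel (2 * real k - 3 / 2) \<kappa>
          + of_real (B * \<sigma>) * hankel (2 * real k - 5 / 2) \<kappa>))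
      \<le> (C + 2 * pi * M * exp 1) * (\<sigma> powr (7 / 2 - 2 * real k) * exp (2 * \<kappa>) / sqrt \<kappa> + exp (2 * \<kappa> - 1 /
          (40 * \<sigma>)) / \<sigma> ^ (2 * k))"
      unfolding main_def e1_def e2_def .
  qed
qed

section \<open>From the integral to powers of n\<close>

text \<open>For k = 0 the orders -3/2 and -5/2 belong to the downward family - n - 1/2; for k \<ge>
  1 both orders have the form n - 1/2 with a natural number n.\<close>

lemma near_orders: "near (2 * real k - 3 / 2)" "near (2 * real k - 5 / 2)"
proof -
  have "near (2 * real k - 3 / 2) \<and> near (2 * real k - 5 / 2)"
  proof (cases k)
    case 0
    thus ?thesis using near_half_integer(2)[of 1] near_half_integer(2)[of 2] by simp
  next
    case (Suc j)
    have "2 * real k - 3 / 2 = real (2 * j + 1) - 1 / 2" "2 * real k - 5 / 2 = real (2 * j) - 1 / 2"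
      using Suc by simp_all
    thus ?thesis using near_half_integer(1) by metis
  qed
  thus "near (2 * real k - 3 / 2)" "near (2 * real k - 5 / 2)" by auto
qed

text \<open>Applied with w = 2 pi. For p = 3/2 the power w^2, halved, is 2 pi times the factor pi of
  the first Bessel term; for p = 5/2 the power w^3 divided by 4 pi^2 is 2 pi, so the second term has
  none.\<close>

lemma powr_scale:
  assumes "w > 0" "X > 0"
  shows "sqrt w * (w / X) powr (p - 2 * real k) * w ^ (2 * k) = w powr (p + 1 / 2) * X powr (2 * real k -
      p)"
proof -
  have "w ^ (2 * k) = w powr (2 * real k)" using assms by (simp add: powr_realpow[symmetric])
  moreover have "X powr (2 * real k - p) = 1 / X powr (p - 2 * real k)"
    using powr_minus_divide[of X "p - 2 * real k"] by simp
  moreover have "w powr (p + 1 / 2) = w powr (1 / 2) * w powr (p - 2 * real k) * w powr (2 * real k)"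
    by (simp add: powr_add[symmetric] add.commute)
  ultimately show ?thesis using assms by (simp add: powr_half_sqrt powr_divide)
qed

text \<open>Stated in X = sqrt(24 n - 1) instead of n, so that \<sigma> = 2 pi / X and \<kappa> = pi
  X / 12 are monomials and all error terms compare as powers of X times exponentials.\<close>

lemma triple_moment_error:
  fixes a b c :: nat
  defines "k \<equiv> a + b + c"
  shows "\<exists>C X0. X0 > 0 \<and> (\<forall>n X. X \<ge> X0 \<longrightarrow> X\<^sup>2 = 24 * real n - 1 \<longrightarrow>
    \<bar>triple_crank_moment (2 * a) (2 * b) (2 * c) n -
      (pi * xi3 a b c * X powr (2 * real k - 3 / 2) * bessel_I (3 / 2 - 2 * real k) (pi / 6 * X) +
       xi3' a b c * X powr (2 * real k - 5 / 2) * bessel_I (5 / 2 - 2 * real k) (pi / 6 * X))\<bar>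
    \<le> C * (X powr (2 * real k - 4) * exp (pi / 6 * X)))"
proof -
  define A where "A = (2 * pi) ^ (2 * k) * xi3 a b c / 2"
  define B where "B = (2 * pi) ^ (2 * k) * xi3' a b c / (4 * pi\<^sup>2)"
  obtain C where C: "C \<ge> 0" "\<And>\<sigma> \<kappa> n. 0 < \<sigma> \<Longrightarrow> \<sigma> \<le> 1 / 2 \<Longrightarrow> \<kappa> \<ge> 2 \<Longrightarrow> pi\<^sup>2 / 6 = \<kappa> * \<sigma> \<Longrightarrow>
      (real n - 1 / 24) * \<sigma> = \<kappa> \<Longrightarrow>
    norm (of_real (2 * pi) * fps_nth (triple_gf a b c) n -
      of_real (sqrt (2 * pi) * \<sigma> powr (3 / 2 - 2 * real k)) * (of_real A * hankel (2 * real k - 3 / 2) \<kappa>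
          + of_real (B * \<sigma>) * hankel (2 * real k - 5 / 2) \<kappa>))
    \<le> C * (\<sigma> powr (7 / 2 - 2 * real k) * exp (2 * \<kappa>) / sqrt \<kappa> + exp (2 * \<kappa> - 1 / (40 * \<sigma>)) / \<sigma> ^ (2 *
        k))"
    using triple_gf_coeff_asymp[of a b c] unfolding k_def A_def B_def by blast
  obtain D where D: "D \<ge> 0" "\<And>\<kappa>. \<kappa> \<ge> 1 \<Longrightarrow> norm (hankel (2 * real k - 3 / 2) \<kappa> -
      of_real (bessel_I (- (2 * real k - 3 / 2)) (2 * \<kappa>))) \<le> D * exp (3 * \<kappa> / 2)"
    using near_orders(1)[of k] unfolding near_def by blast
  obtain E where E: "E \<ge> 0" "\<And>\<kappa>. \<kappa> \<ge> 1 \<Longrightarrow> norm (hankel (2 * real k - 5 / 2) \<kappa> -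
      of_real (bessel_I (- (2 * real k - 5 / 2)) (2 * \<kappa>))) \<le> E * exp (3 * \<kappa> / 2)"
    using near_orders(2)[of k] unfolding near_def by blast
  \<comment> \<open>For the minor arc: its power X^(2 k) exceeds the target X^(2 k - 4) by X^4, and
    1 / (40 \<sigma>) is X / (80 pi).\<close>
  have "\<forall>\<^sub>F X in at_top. X ^ 4 * exp (- (X / (80 * pi))) \<le> (1::real)" by real_asymp
  then obtain Y1 where Y1: "\<forall>X\<ge>Y1. X ^ 4 * exp (- (X / (80 * pi))) \<le> (1::real)"
    unfolding eventually_at_top_linorder by (elim exE)
  \<comment> \<open>For the truncation error: exp(3 \<kappa> / 2) is below exp(2 \<kappa>) by exp(-
    pi X / 24), and the powers of X differ by 5/2.\<close>
  have "\<forall>\<^sub>F X in at_top. X powr (5 / 2) * exp (- (pi / 24 * X)) \<le> (1::real)" by real_asymp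
  then obtain Y2 where Y2: "\<forall>X\<ge>Y2. X powr (5 / 2) * exp (- (pi / 24 * X)) \<le> (1::real)"
    unfolding eventually_at_top_linorder by (elim exE)
  define Y where "Y = max Y1 Y2"
  have Y: "X \<ge> Y \<Longrightarrow> X ^ 4 * exp (- (X / (80 * pi))) \<le> 1"
      "X \<ge> Y \<Longrightarrow> X powr (5 / 2) * exp (- (pi / 24 * X)) \<le> 1" for X
    using Y1 Y2 by (simp_all add: Y_def)
  let ?w = "2 * pi"
  define c1 where "c1 = C * (?w powr (7 / 2 - 2 * real k) / sqrt (pi / 12))"
  define c2 where "c2 = C / ?w ^ (2 * k)"
  define c3 where "c3 = sqrt ?w * ?w powr (3 / 2 - 2 * real k) * (\<bar>A\<bar> * D + \<bar>B\<bar> * E)"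
  show ?thesis
  \<comment> \<open>The bound X \<ge> 24 ensures 2 pi / X \<le> 1/2 and pi X / 12 \<ge> 2.\<close>
  proof (rule exI[of _ "(c1 + c2 + c3) / (2 * pi)"], rule exI[of _ "max Y 24"], intro conjI allI impI)
    fix n :: nat and X :: real assume X: "X \<ge> max Y 24" "X\<^sup>2 = 24 * real n - 1"
    define \<sigma> where "\<sigma> = ?w / X"
    define \<kappa> where "\<kappa> = pi / 12 * X"
    define J1 where "J1 = bessel_I (3 / 2 - 2 * real k) (pi / 6 * X)"
    define J2 where "J2 = bessel_I (5 / 2 - 2 * real k) (pi / 6 * X)"
    define h1 where "h1 = hankel (2 * real k - 3 / 2) \<kappa>"
    define h2 where "h2 = hankel (2 * real k - 5 / 2) \<kappa>"
    define S where "S = sqrt ?w * \<sigma> powr (3 / 2 - 2 * real k)"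
    define R where "R = X powr (2 * real k - 4) * exp (pi / 6 * X)"
    have X0: "X > 0" using X by simp
    have \<sigma>: "0 < \<sigma>" "\<sigma> \<le> 1 / 2" using X pi_less_4 by (auto simp: \<sigma>_def field_simps)
    have \<kappa>: "\<kappa> \<ge> 2" using X pi_gt3 mult_mono[of 3 pi 24 X] by (simp add: \<kappa>_def)
    have eq: "pi\<^sup>2 / 6 = \<kappa> * \<sigma>" "(real n - 1 / 24) * \<sigma> = \<kappa>"
    proof -
      show "pi\<^sup>2 / 6 = \<kappa> * \<sigma>" using X0 by (simp add: \<kappa>_def \<sigma>_def power2_eq_square)
      have "real n - 1 / 24 = X\<^sup>2 / 24" using X(2) by simp
      thus "(real n - 1 / 24) * \<sigma> = \<kappa>"
        using X0 by (simp only:) (simp add: \<kappa>_def \<sigma>_def power2_eq_square)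
    qed
    have k2: "2 * \<kappa> = pi / 6 * X" by (simp add: \<kappa>_def)
    have R0: "R \<ge> 0" by (simp add: R_def)
    have S0: "S \<ge> 0" by (simp add: S_def)
    have t: "of_real (triple_crank_moment (2 * a) (2 * b) (2 * c) n) = fps_nth (triple_gf a b c) n"
      by (simp add: triple_crank_moment_eq triple_gf_def)
    have b1: "\<sigma> powr (7 / 2 - 2 * real k) * exp (2 * \<kappa>) / sqrt \<kappa> =
        ?w powr (7 / 2 - 2 * real k) / sqrt (pi / 12) * R"
    proof -
      have "X powr (2 * real k - 4) = X powr (- (7 / 2 - 2 * real k)) * X powr (- (1 / 2))"
          by (simp add: powr_add[symmetric])
      also have "\<dots> = 1 / (X powr (7 / 2 - 2 * real k) * sqrt X)" using X0
          by (simp only: powr_minus_divide powr_half_sqrt) simp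
      finally have x: "X powr (2 * real k - 4) = 1 / (X powr (7 / 2 - 2 * real k) * sqrt X)" .
      have q: "sqrt \<kappa> = sqrt (pi / 12) * sqrt X" unfolding \<kappa>_def by (rule real_sqrt_mult)
      show ?thesis unfolding R_def x q k2 \<sigma>_def using X0 by (simp add: powr_divide)
    qed
    have b2: "exp (2 * \<kappa> - 1 / (40 * \<sigma>)) / \<sigma> ^ (2 * k) \<le> R / ?w ^ (2 * k)"
    proof -
      have "X ^ (2 * k) = X powr (2 * real k - 4) * X ^ 4"
      proof -
        have "X ^ (2 * k) = X powr ((2 * real k - 4) + 4)" using X0
            by (simp add: powr_realpow[symmetric])
        thus ?thesis using X0 by (simp only: powr_add) simp
      qed
      moreover have s: "1 / (40 * \<sigma>) = X / (80 * pi)" by (simp add: \<sigma>_def)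
      ultimately have "exp (2 * \<kappa> - 1 / (40 * \<sigma>)) / \<sigma> ^ (2 * k) =
          R / ?w ^ (2 * k) * (X ^ 4 * exp (- (X / (80 * pi))))"
        unfolding R_def k2 s diff_conv_add_uminus exp_add using X0 by (simp add: \<sigma>_def power_divide)
      also have "\<dots> \<le> R / ?w ^ (2 * k) * 1" using Y(1)[of X] X R0 by (intro mult_left_mono) auto
      finally show ?thesis by simp
    qed
    have b3: "S * exp (3 * \<kappa> / 2) \<le> sqrt ?w * ?w powr (3 / 2 - 2 * real k) * R"
    proof -
      have "\<sigma> powr (3 / 2 - 2 * real k) = ?w powr (3 / 2 - 2 * real k) * X powr (- (3 / 2 - 2 * real k))"
        unfolding \<sigma>_def using X0 by (simp only: powr_minus_divide powr_divide) (simp add: powr_divide)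
      also have "X powr (- (3 / 2 - 2 * real k)) = X powr (2 * real k - 4) * X powr (5 / 2)"
          by (simp add: powr_add[symmetric])
      finally have "S = sqrt ?w * ?w powr (3 / 2 - 2 * real k) * (X powr (2 * real k -
          4) * X powr (5 / 2))" by (simp add: S_def)
      moreover have "exp (3 * \<kappa> / 2) = exp (pi / 6 * X) * exp (- (pi / 24 * X))"
          by (simp add: \<kappa>_def exp_add[symmetric])
      ultimately have "S * exp (3 * \<kappa> / 2) = sqrt ?w * ?w powr (3 / 2 -
          2 * real k) * R * (X powr (5 / 2) * exp (- (pi / 24 * X)))"
        unfolding R_def by (simp only: mult_ac)
      also have "\<dots> \<le> sqrt ?w * ?w powr (3 / 2 - 2 * real k) * R * 1" using Y(2)[of X] X R0
          by (intro mult_left_mono) auto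
      finally show ?thesis by simp
    qed
    have m1: "S * A = 2 * pi * (pi * xi3 a b c * X powr (2 * real k - 3 / 2))"
      using powr_scale[of ?w X "3 / 2" k] X0 unfolding S_def \<sigma>_def A_def by (simp add: power2_eq_square)
    have m2: "S * (B * \<sigma>) = 2 * pi * (xi3' a b c * X powr (2 * real k - 5 / 2))"
    proof -
      have "\<sigma> powr (5 / 2 - 2 * real k) = \<sigma> powr (3 / 2 - 2 * real k) * \<sigma>"
        using \<sigma>(1) powr_add[of \<sigma> "3 / 2 - 2 * real k" 1] by simp
      hence "S * (B * \<sigma>) = (sqrt ?w * (?w / X) powr (5 / 2 - 2 * real k) * ?w ^ (2 * k)) * (xi3' a b c /
          (4 * pi\<^sup>2))"
        unfolding S_def B_def \<sigma>_def[symmetric] by simp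
      also have "\<dots> = 2 * pi * (xi3' a b c * X powr (2 * real k - 5 / 2))"
        using powr_scale[of ?w X "5 / 2" k] X0 by (simp add: power2_eq_square power3_eq_cube)
      finally show ?thesis .
    qed
    have "norm (of_real (2 * pi) * fps_nth (triple_gf a b c) n - of_real S * (of_real A * h1 +
        of_real (B * \<sigma>) * h2)) \<le> C * (?w powr (7 / 2 - 2 * real k) / sqrt (pi / 12) * R + R / ?w ^ (2 *
        k))"
      unfolding h1_def h2_def S_def b1[symmetric]
      by (rule order_trans[OF C(2)[OF \<sigma> \<kappa> eq] mult_left_mono[OF add_left_mono[OF b2] C(1)]])
    hence n1: "norm (of_real (2 * pi) * fps_nth (triple_gf a b c) n - of_real S * (of_real A * h1 +
        of_real (B * \<sigma>) * h2)) \<le> (c1 + c2) * R"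
      unfolding c1_def c2_def by (simp add: algebra_simps)
    have d1: "norm (h1 - of_real J1) \<le> D * exp (3 * \<kappa> / 2)"
      using D(2)[of \<kappa>] \<kappa> unfolding h1_def J1_def k2[symmetric] by simp
    have d2: "norm (h2 - of_real J2) \<le> E * exp (3 * \<kappa> / 2)"
      using E(2)[of \<kappa>] \<kappa> unfolding h2_def J2_def k2[symmetric] by simp
    have "norm (of_real S * (of_real A * (h1 - of_real J1) + of_real (B * \<sigma>) * (h2 - of_real J2))) \<le>
        S * (\<bar>A\<bar> * (D * exp (3 * \<kappa> / 2)) + \<bar>B\<bar> * (E * exp (3 * \<kappa> / 2)))"
    proof -
      have "\<bar>B * \<sigma>\<bar> \<le> \<bar>B\<bar>" using \<sigma> by (simp add: abs_mult mult_left_le)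
      hence "norm (of_real A * (h1 - of_real J1) + of_real (B * \<sigma>) * (h2 - of_real J2)) \<le>
          \<bar>A\<bar> * (D * exp (3 * \<kappa> / 2)) + \<bar>B\<bar> * (E * exp (3 * \<kappa> / 2))"
        by (intro norm_triangle_mono) (simp_all only: norm_mult norm_of_real, auto intro!: mult_mono d1
            d2)
      thus ?thesis using S0 by (simp only: norm_mult norm_of_real abs_of_nonneg mult_left_mono)
    qed
    also have "\<dots> = (S * exp (3 * \<kappa> / 2)) * (\<bar>A\<bar> * D + \<bar>B\<bar> * E)" by (simp add: algebra_simps)
    also have "\<dots> \<le> (sqrt ?w * ?w powr (3 / 2 - 2 * real k) * R) * (\<bar>A\<bar> * D + \<bar>B\<bar> * E)"
      using D(1) E(1) by (intro mult_right_mono b3) auto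
    finally have n2: "norm (of_real S * (of_real A * (h1 - of_real J1) + of_real (B * \<sigma>) * (h2 -
        of_real J2))) \<le> c3 * R"
      unfolding c3_def by (simp only: mult_ac)
    let ?d = "triple_crank_moment (2 * a) (2 * b) (2 * c) n -
      (pi * xi3 a b c * X powr (2 * real k - 3 / 2) * J1 + xi3' a b c * X powr (2 * real k - 5 / 2) *
          J2)"
    have d: "2 * pi * ?d = 2 * pi * triple_crank_moment (2 * a) (2 * b) (2 * c) n - ((S * A) * J1 +
        (S * (B * \<sigma>)) * J2)"
      unfolding m1 m2 by (simp add: algebra_simps)
    have "complex_of_real (2 * pi * ?d) = (of_real (2 * pi) * fps_nth (triple_gf a b c) n -
        of_real S * (of_real A * h1 + of_real (B * \<sigma>) * h2)) +
       of_real S * (of_real A * (h1 - of_real J1) + of_real (B * \<sigma>) * (h2 - of_real J2))"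
      unfolding d t[symmetric] by (simp add: algebra_simps)
    hence "norm (complex_of_real (2 * pi * ?d)) \<le> (c1 + c2) * R + c3 * R"
      using norm_triangle_mono[OF n1 n2] by (simp only:)
    hence "2 * pi * \<bar>?d\<bar> \<le> (c1 + c2 + c3) * R"
      unfolding norm_of_real abs_mult by (simp add: algebra_simps)
    hence "\<bar>?d\<bar> \<le> (c1 + c2 + c3) / (2 * pi) * R" by (simp add: field_simps)
    thus "\<bar>triple_crank_moment (2 * a) (2 * b) (2 * c) n -
      (pi * xi3 a b c * X powr (2 * real k - 3 / 2) * bessel_I (3 / 2 - 2 * real k) (pi / 6 * X) +
       xi3' a b c * X powr (2 * real k - 5 / 2) * bessel_I (5 / 2 - 2 * real k) (pi / 6 * X))\<bar>
      \<le> (c1 + c2 + c3) / (2 * pi) * (X powr (2 * real k - 4) * exp (pi / 6 * X))"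
      unfolding J1_def J2_def R_def .
  qed simp
qed

theorem theorem3p1:
  fixes \<alpha> \<beta> \<gamma> k :: nat
  assumes "\<alpha> + \<beta> + \<gamma> = k"
  shows "(\<lambda>n. triple_crank_moment (2 * \<alpha>) (2 * \<beta>) (2 * \<gamma>) n
            - (pi * xi3 \<alpha> \<beta> \<gamma> * (24 * real n - 1) powr (real k - 3 / 4)
                 * bessel_I (3 / 2 - 2 * real k) (y_arg n)
               + xi3' \<alpha> \<beta> \<gamma> * (24 * real n - 1) powr (real k - 5 / 4)
                 * bessel_I (3 / 2 - 2 * real k + 1) (y_arg n)))
         \<in> O(\<lambda>n. real n powr (real k - 7 / 4) * (real n powr (- (1 / 4)) * exp (y_arg n)))"
proof -
  obtain C X0 where X0: "X0 > 0" and C: "\<And>n X. X \<ge> X0 \<Longrightarrow> X\<^sup>2 = 24 * real n - 1 \<Longrightarrow>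
    \<bar>triple_crank_moment (2 * \<alpha>) (2 * \<beta>) (2 * \<gamma>) n -
      (pi * xi3 \<alpha> \<beta> \<gamma> * X powr (2 * real k - 3 / 2) * bessel_I (3 / 2 - 2 * real k) (pi / 6 * X) +
       xi3' \<alpha> \<beta> \<gamma> * X powr (2 * real k - 5 / 2) * bessel_I (5 / 2 - 2 * real k) (pi / 6 * X))\<bar>
    \<le> C * (X powr (2 * real k - 4) * exp (pi / 6 * X))"
    using triple_moment_error[of \<alpha> \<beta> \<gamma>] unfolding assms by blast
  have X_at_top: "\<forall>\<^sub>F n in sequentially. sqrt (24 * real n - 1) \<ge> X0"
    by (rule filterlim_at_top[THEN iffD1, rule_format]) real_asymp
  show ?thesis
  proof (rule bigoI[of _ "\<bar>C\<bar> * 24 powr \<bar>real k - 2\<bar>"])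
    show "\<forall>\<^sub>F n in sequentially. norm (triple_crank_moment (2 * \<alpha>) (2 * \<beta>) (2 * \<gamma>) n
            - (pi * xi3 \<alpha> \<beta> \<gamma> * (24 * real n - 1) powr (real k - 3 / 4)
                 * bessel_I (3 / 2 - 2 * real k) (y_arg n)
               + xi3' \<alpha> \<beta> \<gamma> * (24 * real n - 1) powr (real k - 5 / 4)
                 * bessel_I (3 / 2 - 2 * real k + 1) (y_arg n)))
      \<le> \<bar>C\<bar> * 24 powr \<bar>real k - 2\<bar> * norm (real n powr (real k - 7 / 4) * (real n powr (- (1 / 4)) * exp
          (y_arg n)))"
      using X_at_top eventually_ge_at_top[of 1]
    proof eventually_elim
      case (elim n)
      define X where "X = sqrt (24 * real n - 1)"
      have n: "real n \<ge> 1" using elim(2) by simp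
      have X2: "X\<^sup>2 = 24 * real n - 1" and pos: "X > 0" using n by (simp_all add: X_def)
      have pw: "X powr (2 * p) = (24 * real n - 1) powr p" for p
        unfolding X2[symmetric] powr_powr[symmetric] using pos by (simp add: powr_numeral)
      have "X powr (2 * real k - 4) = (24 * real n - 1) powr (real k - 2)"
        using pw[of "real k - 2"] by (simp add: right_diff_distrib)
      \<comment> \<open>The exponent k - 2 may be negative: then 24 n - 1 \<ge> n is used, otherwise
        24 n - 1 \<le> 24 n. The absolute value in the constant covers both cases.\<close>
      also have "\<dots> \<le> 24 powr \<bar>real k - 2\<bar> * real n powr (real k - 2)"
      proof (cases "real k \<ge> 2")
        case True
        hence "(24 * real n - 1) powr (real k - 2) \<le> (24 * real n) powr (real k - 2)"
          using n by (intro powr_mono2) auto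
        thus ?thesis using True by (simp add: powr_mult)
      next
        case False
        hence "(24 * real n - 1) powr (real k - 2) \<le> real n powr (real k - 2)"
          using n by (intro powr_mono2') auto
        also have "\<dots> \<le> 24 powr \<bar>real k - 2\<bar> * real n powr (real k - 2)"
          using ge_one_powr_ge_zero[of 24 "\<bar>real k - 2\<bar>"] by (simp add: mult_le_cancel_right1)
        finally show ?thesis .
      qed
      finally have R: "X powr (2 * real k - 4) \<le> 24 powr \<bar>real k - 2\<bar> * real n powr (real k - 2)" .
      have y: "y_arg n = pi / 6 * X" by (simp add: y_arg_def X_def)
      have e: "(24 * real n - 1) powr (real k - 3 / 4) = X powr (2 * real k - 3 / 2)"
        "(24 * real n - 1) powr (real k - 5 / 4) = X powr (2 * real k - 5 / 2)"
        "3 / 2 - 2 * real k + 1 = 5 / 2 - 2 * real k"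
        by (simp_all add: pw[symmetric] right_diff_distrib)
      have "X \<ge> X0" using elim(1) by (simp add: X_def)
      note C[OF this X2]
      also have "C * (X powr (2 * real k - 4) * exp (pi / 6 * X)) \<le> \<bar>C\<bar> * ((24 powr \<bar>real k -
          2\<bar> * real n powr (real k - 2)) * exp (pi / 6 * X))"
        using R by (intro mult_mono) auto
      also have "real n powr (real k - 2) = real n powr (real k - 7 / 4) * real n powr (- (1 / 4))"
        by (simp add: powr_add[symmetric])
      finally show ?case unfolding real_norm_def y e by (simp add: abs_mult mult_ac)
    qed
  qed
qed

end
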